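(* Let $L\subset\mathbb{R}[x_1,\dots,x_n]$ be a finite-dimensional (real) vector subspace with $1\in L$, and let $f\in\mathbb{R}[x_1,\dots,x_n]$ be a nonnegative polynomial (i.e., $f(x)\geq0$ for all $x\in\mathbb{R}^n$) which is not a sum of squares of polynomials. Suppose that, for all $y\in\mathbb{R}^n$, the coefficients of $f^h(t,x_1-y_1,\dots,x_n-y_n)$, considered as a polynomial in the variable $t$ (so that its coefficients are elements of $\mathbb{R}[x_1,\dots,x_n]$), belong to $L$. Then the set $$K=\{g\in L:\ g(x)\geq0\ \text{ for all } x\in\mathbb{R}^n\}$$ is not a spectrahedral shadow.
   Context: The homogenization of $f\in\mathbb{R}[x_1,\dots,x_n]$ is the unique homogeneous polynomial $f^h\in\mathbb{R}[t,x_1,\dots,x_n]$ of the same degree as $f$ such that $f^h(1,x_1,\dots,x_n)=f(x_1,\dots,x_n)$. A spectrahedral shadow is a subset of $\mathbb{R}^N$ of the form $\{x\in\mathbb{R}^N:\exists\,y\in\mathbb{R}^m,\ A+\sum_i x_iB_i+\sum_j y_jC_j\succeq0\}$, where $A,B_i,C_j$ are real symmetric $d\times d$ matrices for some $d$, and $\succeq0$ means positive-semidefinite. The notion applies to subsets of any finite-dimensional real vector space (here $L$) by choosing a linear isomorphism with $\mathbb{R}^N$. *)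

theory Defs
  imports "HOL-Analysis.Analysis" "HOL-Analysis.Finite_Function_Topology"
    "HOL-Computational_Algebra.Polynomial"
begin

section \<open>Real multivariate polynomials\<close>

text \<open>
  A polynomial with variables indexed by \<open>'v\<close> is a finitely supported map from exponent vectors
  to coefficients. Ring operations come from \<open>HOL-Library.Poly_Mapping\<close>, the real vector space
  structure (\<open>subspace\<close>, \<open>span\<close>) from \<open>HOL-Analysis.Finite_Function_Topology\<close>.
\<close>

type_synonym 'v mpoly = "('v \<Rightarrow>\<^sub>0 nat) \<Rightarrow>\<^sub>0 real"

definition Const :: "real \<Rightarrow> 'v mpoly" where
  "Const a = Poly_Mapping.single 0 a"

definition Var :: "'v \<Rightarrow> 'v mpoly" where
  "Var i = Poly_Mapping.single (Poly_Mapping.single i 1) 1"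

text \<open>Substitution of \<open>v\<close> for the variables; \<open>c\<close> embeds the scalars into the target ring.\<close>

definition eval_mpoly :: "(real \<Rightarrow> 'b::comm_ring_1) \<Rightarrow> ('v \<Rightarrow> 'b) \<Rightarrow> 'v mpoly \<Rightarrow> 'b" where
  "eval_mpoly c v p =
     (\<Sum>m\<in>Poly_Mapping.keys p. c (Poly_Mapping.lookup p m) *
        (\<Prod>i\<in>Poly_Mapping.keys m. v i ^ Poly_Mapping.lookup m i))"

definition value_at :: "'n mpoly \<Rightarrow> real ^ 'n::finite \<Rightarrow> real" where
  "value_at p x = eval_mpoly (\<lambda>a. a) (\<lambda>i. x $ i) p"

definition nonneg_mpoly :: "'n::finite mpoly \<Rightarrow> bool" where
  "nonneg_mpoly p \<longleftrightarrow> (\<forall>x. value_at p x \<ge> 0)"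

definition sum_of_squares :: "'v mpoly \<Rightarrow> bool" where
  "sum_of_squares p \<longleftrightarrow> (\<exists>(k::nat) q. p = (\<Sum>i<k. (q i)\<^sup>2))"

section \<open>Homogenization\<close>

definition monom_degree :: "('v \<Rightarrow>\<^sub>0 nat) \<Rightarrow> nat" where
  "monom_degree m = (\<Sum>i\<in>Poly_Mapping.keys m. Poly_Mapping.lookup m i)"

text \<open>The zero polynomial has degree 0 and is homogeneous.\<close>

definition total_degree :: "'v mpoly \<Rightarrow> nat" where
  "total_degree p = Max (insert 0 (monom_degree ` Poly_Mapping.keys p))"

definition homogeneous :: "'v mpoly \<Rightarrow> bool" where
  "homogeneous p \<longleftrightarrow> (\<exists>d. \<forall>m\<in>Poly_Mapping.keys p. monom_degree m = d)"

text \<open>In \<open>'v option mpoly\<close>, \<open>None\<close> is the homogenizing variable \<open>t\<close> and \<open>Some i\<close> is \<open>x\<^sub>i\<close>.\<close>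

definition is_homogenization :: "'v mpoly \<Rightarrow> 'v option mpoly \<Rightarrow> bool" where
  "is_homogenization f h \<longleftrightarrow>
     homogeneous h \<and> total_degree h = total_degree f \<and>
     eval_mpoly Const (case_option 1 Var) h = f"

definition homogenization :: "'v mpoly \<Rightarrow> 'v option mpoly" where
  "homogenization f = (THE h. is_homogenization f h)"

text \<open>\<open>f\<^sup>h(t, x\<^sub>1 - y\<^sub>1, \<dots>, x\<^sub>n - y\<^sub>n)\<close> as a univariate polynomial in \<open>t\<close> over the ring of
  polynomials in \<open>x\<^sub>1, \<dots>, x\<^sub>n\<close>.\<close>

definition shifted_homogenization :: "'n::finite mpoly \<Rightarrow> real ^ 'n \<Rightarrow> 'n mpoly poly" where
  "shifted_homogenization f y =
     eval_mpoly (\<lambda>a. [:Const a:])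
       (case_option [:0, 1:] (\<lambda>i. [:Var i - Const (y $ i):]))
       (homogenization f)"

section \<open>Spectrahedral shadows\<close>

text \<open>
  Sizes are bound inside the definitions, so vectors and matrices are functions on \<open>nat\<close> of which
  only the entries below the size are used; \<open>\<real>\<^sup>N\<close> is \<open>topspace (Euclidean_space N)\<close>.
\<close>

definition symmetric_matrix :: "nat \<Rightarrow> (nat \<Rightarrow> nat \<Rightarrow> real) \<Rightarrow> bool" where
  "symmetric_matrix d M \<longleftrightarrow> (\<forall>r<d. \<forall>s<d. M r s = M s r)"

definition psd_matrix :: "nat \<Rightarrow> (nat \<Rightarrow> nat \<Rightarrow> real) \<Rightarrow> bool" where
  "psd_matrix d M \<longleftrightarrow>
     symmetric_matrix d M \<and> (\<forall>v. (\<Sum>r<d. \<Sum>s<d. v r * M r s * v s) \<ge> 0)"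

definition spectrahedral_shadow :: "nat \<Rightarrow> (nat \<Rightarrow> real) set \<Rightarrow> bool" where
  "spectrahedral_shadow N S \<longleftrightarrow>
     (\<exists>d m A B C.
        symmetric_matrix d A \<and>
        (\<forall>i<N. symmetric_matrix d (B i)) \<and>
        (\<forall>j<m. symmetric_matrix d (C j)) \<and>
        S = {x \<in> topspace (Euclidean_space N).
               \<exists>y \<in> topspace (Euclidean_space m).
                 psd_matrix d (\<lambda>r s. A r s + (\<Sum>i<N. x i * B i r s) + (\<Sum>j<m. y j * C j r s))})"

definition linear_isomorphism ::
    "nat \<Rightarrow> 'a::real_vector set \<Rightarrow> ((nat \<Rightarrow> real) \<Rightarrow> 'a) \<Rightarrow> bool" where
  "linear_isomorphism N V \<phi> \<longleftrightarrow>
     bij_betw \<phi> (topspace (Euclidean_space N)) V \<and>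
     (\<forall>x\<in>topspace (Euclidean_space N). \<forall>y\<in>topspace (Euclidean_space N).
        \<phi> (\<lambda>i. x i + y i) = \<phi> x + \<phi> y) \<and>
     (\<forall>c. \<forall>x\<in>topspace (Euclidean_space N). \<phi> (\<lambda>i. c * x i) = c *\<^sub>R \<phi> x)"

text \<open>
  Which isomorphism is chosen is irrelevant, since spectrahedral shadows in \<open>\<real>\<^sup>N\<close> are stable under
  invertible linear maps.
\<close>

definition spectrahedral_shadow_in :: "'a::real_vector set \<Rightarrow> 'a set \<Rightarrow> bool" where
  "spectrahedral_shadow_in V K \<longleftrightarrow>
     (\<exists>N \<phi> S. linear_isomorphism N V \<phi> \<and> spectrahedral_shadow N S \<and> K = \<phi> ` S)"

section \<open>Existence and uniqueness of the homogenization\<close>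

context
begin

private abbreviation "restr m \<equiv> Poly_Mapping.map_key Some m"

private lemma lookup_restr: "Poly_Mapping.lookup (restr m) i = Poly_Mapping.lookup m (Some i)"
  by (simp add: map_key.rep_eq)

private lemma Var_power: "Var i ^ k = Poly_Mapping.single (Poly_Mapping.single i k) 1"
proof (induction k)
  case (Suc k)
  then show ?case
    by (simp add: Var_def mult_single flip: single_add)
qed simp

private lemma prod_single:
  "finite A \<Longrightarrow> (\<Prod>i\<in>A. Poly_Mapping.single (g i) (1::real)) = Poly_Mapping.single (\<Sum>i\<in>A. g i) 1"
  for g :: "'a \<Rightarrow> 'b::comm_monoid_add"
  by (induction A rule: finite_induct) (simp_all add: mult_single)

private lemma sum_monomials: "(\<Sum>i\<in>Poly_Mapping.keys r. Poly_Mapping.single i (Poly_Mapping.lookup r i)) = r"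
  for r :: "'a \<Rightarrow>\<^sub>0 'b::comm_monoid_add"
proof (rule poly_mapping_eqI)
  fix k
  have "Poly_Mapping.lookup (\<Sum>i\<in>Poly_Mapping.keys r. Poly_Mapping.single i (Poly_Mapping.lookup r i)) k
     = (\<Sum>i\<in>Poly_Mapping.keys r. if i = k then Poly_Mapping.lookup r i else 0)"
    by (simp add: lookup_sum lookup_single when_def)
  also have "\<dots> = Poly_Mapping.lookup r k"
    by (simp add: in_keys_iff)
  finally show "Poly_Mapping.lookup (\<Sum>i\<in>Poly_Mapping.keys r. Poly_Mapping.single i (Poly_Mapping.lookup r i)) k
      = Poly_Mapping.lookup r k" .
qed

private lemma keys_option:
  "Poly_Mapping.keys m - {None} = Some ` Poly_Mapping.keys (restr m)"
proof -
  have "x \<in> Poly_Mapping.keys m - {None} \<longleftrightarrow> x \<in> Some ` Poly_Mapping.keys (restr m)" for x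
    by (cases x) (auto simp: in_keys_iff lookup_restr)
  then show ?thesis by blast
qed

private lemma dehom_monom:
  "(\<Prod>i\<in>Poly_Mapping.keys m. case_option 1 Var i ^ Poly_Mapping.lookup m i)
     = Poly_Mapping.single (restr m) (1::real)"
proof -
  have "(\<Prod>i\<in>Poly_Mapping.keys m. case_option 1 Var i ^ Poly_Mapping.lookup m i)
      = (\<Prod>i\<in>Poly_Mapping.keys m - {None}. case_option 1 Var i ^ Poly_Mapping.lookup m i :: 'a mpoly)"
    by (rule prod.mono_neutral_right) auto
  also have "\<dots> = (\<Prod>j\<in>Poly_Mapping.keys (restr m). Var j ^ Poly_Mapping.lookup (restr m) j)"
    by (simp add: keys_option prod.reindex lookup_restr)
  also have "\<dots> = Poly_Mapping.single (restr m) 1"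
    by (simp add: Var_power prod_single sum_monomials)
  finally show ?thesis .
qed

private lemma lookup_dehom:
  "Poly_Mapping.lookup (eval_mpoly Const (case_option 1 Var) h) r =
     (\<Sum>m\<in>{m\<in>Poly_Mapping.keys h. restr m = r}. Poly_Mapping.lookup h m)"
proof -
  have "Poly_Mapping.lookup (eval_mpoly Const (case_option 1 Var) h) r =
     (\<Sum>m\<in>Poly_Mapping.keys h. if restr m = r then Poly_Mapping.lookup h m else 0)"
    by (simp add: eval_mpoly_def dehom_monom Const_def mult_single lookup_sum lookup_single when_def)
  also have "\<dots> = (\<Sum>m\<in>{m\<in>Poly_Mapping.keys h. restr m = r}. Poly_Mapping.lookup h m)"
    by (simp add: sum.If_cases Int_def)
  finally show ?thesis .
qed

private lemma monom_degree_option: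
  "monom_degree m = Poly_Mapping.lookup m None + monom_degree (restr m)"
proof -
  have "monom_degree m = (\<Sum>i\<in>insert None (Poly_Mapping.keys m). Poly_Mapping.lookup m i)"
    unfolding monom_degree_def by (rule sum.mono_neutral_left) (auto simp: in_keys_iff)
  also have "\<dots> = Poly_Mapping.lookup m None + (\<Sum>i\<in>Poly_Mapping.keys m - {None}. Poly_Mapping.lookup m i)"
    by (simp add: sum.insert_remove)
  also have "\<dots> = Poly_Mapping.lookup m None + monom_degree (restr m)"
    by (simp add: keys_option sum.reindex monom_degree_def lookup_restr)
  finally show ?thesis .
qed

private lemma restr_inj:
  assumes "restr m = restr m'" "monom_degree m = monom_degree m'"
  shows "m = m'"
proof (rule poly_mapping_eqI)
  fix k
  show "Poly_Mapping.lookup m k = Poly_Mapping.lookup m' k"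
    using assms by (cases k) (auto simp: monom_degree_option simp flip: lookup_restr)
qed

private lemma lookup_dehom_homogeneous:
  assumes "\<forall>m\<in>Poly_Mapping.keys h. monom_degree m = d" "monom_degree m = d"
  shows "Poly_Mapping.lookup (eval_mpoly Const (case_option 1 Var) h) (restr m) = Poly_Mapping.lookup h m"
proof -
  have "{m'\<in>Poly_Mapping.keys h. restr m' = restr m} = (if m \<in> Poly_Mapping.keys h then {m} else {})"
    using assms restr_inj by auto
  then show ?thesis
    by (simp add: lookup_dehom in_keys_iff)
qed

private lemma total_degree_homogeneous:
  assumes "\<forall>m\<in>Poly_Mapping.keys h. monom_degree m = d" "h \<noteq> 0"
  shows "total_degree h = d"
proof -
  have "monom_degree ` Poly_Mapping.keys h = {d}"
    using assms by (metis image_cong image_constant_conv keys_eq_empty)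
  then show ?thesis by (simp add: total_degree_def)
qed

private lemma restr_surj:
  assumes "monom_degree r \<le> d"
  shows "\<exists>m. restr m = r \<and> monom_degree m = d"
proof -
  define g where "g = (\<lambda>i. case i of None \<Rightarrow> d - monom_degree r | Some j \<Rightarrow> Poly_Mapping.lookup r j)"
  have "{i. g i \<noteq> 0} \<subseteq> insert None (Some ` Poly_Mapping.keys r)"
  proof
    fix x assume "x \<in> {i. g i \<noteq> 0}"
    then show "x \<in> insert None (Some ` Poly_Mapping.keys r)"
      by (cases x) (auto simp: g_def in_keys_iff)
  qed
  then have fin: "finite {i. g i \<noteq> 0}"
    by (rule finite_subset) simp
  define m where "m = Abs_poly_mapping g"
  have l: "Poly_Mapping.lookup m = g"
    using fin by (simp add: m_def)
  have "restr m = r"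
    by (rule poly_mapping_eqI) (simp add: lookup_restr l g_def)
  moreover have "monom_degree m = d"
    using assms by (simp add: monom_degree_option \<open>restr m = r\<close> l g_def)
  ultimately show ?thesis by blast
qed

lemma homogenization_ex1: "\<exists>!h. is_homogenization f h"
proof -
  define d where "d = total_degree f"
  define g where "g = (\<lambda>m. if monom_degree m = d then Poly_Mapping.lookup f (restr m) else 0)"
  define h where "h = Abs_poly_mapping g"
  have "finite (restr ` {m. g m \<noteq> 0})"
    by (rule finite_subset[of _ "Poly_Mapping.keys f"]) (auto simp: g_def in_keys_iff split: if_splits)
  moreover have "inj_on restr {m. g m \<noteq> 0}"
    by (auto simp: inj_on_def g_def split: if_splits intro: restr_inj)
  ultimately have "finite {m. g m \<noteq> 0}"
    by (rule finite_imageD)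
  then have l: "Poly_Mapping.lookup h = g"
    by (simp add: h_def)
  have deg: "\<forall>m\<in>Poly_Mapping.keys h. monom_degree m = d"
    by (auto simp: in_keys_iff l g_def split: if_splits)
  have ev: "eval_mpoly Const (case_option 1 Var) h = f"
  proof (rule poly_mapping_eqI)
    fix r
    show "Poly_Mapping.lookup (eval_mpoly Const (case_option 1 Var) h) r = Poly_Mapping.lookup f r"
    proof (cases "r \<in> Poly_Mapping.keys f")
      case True
      then have "monom_degree r \<le> d"
        by (simp add: d_def total_degree_def)
      then obtain m where m: "restr m = r" "monom_degree m = d"
        using restr_surj by blast
      then show ?thesis
        using lookup_dehom_homogeneous[OF deg m(2)] by (simp add: l g_def)
    next
      case False
      then have e: "{m\<in>Poly_Mapping.keys h. restr m = r} = {}"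
        by (auto simp: in_keys_iff l g_def split: if_splits)
      show ?thesis
        using False unfolding lookup_dehom e by (simp add: in_keys_iff)
    qed
  qed
  have "total_degree h = d"
  proof (cases "h = 0")
    case True
    then have "f = 0" using ev by (simp add: eval_mpoly_def)
    then show ?thesis using True by (simp add: d_def total_degree_def)
  qed (use total_degree_homogeneous deg in blast)
  then have ex: "is_homogenization f h"
    using deg ev by (auto simp: is_homogenization_def homogeneous_def d_def)
  show ?thesis
  proof (rule ex1I[where a = h])
    show "is_homogenization f h" by (rule ex)
  next
    fix h' assume h': "is_homogenization f h'"
    have deg': "\<forall>m\<in>Poly_Mapping.keys h'. monom_degree m = d"
    proof (cases "h' = 0")
      case False
      then show ?thesis
        using h' total_degree_homogeneous[of h'] unfolding is_homogenization_def homogeneous_def d_def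
        by metis
    qed simp
    show "h' = h"
    proof (rule poly_mapping_eqI)
      fix m
      show "Poly_Mapping.lookup h' m = Poly_Mapping.lookup h m"
      proof (cases "monom_degree m = d")
        case True
        then show ?thesis
          using lookup_dehom_homogeneous[OF deg True] lookup_dehom_homogeneous[OF deg' True] ev h'
          by (simp add: is_homogenization_def)
      next
        case False
        then show ?thesis using deg deg' by (metis in_keys_iff)
      qed
    qed
  qed
qed

end

lemma is_homogenization_homogenization: "is_homogenization f (homogenization f)"
  unfolding homogenization_def by (rule theI'[OF homogenization_ex1])

end

theory Submission
  imports Defs "HOL-Computational_Algebra.Polynomial_FPS"
begin

text \<open>
  Suppose the cone \<open>K\<close> of nonnegative polynomials in \<open>L\<close> is the projection of a linear matrix
  inequality \<open>S(p) \<succeq> 0\<close>. After facial reduction the inequality is strictly feasible and no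
  nonzero \<open>S(p) \<succeq> 0\<close> projects to \<open>0\<close>. By strict feasibility, evaluation at a point \<open>y\<close> is a sum
  \<open>\<Sum> V\<^sub>l\<^sup>T S(p) V\<^sub>l\<close>. If \<open>y\<close> is generic, there is a derivation of \<open>\<real>\<close> into \<open>\<real>[z]\<close> that
  kills all constants of the representation and sends \<open>y\<^sub>i\<close> to \<open>z\<^sub>i\<close>; exponentiating it gives a ring
  homomorphism \<open>\<real> \<rightarrow> \<real>[z][[\<tau>]]\<close> with \<open>y\<^sub>i \<mapsto> y\<^sub>i + \<tau> z\<^sub>i\<close>, which turns the certificate at \<open>y\<close> into one
  at \<open>y + \<tau> z\<close> with coefficients that are power series in \<open>\<tau>\<close>. Truncate it at order \<open>e = deg f\<close> and
  pair it with matrices lifting \<open>f\<^sup>h(t, x - y) \<in> K\<close>, which stay bounded as \<open>t \<rightarrow> 0\<close>: since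
  \<open>f\<^sup>h(t, t z) = t\<^sup>e f(z)\<close>, dividing by \<open>t\<^sup>e\<close> exhibits \<open>f\<close> as a limit of sums of squares with bounded
  support, hence as a sum of squares.
\<close>

section \<open>Quadratic forms on finite index sets\<close>

text \<open>The obstacle is that a certificate at \<open>y\<close> is a mere tuple \<open>V\<close>
  of real numbers, chosen without any continuity in \<open>y\<close>, so it cannot be moved along
  with \<open>y\<close> by analysis. Genericity replaces regularity. Over the countable field
  generated by the constants of the representation, transcendental coordinates can be given any
  derivatives at will; extending the derivation from there to all reals is what lets it act on the
  uncontrolled entries of \<open>V\<close>. The point obtained depends on the representation and is
  not known beforehand, which is why \<open>L\<close> has to contain the coefficients for every
  \<open>y\<close>. For \<open>t > 0\<close> one has f^h(t, x - y) = t^e f((x - y)/t), which is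
  where nonnegativity of \<open>f\<close> enters. Strict feasibility makes the dual certificate
  exist exactly, not just in a limit. Triviality of the fibre over zero makes lifts of a bounded
  family bounded. This is decisive at the end: truncation leaves an error t^(e+1) times the lift,
  and after division by t^e it tends to zero because the lifts do not blow up.\<close>

definition qf :: "'i set \<Rightarrow> ('i \<Rightarrow> 'i \<Rightarrow> real) \<Rightarrow> ('i \<Rightarrow> real) \<Rightarrow> ('i \<Rightarrow> real) \<Rightarrow> real" where
  "qf I S x y = (\<Sum>r\<in>I. \<Sum>s\<in>I. x r * S r s * y s)"

text \<open>The index set is a parameter and not a type because facial reduction deletes indices one
  at a time. Symmetry is stated separately, by \<open>symm_on\<close>.\<close>

definition nonneg_form :: "'i set \<Rightarrow> ('i \<Rightarrow> 'i \<Rightarrow> real) \<Rightarrow> bool" where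
  "nonneg_form I S \<longleftrightarrow> (\<forall>x. 0 \<le> qf I S x x)"

definition symm_on :: "'i set \<Rightarrow> ('i \<Rightarrow> 'i \<Rightarrow> real) \<Rightarrow> bool" where
  "symm_on I S \<longleftrightarrow> (\<forall>r\<in>I. \<forall>s\<in>I. S r s = S s r)"

definition unit_vec :: "'i \<Rightarrow> 'i \<Rightarrow> real" where
  "unit_vec r s = (if s = r then 1 else 0)"

lemma qf_add_left: "qf I S (\<lambda>r. x r + c * x' r) y = qf I S x y + c * qf I S x' y"
  by (simp add: qf_def algebra_simps sum.distrib sum_distrib_left)

lemma qf_add_right: "qf I S y (\<lambda>r. x r + c * x' r) = qf I S y x + c * qf I S y x'"
  by (simp add: qf_def algebra_simps sum.distrib sum_distrib_left)

lemma qf_scale: "qf I S (\<lambda>r. c * x r) (\<lambda>r. c * y r) = c\<^sup>2 * qf I S x y"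
  by (simp add: qf_def algebra_simps sum_distrib_left power2_eq_square)

lemma symm_onD: "symm_on I S \<Longrightarrow> r \<in> I \<Longrightarrow> s \<in> I \<Longrightarrow> S r s = S s r"
  by (simp add: symm_on_def)

lemma qf_commute: "symm_on I S \<Longrightarrow> qf I S x y = qf I S y x"
proof -
  assume S: "symm_on I S"
  have "qf I S x y = (\<Sum>s\<in>I. \<Sum>r\<in>I. x r * S r s * y s)"
    unfolding qf_def by (rule sum.swap)
  also have "\<dots> = qf I S y x"
    unfolding qf_def using S by (intro sum.cong) (auto simp: symm_on_def)
  finally show ?thesis .
qed

lemma qf_expand:
  assumes "symm_on I S"
  shows "qf I S (\<lambda>r. x r + c * y r) (\<lambda>r. x r + c * y r)
    = qf I S x x + 2 * c * qf I S x y + c\<^sup>2 * qf I S y y"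
  by (simp only: qf_add_left qf_add_right qf_commute[OF assms, of y x])
    (simp add: algebra_simps power2_eq_square)

lemma qf_cong:
  assumes "\<And>r. r \<in> I \<Longrightarrow> x r = x' r" "\<And>r. r \<in> I \<Longrightarrow> y r = y' r"
    "\<And>r s. r \<in> I \<Longrightarrow> s \<in> I \<Longrightarrow> S r s = S' r s"
  shows "qf I S x y = qf I S' x' y'"
  unfolding qf_def using assms by (intro sum.cong) auto

lemma qf_unit_left:
  assumes "finite I" "r \<in> I"
  shows "qf I S (unit_vec r) y = (\<Sum>s\<in>I. S r s * y s)"
proof -
  have "qf I S (unit_vec r) y = (\<Sum>r'\<in>I. if r' = r then (\<Sum>s\<in>I. S r' s * y s) else 0)"
    unfolding qf_def by (intro sum.cong) (auto simp: unit_vec_def)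
  then show ?thesis using assms by simp
qed

lemma qf_unit_unit:
  assumes "finite I" "r \<in> I" "s \<in> I"
  shows "qf I S (unit_vec r) (unit_vec s) = S r s"
  using assms by (simp add: qf_unit_left unit_vec_def if_distrib cong: if_cong)

lemma qf_restrict:
  assumes "finite I" "r \<in> I" "x r = 0"
  shows "qf I S x x = qf (I - {r}) S x x"
proof -
  have "qf I S x x = (\<Sum>a\<in>I - {r}. \<Sum>s\<in>I. x a * S a s * x s)"
    unfolding qf_def using assms by (intro sum.mono_neutral_right) auto
  also have "\<dots> = qf (I - {r}) S x x"
    unfolding qf_def using assms by (intro sum.cong refl sum.mono_neutral_right) auto
  finally show ?thesis .
qed

text \<open>Bilinearity in both arguments. With \<open>E s\<close> running through a basis of a
  subspace, this writes the restricted form as a matrix on the smaller index set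
  \<open>I'\<close>.\<close>

lemma qf_congruence:
  assumes "finite I'"
  shows "qf I S (\<lambda>a. \<Sum>s\<in>I'. x s * E s a) (\<lambda>a. \<Sum>s\<in>I'. y s * E s a)
    = qf I' (\<lambda>s s'. qf I S (E s) (E s')) x y"
proof -
  have 1: "qf I S (\<lambda>a. \<Sum>s\<in>I'. x s * E s a) w = (\<Sum>s\<in>I'. x s * qf I S (E s) w)" for w
    using assms
  proof (induction I' rule: finite_induct)
    case empty
    show ?case by (simp add: qf_def)
  next
    case (insert t F)
    have "qf I S (\<lambda>a. \<Sum>s\<in>insert t F. x s * E s a) w
      = qf I S (\<lambda>a. (\<Sum>s\<in>F. x s * E s a) + x t * E t a) w"
      using insert by (simp add: add.commute)
    also have "\<dots> = (\<Sum>s\<in>insert t F. x s * qf I S (E s) w)"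
      using insert by (simp add: qf_add_left)
    finally show ?case .
  qed
  have 2: "qf I S w (\<lambda>a. \<Sum>s\<in>I'. y s * E s a) = (\<Sum>s\<in>I'. y s * qf I S w (E s))" for w
    using assms
  proof (induction I' rule: finite_induct)
    case empty
    show ?case by (simp add: qf_def)
  next
    case (insert t F)
    have "qf I S w (\<lambda>a. \<Sum>s\<in>insert t F. y s * E s a)
      = qf I S w (\<lambda>a. (\<Sum>s\<in>F. y s * E s a) + y t * E t a)"
      using insert by (simp add: add.commute)
    also have "\<dots> = (\<Sum>s\<in>insert t F. y s * qf I S w (E s))"
      using insert by (simp add: qf_add_right)
    finally show ?case .
  qed
  show ?thesis
    unfolding 1 2 by (simp add: qf_def[of I'] sum_distrib_left algebra_simps)
qed

lemma nonneg_formD: "nonneg_form I S \<Longrightarrow> 0 \<le> qf I S x x"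
  by (simp add: nonneg_form_def)

lemma nonneg_form_Cauchy_Schwarz:
  assumes S: "symm_on I S" "nonneg_form I S"
  shows "(qf I S x y)\<^sup>2 \<le> qf I S x x * qf I S y y"
proof -
  let ?a = "qf I S x x" and ?b = "qf I S x y" and ?c = "qf I S y y"
  have q: "0 \<le> ?a + 2 * l * ?b + l\<^sup>2 * ?c" for l
    using nonneg_formD[OF S(2)] by (simp flip: qf_expand[OF S(1)])
  show ?thesis
  proof (cases "?c = 0")
    case True
    have "?b = 0"
    proof (rule ccontr)
      assume "?b \<noteq> 0"
      \<comment> \<open>At this \<open>l\<close> the affine function \<open>?a + 2 * l * ?b\<close>
        takes the value -1.\<close>
      then show False
        using q[of "- (?a + 1) / (2 * ?b)"] True by (simp add: field_simps)
    qed
    then show ?thesis using True by simp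
  next
    case False
    then have c: "?c > 0"
      using nonneg_formD[OF S(2), of y] by linarith
    \<comment> \<open>The chosen \<open>l\<close> minimizes the quadratic polynomial.\<close>
    have "0 \<le> ?a + 2 * (- ?b / ?c) * ?b + (- ?b / ?c)\<^sup>2 * ?c" by (rule q)
    also have "\<dots> = ?a - ?b\<^sup>2 / ?c"
      using False by (simp add: field_simps power2_eq_square)
    finally show ?thesis
      using c by (simp add: field_simps)
  qed
qed

lemma nonneg_form_kernel:
  assumes S: "symm_on I S" "nonneg_form I S" and "qf I S x x = 0"
  shows "qf I S x y = 0"
  using nonneg_form_Cauchy_Schwarz[OF S, of x y] assms(3) by simp

lemma nonneg_form_diag: "nonneg_form I S \<Longrightarrow> finite I \<Longrightarrow> r \<in> I \<Longrightarrow> 0 \<le> S r r"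
  using nonneg_formD[of I S "unit_vec r"] by (simp add: qf_unit_unit)

lemma nonneg_form_insert_restrict:
  assumes "finite I" "r \<notin> I" "nonneg_form (insert r I) U"
  shows "nonneg_form I U"
  unfolding nonneg_form_def
proof
  fix x :: "'a \<Rightarrow> real"
  let ?x = "\<lambda>s. if s = r then 0 else x s"
  have "qf (insert r I) U ?x ?x = qf (insert r I - {r}) U ?x ?x"
    using assms by (intro qf_restrict) auto
  also have "\<dots> = qf I U x x"
    using assms by (simp, intro qf_cong) auto
  finally show "0 \<le> qf I U x x"
    using nonneg_formD[OF assms(3), of ?x] by simp
qed

lemma qf_insert:
  assumes "finite I" "r \<notin> I" "symm_on (insert r I) U"
  shows "qf (insert r I) U x x = qf I U x x + 2 * x r * (\<Sum>s\<in>I. U r s * x s) + (x r)\<^sup>2 * U r r"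
proof -
  have "(\<Sum>s\<in>I. x s * U s r * x r) = x r * (\<Sum>s\<in>I. U r s * x s)"
    unfolding sum_distrib_left by (intro sum.cong) (simp_all add: symm_onD[OF assms(3), of _ r])
  moreover have "(\<Sum>s\<in>I. x r * U r s * x s) = x r * (\<Sum>s\<in>I. U r s * x s)"
    by (simp add: sum_distrib_left algebra_simps)
  ultimately show ?thesis
    using assms(1,2) by (simp add: qf_def sum.distrib power2_eq_square)
qed

text \<open>Cholesky factorization by induction on the index set: a zero pivot forces its whole row
  to vanish, and a positive pivot is split off by passing to the Schur complement.\<close>

lemma nonneg_form_factor:
  assumes "finite I" "symm_on I U" "nonneg_form I U"
  shows "\<exists>b. \<forall>r\<in>I. \<forall>s\<in>I. U r s = (\<Sum>l\<in>I. b l r * b l s)"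
  using assms
proof (induction I arbitrary: U rule: finite_induct)
  case (insert r I)
  let ?J = "insert r I"
  have symI: "symm_on I U" using insert.prems by (auto simp: symm_on_def)
  have sym: "U s r = U r s" if "s \<in> I" for s
    by (rule symm_onD[OF insert.prems(1)]) (use that in auto)
  show ?case
  proof (cases "U r r = 0")
    case True
    have z: "U r s = 0" if "s \<in> I" for s
      using nonneg_form_kernel[OF insert.prems, of "unit_vec r" "unit_vec s"] insert.hyps that True
      by (simp add: qf_unit_unit)
    obtain b where b: "\<forall>r\<in>I. \<forall>s\<in>I. U r s = (\<Sum>l\<in>I. b l r * b l s)"
      using insert.IH[OF symI nonneg_form_insert_restrict[OF insert.hyps insert.prems(2)]] by blast
    define b' where "b' = (\<lambda>l s. if l = r \<or> s = r then 0 else b l s)"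
    have eq: "(\<Sum>l\<in>I. b' l a * b' l s) = (\<Sum>l\<in>I. b l a * b l s)" if "a \<in> I" "s \<in> I" for a s
      using insert.hyps that by (intro sum.cong) (auto simp: b'_def)
    have "U a s = (\<Sum>l\<in>?J. b' l a * b' l s)" if "a \<in> ?J" "s \<in> ?J" for a s
    proof (cases "a = r \<or> s = r")
      case True
      then have "U a s = 0" using z sym that \<open>U r r = 0\<close> by auto
      then show ?thesis using True by (auto simp: b'_def)
    next
      case False
      then have "a \<in> I" "s \<in> I" using that by auto
      then show ?thesis using b insert.hyps eq by (simp add: b'_def[THEN fun_cong, of r])
    qed
    then show ?thesis by blast
  next
    case False
    then have pos: "U r r > 0"
      using nonneg_form_diag[OF insert.prems(2), of r] insert.hyps by simp
    define U' where "U' = (\<lambda>s t. U s t - U r s * U r t / U r r)"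
    have "symm_on I U'" using symI by (auto simp: U'_def symm_on_def)
    moreover have "nonneg_form I U'"
      unfolding nonneg_form_def
    proof
      fix x :: "'a \<Rightarrow> real"
      define w where "w = (\<Sum>s\<in>I. U r s * x s)"
      \<comment> \<open>This value at \<open>r\<close> minimizes the form for fixed other
        coordinates; the minimum is the value of the Schur complement.\<close>
      let ?x = "\<lambda>s. if s = r then - w / U r r else x s"
      have 1: "qf I U ?x ?x = qf I U x x"
        using insert.hyps by (intro qf_cong) auto
      have 2: "(\<Sum>s\<in>I. U r s * ?x s) = w"
        unfolding w_def using insert.hyps by (intro sum.cong) auto
      have "w\<^sup>2 / U r r = (\<Sum>s\<in>I. \<Sum>t\<in>I. x s * (U r s * U r t / U r r) * x t)"
        unfolding w_def power2_eq_square sum_product sum_divide_distrib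
        by (intro sum.cong refl) (simp add: algebra_simps)
      then have "qf I U' x x = qf I U x x - w\<^sup>2 / U r r"
        by (simp add: qf_def U'_def algebra_simps sum_subtractf)
      also have "\<dots> = qf ?J U ?x ?x"
        unfolding qf_insert[OF insert.hyps insert.prems(1)] 1 2
        using pos by (simp add: field_simps power2_eq_square)
      finally show "0 \<le> qf I U' x x"
        using nonneg_formD[OF insert.prems(2), of ?x] by simp
    qed
    ultimately obtain b where b: "\<forall>r\<in>I. \<forall>s\<in>I. U' r s = (\<Sum>l\<in>I. b l r * b l s)"
      using insert.IH by blast
    define b' where "b' = (\<lambda>l s. if l = r then U r s / sqrt (U r r) else if s = r then 0 else b l s)"
    have eq: "(\<Sum>l\<in>I. b' l a * b' l s) = (\<Sum>l\<in>I. b l a * b l s)" if "a \<in> I" "s \<in> I" for a s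
      using insert.hyps that by (intro sum.cong) (auto simp: b'_def)
    have eq0: "(\<Sum>l\<in>I. b' l a * b' l s) = 0" if "a = r \<or> s = r" for a s
      using insert.hyps that by (intro sum.neutral) (auto simp: b'_def)
    have top: "b' r a * b' r s = U r a * U r s / U r r" for a s
      using pos by (simp add: b'_def field_simps)
    have "U a s = (\<Sum>l\<in>?J. b' l a * b' l s)" if "a \<in> ?J" "s \<in> ?J" for a s
    proof (cases "a = r \<or> s = r")
      case True
      then show ?thesis
        using insert.hyps that pos eq0[OF True] top sym by auto
    next
      case False
      then have "a \<in> I" "s \<in> I" using that by auto
      moreover have "U a s = U' a s + U r a * U r s / U r r" by (simp add: U'_def)
      ultimately show ?thesis using b insert.hyps eq top by simp
    qed
    then show ?thesis by blast
  qed
qed simp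

section \<open>Compactness arguments in coordinates\<close>

text \<open>Bolzano-Weierstrass, refining the subsequence one coordinate at a time.\<close>

lemma common_convergent_subsequence:
  fixes X :: "nat \<Rightarrow> 'i \<Rightarrow> real"
  assumes "finite I" "\<And>k i. i \<in> I \<Longrightarrow> \<bar>X k i\<bar> \<le> B"
  shows "\<exists>l \<sigma>. strict_mono (\<sigma> :: nat \<Rightarrow> nat) \<and> (\<forall>i\<in>I. (\<lambda>k. X (\<sigma> k) i) \<longlonglongrightarrow> l i)"
  using assms
proof (induction I rule: finite_induct)
  case empty
  show ?case using strict_mono_id by auto
next
  case (insert i I)
  then obtain l \<sigma> where s: "strict_mono (\<sigma> :: nat \<Rightarrow> nat)" "\<forall>i\<in>I. (\<lambda>k. X (\<sigma> k) i) \<longlonglongrightarrow> l i"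
    by auto
  have "bounded (range (\<lambda>k. X (\<sigma> k) i))"
    unfolding bounded_iff using insert.prems by auto
  from bounded_imp_convergent_subsequence[OF this]
  obtain m \<rho> where r: "strict_mono (\<rho> :: nat \<Rightarrow> nat)" "((\<lambda>k. X (\<sigma> k) i) \<circ> \<rho>) \<longlonglongrightarrow> m"
    by blast
  have "(\<lambda>k. X ((\<sigma> \<circ> \<rho>) k) j) \<longlonglongrightarrow> (l(i := m)) j" if "j \<in> insert i I" for j
  proof (cases "j = i")
    case True
    then show ?thesis using r by (simp add: o_def)
  next
    case False
    then have "(\<lambda>k. X (\<sigma> k) j) \<longlonglongrightarrow> l j" using that s by auto
    from LIMSEQ_subseq_LIMSEQ[OF this r(1)] show ?thesis using False by (simp add: o_def)
  qed
  moreover have "strict_mono (\<sigma> \<circ> \<rho>)" using s r by (simp add: strict_mono_o)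
  ultimately show ?case by blast
qed

text \<open>Normalise and pass to a limit on the unit sphere of the max norm.\<close>

lemma homogeneous_bounded:
  fixes X :: "nat \<Rightarrow> 'i \<Rightarrow> real" and h :: "'l \<Rightarrow> ('i \<Rightarrow> real) \<Rightarrow> real"
  assumes fin: "finite I"
    and hom: "\<And>l x c. c > 0 \<Longrightarrow> h l (\<lambda>i. c * x i) = c ^ e * h l x" and e: "e > 0"
    and cont: "\<And>l x (y :: nat \<Rightarrow> 'i \<Rightarrow> real).
      (\<And>i. i \<in> I \<Longrightarrow> (\<lambda>k. y k i) \<longlonglongrightarrow> x i) \<Longrightarrow> (\<lambda>k. h l (y k)) \<longlonglongrightarrow> h l x"
    and bd: "\<And>l. \<exists>C. \<forall>k. \<bar>h l (X k)\<bar> \<le> C"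
    and zero: "\<And>x. (\<And>l. h l x = 0) \<Longrightarrow> \<forall>i\<in>I. x i = 0"
  shows "\<exists>B. \<forall>k. \<forall>i\<in>I. \<bar>X k i\<bar> \<le> B"
proof (rule ccontr)
  assume "\<not> ?thesis"
  \<comment> \<open>The \<open>+ 1\<close> keeps the norms positive and matches the null sequence
    \<open>inverse (real (Suc n))\<close> used below.\<close>
  then have "\<forall>n::nat. \<exists>k. \<exists>i\<in>I. \<bar>X k i\<bar> > real n + 1"
    by (meson not_le)
  then obtain \<kappa> where \<kappa>: "\<And>n::nat. \<exists>i\<in>I. \<bar>X (\<kappa> n) i\<bar> > real n + 1" by metis
  then have ne: "I \<noteq> {}" by auto
  define m where "m = (\<lambda>n. Max ((\<lambda>i. \<bar>X (\<kappa> n) i\<bar>) ` I))"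
  have mge: "\<bar>X (\<kappa> n) i\<bar> \<le> m n" if "i \<in> I" for n i
    unfolding m_def using fin that by simp
  have mgt: "m n > real n + 1" for n
    using \<kappa>[of n] mge[of _ n] by force
  have mpos: "m n > 0" for n using mgt[of n] by linarith
  have "m n \<in> (\<lambda>i. \<bar>X (\<kappa> n) i\<bar>) ` I" for n
    unfolding m_def using fin ne by (intro Max_in) auto
  then have "\<forall>n. \<exists>i\<in>I. \<bar>X (\<kappa> n) i\<bar> = m n" by (metis (no_types, lifting) imageE)
  define Y where "Y = (\<lambda>n i. inverse (m n) * X (\<kappa> n) i)"
  have "\<bar>Y n i\<bar> \<le> 1" if "i \<in> I" for n i
    using mge[OF that, of n] mpos[of n] by (simp add: Y_def abs_mult field_simps)
  with common_convergent_subsequence[OF fin, of Y 1]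
  obtain x \<sigma> where s: "strict_mono (\<sigma> :: nat \<Rightarrow> nat)" "\<And>i. i \<in> I \<Longrightarrow> (\<lambda>k. Y (\<sigma> k) i) \<longlonglongrightarrow> x i"
    by blast
  have minv: "(\<lambda>n. inverse (m n)) \<longlonglongrightarrow> 0"
  proof (rule Lim_null_comparison[OF _ LIMSEQ_inverse_real_of_nat])
    show "\<forall>\<^sub>F n in sequentially. norm (inverse (m n)) \<le> inverse (real (Suc n))"
      using mgt mpos by (intro always_eventually allI) (simp add: le_imp_inverse_le less_imp_le add.commute)
  qed
  \<comment> \<open>Homogeneity of positive degree divides the bounded values
    \<open>h l (X (\<kappa> k))\<close> by \<open>m k ^ e\<close>, which tends to infinity.\<close>
  have "h l x = 0" for l
  proof -
    obtain C where C: "\<And>k. \<bar>h l (X k)\<bar> \<le> C" using bd by blast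
    have "(\<lambda>k. inverse (m k) ^ e) \<longlonglongrightarrow> 0 ^ e" by (intro tendsto_power minv)
    then have "(\<lambda>k. inverse (m k) ^ e * C) \<longlonglongrightarrow> 0"
      using e by (intro tendsto_mult_left_zero) (simp add: zero_power)
    then have "(\<lambda>k. h l (Y k)) \<longlonglongrightarrow> 0"
    proof (rule Lim_null_comparison[rotated])
      show "\<forall>\<^sub>F k in sequentially. norm (h l (Y k)) \<le> inverse (m k) ^ e * C"
        using C mpos unfolding Y_def
        by (intro always_eventually allI)
          (simp add: hom abs_mult mult_left_mono less_imp_le)
    qed
    from LIMSEQ_subseq_LIMSEQ[OF this s(1)]
    have "(\<lambda>k. h l (Y (\<sigma> k))) \<longlonglongrightarrow> 0" by (simp add: o_def)
    moreover have "(\<lambda>k. h l (Y (\<sigma> k))) \<longlonglongrightarrow> h l x" by (rule cont) (rule s(2))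
    ultimately show ?thesis by (rule LIMSEQ_unique[symmetric])
  qed
  then have x0: "\<forall>i\<in>I. x i = 0" by (rule zero)
  have "(\<lambda>k. \<Sum>i\<in>I. \<bar>Y (\<sigma> k) i\<bar>) \<longlonglongrightarrow> (\<Sum>i\<in>I. \<bar>x i\<bar>)"
    by (intro tendsto_sum tendsto_rabs s(2))
  \<comment> \<open>Each normalized vector has a coordinate of absolute value 1, so the limit cannot
    be zero on \<open>I\<close>.\<close>
  moreover have "1 \<le> (\<Sum>i\<in>I. \<bar>Y n i\<bar>)" for n
  proof -
    obtain i where i: "i \<in> I" "\<bar>X (\<kappa> n) i\<bar> = m n"
      using \<open>\<forall>n. \<exists>i\<in>I. \<bar>X (\<kappa> n) i\<bar> = m n\<close> by blast
    then have "\<bar>Y n i\<bar> = 1" using mpos[of n] by (simp add: Y_def abs_mult)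
    then show ?thesis using member_le_sum[of i I "\<lambda>i. \<bar>Y n i\<bar>"] fin i by simp
  qed
  ultimately have "1 \<le> (\<Sum>i\<in>I. \<bar>x i\<bar>)"
    by (intro LIMSEQ_le_const) auto
  then show False using x0 by simp
qed

section \<open>Linear matrix representations of cones\<close>

definition comb :: "'m set \<Rightarrow> ('m \<Rightarrow> 'i \<Rightarrow> 'i \<Rightarrow> real) \<Rightarrow> ('m \<Rightarrow> real) \<Rightarrow> 'i \<Rightarrow> 'i \<Rightarrow> real" where
  "comb M S p = (\<lambda>r s. \<Sum>i\<in>M. p i * S i r s)"

lemma qf_comb: "qf I (comb M S p) x y = (\<Sum>i\<in>M. p i * qf I (S i) x y)"
proof -
  have "qf I (comb M S p) x y = (\<Sum>r\<in>I. \<Sum>s\<in>I. \<Sum>i\<in>M. p i * (x r * S i r s * y s))"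
    by (simp add: qf_def comb_def sum_distrib_left sum_distrib_right algebra_simps)
  also have "\<dots> = (\<Sum>r\<in>I. \<Sum>i\<in>M. \<Sum>s\<in>I. p i * (x r * S i r s * y s))"
    by (intro sum.cong refl sum.swap)
  also have "\<dots> = (\<Sum>i\<in>M. \<Sum>r\<in>I. \<Sum>s\<in>I. p i * (x r * S i r s * y s))"
    by (rule sum.swap)
  finally show ?thesis by (simp add: qf_def sum_distrib_left)
qed

lemma symm_on_comb: "\<forall>i\<in>M. symm_on I (S i) \<Longrightarrow> symm_on I (comb M S p)"
  unfolding symm_on_def comb_def by (intro ballI sum.cong) auto

lemma nonneg_form_cong:
  "(\<And>r s. r \<in> I \<Longrightarrow> s \<in> I \<Longrightarrow> S r s = S' r s) \<Longrightarrow> nonneg_form I S \<longleftrightarrow> nonneg_form I S'"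
  unfolding nonneg_form_def by (simp add: qf_cong[of I _ _ _ _ S S'])

text \<open>A linear image of a spectrahedral cone. The pencil is homogeneous in \<open>p\<close>,
  and one parameter vector feeds both the pencil and the projection, so a change of parameters acts
  on \<open>S\<close> and \<open>G\<close> simultaneously.\<close>

definition lin_rep ::
    "'a::real_vector set \<Rightarrow> 'm set \<Rightarrow> 'i set \<Rightarrow> ('m \<Rightarrow> 'i \<Rightarrow> 'i \<Rightarrow> real) \<Rightarrow> ('m \<Rightarrow> 'a) \<Rightarrow> bool" where
  "lin_rep K M I S G \<longleftrightarrow>
     finite M \<and> finite I \<and> (\<forall>i\<in>M. symm_on I (S i)) \<and>
     (\<forall>p. nonneg_form I (comb M S p) \<longrightarrow> (\<Sum>i\<in>M. p i *\<^sub>R G i) \<in> K) \<and>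
     (\<forall>g\<in>K. \<exists>p. nonneg_form I (comb M S p) \<and> g = (\<Sum>i\<in>M. p i *\<^sub>R G i))"

lemma lin_repI:
  assumes "finite M" "finite I" "\<And>i. i \<in> M \<Longrightarrow> symm_on I (S i)"
    and "\<And>p. nonneg_form I (comb M S p) \<Longrightarrow> (\<Sum>i\<in>M. p i *\<^sub>R G i) \<in> K"
    and "\<And>g. g \<in> K \<Longrightarrow> \<exists>p. nonneg_form I (comb M S p) \<and> g = (\<Sum>i\<in>M. p i *\<^sub>R G i)"
  shows "lin_rep K M I S G"
  using assms unfolding lin_rep_def by blast

lemma lin_repD:
  assumes "lin_rep K M I S G"
  shows "finite M" "finite I" "\<forall>i\<in>M. symm_on I (S i)"
    and "nonneg_form I (comb M S p) \<Longrightarrow> (\<Sum>i\<in>M. p i *\<^sub>R G i) \<in> K"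
    and "g \<in> K \<Longrightarrow> \<exists>p. nonneg_form I (comb M S p) \<and> g = (\<Sum>i\<in>M. p i *\<^sub>R G i)"
  using assms unfolding lin_rep_def by blast+

section \<open>Facial reduction steps\<close>

text \<open>All feasible parameters lie in the hyperplane annihilated by \<open>\<xi>\<close>, so
  \<open>p i0\<close> can be solved for and substituted; \<open>S'\<close> and \<open>G'\<close> are
  the result of that substitution.\<close>

lemma lin_rep_eliminate_parameter:
  assumes R: "lin_rep K M I S G" and i0: "i0 \<in> M" "\<xi> i0 \<noteq> 0"
    and van: "\<And>p. nonneg_form I (comb M S p) \<Longrightarrow> (\<Sum>i\<in>M. \<xi> i * p i) = 0"
  shows "\<exists>S' G'. lin_rep K (M - {i0}) I S' G'"
proof -
  note D = lin_repD[OF R]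
  define S' where "S' = (\<lambda>i r s. S i r s - \<xi> i / \<xi> i0 * S i0 r s)"
  define G' where "G' = (\<lambda>i. G i - (\<xi> i / \<xi> i0) *\<^sub>R G i0)"
  let ?M = "M - {i0}"
  have key: "comb M S p = comb ?M S' p" "(\<Sum>i\<in>M. p i *\<^sub>R G i) = (\<Sum>i\<in>?M. p i *\<^sub>R G' i)"
    if p: "p i0 = - (\<Sum>i\<in>?M. \<xi> i * p i) / \<xi> i0" for p
  proof -
    have "p i0 *\<^sub>R G i0 = - (\<Sum>i\<in>?M. (p i * (\<xi> i / \<xi> i0)) *\<^sub>R G i0)"
      unfolding p by (simp add: sum_divide_distrib scaleR_sum_left sum_negf algebra_simps)
    then show "(\<Sum>i\<in>M. p i *\<^sub>R G i) = (\<Sum>i\<in>?M. p i *\<^sub>R G' i)"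
      using D(1) i0(1) by (simp add: G'_def sum.remove scaleR_diff_right sum_subtractf)
    have "p i0 * S i0 r s = - (\<Sum>i\<in>?M. p i * (\<xi> i / \<xi> i0 * S i0 r s))" for r s
      unfolding p by (simp add: sum_divide_distrib sum_distrib_left sum_distrib_right sum_negf algebra_simps)
    then show "comb M S p = comb ?M S' p"
      using D(1) i0(1)
      by (intro ext) (simp add: comb_def S'_def sum.remove right_diff_distrib sum_subtractf)
  qed
  have "lin_rep K ?M I S' G'"
  proof (rule lin_repI)
    show "symm_on I (S' i)" if "i \<in> ?M" for i
      using D(3) that i0(1) unfolding symm_on_def S'_def
      by (metis DiffD1)
  next
    fix p assume p: "nonneg_form I (comb ?M S' p)"
    define q where "q = p(i0 := - (\<Sum>i\<in>?M. \<xi> i * p i) / \<xi> i0)"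
    have "(\<Sum>i\<in>?M. \<xi> i * p i) = (\<Sum>i\<in>?M. \<xi> i * q i)"
      by (intro sum.cong) (auto simp: q_def)
    then have k: "q i0 = - (\<Sum>i\<in>?M. \<xi> i * q i) / \<xi> i0" by (simp add: q_def)
    have 1: "comb ?M S' q = comb ?M S' p" "(\<Sum>i\<in>?M. q i *\<^sub>R G' i) = (\<Sum>i\<in>?M. p i *\<^sub>R G' i)"
      by (auto simp: comb_def q_def intro!: ext sum.cong)
    show "(\<Sum>i\<in>?M. p i *\<^sub>R G' i) \<in> K"
      using D(4)[of q] p key[OF k] 1 by simp
  next
    fix g assume "g \<in> K"
    then obtain p where p: "nonneg_form I (comb M S p)" "g = (\<Sum>i\<in>M. p i *\<^sub>R G i)"
      using D(5) by blast
    from van[OF p(1)] have "\<xi> i0 * p i0 = - (\<Sum>i\<in>?M. \<xi> i * p i)"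
      using D(1) i0(1) by (simp add: sum.remove)
    then have "p i0 = - (\<Sum>i\<in>?M. \<xi> i * p i) / \<xi> i0"
      using i0(2) by (simp add: field_simps)
    from key[OF this] p show "\<exists>p. nonneg_form I (comb ?M S' p) \<and> g = (\<Sum>i\<in>?M. p i *\<^sub>R G' i)"
      by metis
  qed (use D in auto)
  then show ?thesis by blast
qed

text \<open>Modulo the kernel vector \<open>v\<close>, every vector has a representative with
  vanishing coordinate \<open>r\<close>.\<close>

lemma nonneg_form_drop_kernel:
  assumes "finite I" "symm_on I T" "r \<in> I" "v r \<noteq> 0" and ker: "\<And>y. qf I T v y = 0"
  shows "nonneg_form (I - {r}) T \<longleftrightarrow> nonneg_form I T"
proof
  assume "nonneg_form I T"
  then show "nonneg_form (I - {r}) T"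
    using nonneg_form_insert_restrict[of "I - {r}" r T] assms by (simp add: insert_absorb)
next
  assume N: "nonneg_form (I - {r}) T"
  show "nonneg_form I T"
    unfolding nonneg_form_def
  proof
    fix x
    define c where "c = x r / v r"
    define y where "y = (\<lambda>s. x s + (- c) * v s)"
    have "qf I T y y = qf I T x x"
      unfolding y_def qf_expand[OF assms(2)] using ker qf_commute[OF assms(2), of x v] by simp
    moreover have "y r = 0" using assms by (simp add: y_def c_def)
    ultimately show "0 \<le> qf I T x x"
      using qf_restrict[OF assms(1,3), of y T] nonneg_formD[OF N, of y] by simp
  qed
qed

lemma lin_rep_drop_kernel:
  assumes R: "lin_rep K M I S G" and "r \<in> I" "v r \<noteq> 0"
    and ker: "\<And>i y. i \<in> M \<Longrightarrow> qf I (S i) v y = 0"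
  shows "lin_rep K M (I - {r}) S G"
proof -
  note D = lin_repD[OF R]
  have eq: "nonneg_form (I - {r}) (comb M S p) \<longleftrightarrow> nonneg_form I (comb M S p)" for p
    using assms D(3) by (intro nonneg_form_drop_kernel D symm_on_comb) (auto simp: qf_comb)
  show ?thesis
    using D by (intro lin_repI) (auto simp: eq symm_on_def)
qed

text \<open>The direction \<open>p0\<close> is invisible to the pencil and to the projection, so a
  multiple of it can be subtracted to clear coordinate \<open>i0\<close>.\<close>

lemma lin_rep_drop_parameter:
  assumes R: "lin_rep K M I S G" and i0: "i0 \<in> M" "p0 i0 \<noteq> 0"
    and S0: "\<And>r s. r \<in> I \<Longrightarrow> s \<in> I \<Longrightarrow> comb M S p0 r s = 0" and G0: "(\<Sum>i\<in>M. p0 i *\<^sub>R G i) = 0"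
  shows "lin_rep K (M - {i0}) I S G"
proof -
  note D = lin_repD[OF R]
  let ?M = "M - {i0}"
  have z: "comb M S q = comb ?M S q" "(\<Sum>i\<in>M. q i *\<^sub>R G i) = (\<Sum>i\<in>?M. q i *\<^sub>R G i)"
    if "q i0 = 0" for q
    using that D(1) i0(1) by (auto simp: comb_def sum.remove)
  show ?thesis
  proof (rule lin_repI)
    fix p assume p: "nonneg_form I (comb ?M S p)"
    define q where "q = p(i0 := 0)"
    have "comb ?M S q = comb ?M S p" "(\<Sum>i\<in>?M. q i *\<^sub>R G i) = (\<Sum>i\<in>?M. p i *\<^sub>R G i)"
      by (auto simp: comb_def q_def intro!: ext sum.cong)
    then show "(\<Sum>i\<in>?M. p i *\<^sub>R G i) \<in> K"
      using D(4)[of q] p z[of q] by (simp add: q_def)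
  next
    fix g assume "g \<in> K"
    then obtain p where p: "nonneg_form I (comb M S p)" "g = (\<Sum>i\<in>M. p i *\<^sub>R G i)"
      using D(5) by blast
    define c where "c = p i0 / p0 i0"
    define q where "q = (\<lambda>i. p i - c * p0 i)"
    have q0: "q i0 = 0" using i0 by (simp add: q_def c_def)
    have "comb M S q r s = comb M S p r s - c * comb M S p0 r s" for r s
      by (simp add: comb_def q_def left_diff_distrib sum_subtractf sum_distrib_left mult.assoc)
    then have "nonneg_form I (comb M S q)"
      using p(1) S0 nonneg_form_cong[of I "comb M S q" "comb M S p"] by simp
    moreover have "(\<Sum>i\<in>M. q i *\<^sub>R G i) = g - c *\<^sub>R (\<Sum>i\<in>M. p0 i *\<^sub>R G i)"
      by (simp add: p q_def scaleR_diff_left sum_subtractf scaleR_sum_right)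
    ultimately show "\<exists>p. nonneg_form I (comb ?M S p) \<and> g = (\<Sum>i\<in>?M. p i *\<^sub>R G i)"
      using z[of q] q0 G0 by force
  qed (use D in auto)
qed

lemma nonneg_form_diag_pos:
  assumes "finite I" "symm_on I T" "nonneg_form I T" "r \<in> I" "s \<in> I" "T r s \<noteq> 0"
  shows "T r r > 0"
proof -
  have "T r r \<noteq> 0"
    using nonneg_form_kernel[OF assms(2,3), of "unit_vec r" "unit_vec s"] assms
    by (auto simp: qf_unit_unit)
  then show ?thesis using nonneg_form_diag[OF assms(3,1,4)] by simp
qed

text \<open>By Cauchy-Schwarz \<open>T(x, x) \<ge> (\<Sum>s. T r s * x s)\<^sup>2 / T r r\<close>, so a large multiple of \<open>T\<close> absorbs the
  component transversal to the hyperplane.\<close>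

lemma nonneg_form_from_hyperplane:
  assumes fin: "finite I" and T: "symm_on I T" "nonneg_form I T" and r: "r \<in> I" "T r r > 0"
    and A: "symm_on I A" "\<And>x. (\<Sum>s\<in>I. T r s * x s) = 0 \<Longrightarrow> 0 \<le> qf I A x x"
    and P: "\<And>x. \<mu> * (\<Sum>i\<in>I. (x i)\<^sup>2) \<le> qf I P x x" and mu: "\<mu> > 0" and d: "\<delta> > 0"
  shows "\<exists>l. nonneg_form I (\<lambda>a b. A a b + \<delta> * P a b + l * T a b)"
proof -
  define C where "C = (\<Sum>s\<in>I. (A r s)\<^sup>2)"
  \<comment> \<open>After scaling by \<open>T r r\<close>, the summand with \<open>C\<close> pays
    for the mixed term \<open>2 * c * B\<close> by completing a square against
    \<open>\<delta> * \<mu> * N\<close>, and \<open>\<bar>A r r\<bar>\<close> pays for the square of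
    the transversal component \<open>c\<close>.\<close>
  define l where "l = (C / (\<delta> * \<mu>) + \<bar>A r r\<bar>) / T r r"
  have Cpos: "0 \<le> C" unfolding C_def by (rule sum_nonneg) simp
  have lpos: "0 \<le> l" using Cpos mu d r by (simp add: l_def)
  have "0 \<le> qf I (\<lambda>a b. A a b + \<delta> * P a b + l * T a b) x x" for x
  proof -
    define w where "w = (\<Sum>s\<in>I. T r s * x s)"
    define c where "c = w / T r r"
    define N where "N = (\<Sum>i\<in>I. (x i)\<^sup>2)"
    define B where "B = (\<Sum>s\<in>I. A r s * x s)"
    have Npos: "0 \<le> N" unfolding N_def by (rule sum_nonneg) simp
    \<comment> \<open>The projection of \<open>x\<close> along the \<open>r\<close>-th unit vector
      onto the hyperplane on which \<open>A\<close> is nonnegative.\<close>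
    define z where "z = (\<lambda>s. x s + (- c) * unit_vec r s)"
    have "(\<Sum>s\<in>I. T r s * z s) = w - c * (\<Sum>s\<in>I. T r s * unit_vec r s)"
      by (simp add: z_def w_def right_diff_distrib sum_subtractf sum_distrib_left algebra_simps)
    also have "\<dots> = 0"
      using fin r by (simp add: unit_vec_def c_def if_distrib cong: if_cong)
    finally have "0 \<le> qf I A z z" by (rule A(2))
    then have a: "0 \<le> qf I A x x - 2 * c * B + c\<^sup>2 * A r r"
      unfolding z_def qf_expand[OF A(1)] qf_commute[OF A(1), of x "unit_vec r"]
      using fin r by (simp add: qf_unit_unit[OF fin r(1) r(1)] qf_unit_left[OF fin r(1), of A x] B_def)
    have B2: "B\<^sup>2 \<le> C * N"
      unfolding B_def C_def N_def by (rule Cauchy_Schwarz_ineq_sum)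
    have t: "w\<^sup>2 \<le> T r r * qf I T x x"
      using nonneg_form_Cauchy_Schwarz[OF T, of "unit_vec r" x] fin r
      by (simp add: qf_unit_unit[OF fin r(1) r(1)] qf_unit_left[OF fin r(1), of T x] w_def)
    then have t': "c\<^sup>2 * T r r \<le> qf I T x x"
      using r by (simp add: c_def field_simps power2_eq_square)
    have "c\<^sup>2 * (C / (\<delta> * \<mu>) + \<bar>A r r\<bar>) = l * (c\<^sup>2 * T r r)"
      using r by (simp add: l_def)
    also have "\<dots> \<le> l * qf I T x x" by (intro mult_left_mono t' lpos)
    finally have t2: "c\<^sup>2 * (C / (\<delta> * \<mu>)) + c\<^sup>2 * \<bar>A r r\<bar> \<le> l * qf I T x x"
      by (simp add: algebra_simps)
    have "c\<^sup>2 * A r r \<le> c\<^sup>2 * \<bar>A r r\<bar>" by (intro mult_left_mono) auto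
    moreover have "0 \<le> 2 * c * B + \<delta> * \<mu> * N + c\<^sup>2 * (C / (\<delta> * \<mu>))"
    proof (cases "N = 0")
      case True
      then have "B = 0" using B2 by simp
      then show ?thesis using True Cpos mu d by simp
    next
      case False
      then have N: "N > 0" using Npos by simp
      have e: "\<delta> * \<mu> > 0" using mu d by simp
      have "0 \<le> (\<delta> * \<mu> * N + c * B)\<^sup>2 / (\<delta> * \<mu> * N)" using e N by simp
      also have "\<dots> = 2 * c * B + \<delta> * \<mu> * N + c\<^sup>2 * (B\<^sup>2 / N / (\<delta> * \<mu>))"
        using mu d N by (simp add: field_simps power2_eq_square)
      also have "\<dots> \<le> 2 * c * B + \<delta> * \<mu> * N + c\<^sup>2 * (C / (\<delta> * \<mu>))"
        using e N B2 by (intro add_left_mono mult_left_mono divide_right_mono)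
          (auto simp: field_simps)
      finally show ?thesis .
    qed
    moreover have "\<delta> * \<mu> * N \<le> \<delta> * qf I P x x"
      using P[of x] d by (simp add: N_def mult.assoc)
    moreover have "qf I (\<lambda>a b. A a b + \<delta> * P a b + l * T a b) x x
      = qf I A x x + \<delta> * qf I P x x + l * qf I T x x"
      by (simp add: qf_def algebra_simps sum.distrib sum_distrib_left)
    ultimately show ?thesis using a t2 by linarith
  qed
  then show ?thesis unfolding nonneg_form_def by blast
qed

text \<open>Adding multiples of \<open>p1\<close> leaves the projected element unchanged but makes
  the form large across the hyperplane given by row \<open>r\<close> of its matrix. Hence
  nonnegativity on that hyperplane suffices: it becomes nonnegativity everywhere after adding
  \<open>\<delta> * p0 + l * p1\<close>, which moves the projection only by \<open>\<delta>\<close>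
  times a fixed element, and \<open>clo\<close> lets \<open>\<delta>\<close> tend to zero.\<close>

lemma lin_rep_restrict_hyperplane:
  fixes K :: "'a::real_vector set"
  assumes R: "lin_rep K M I S G"
    and clo: "\<And>g g0. (\<And>\<delta>. \<delta> > 0 \<Longrightarrow> g + \<delta> *\<^sub>R g0 \<in> K) \<Longrightarrow> g \<in> K"
    and P: "\<And>x. \<mu> * (\<Sum>i\<in>I. (x i)\<^sup>2) \<le> qf I (comb M S p0) x x" "\<mu> > 0"
    and p1: "nonneg_form I (comb M S p1)" "(\<Sum>i\<in>M. p1 i *\<^sub>R G i) = 0"
    and r: "r \<in> I" "comb M S p1 r r > 0"
  shows "\<exists>S'. lin_rep K M (I - {r}) S' G"
proof -
  note D = lin_repD[OF R]
  define T where "T = comb M S p1"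
  \<comment> \<open>The vectors \<open>E s\<close> with \<open>s\<close> in \<open>I - {r}\<close>
    form a basis of the hyperplane; a vector of the hyperplane has its own coordinates as
    coefficients.\<close>
  define E where "E = (\<lambda>s a. unit_vec s a - T r s / T r r * unit_vec r a)"
  define S' where "S' = (\<lambda>i s t. qf I (S i) (E s) (E t))"
  have T0: "T r r > 0" using r by (simp add: T_def)
  have cS': "comb M S' q = (\<lambda>s t. qf I (comb M S q) (E s) (E t))" for q
    by (intro ext, simp only: qf_comb) (simp add: S'_def comb_def)
  have qS': "qf (I - {r}) (comb M S' q) x x =
      qf I (comb M S q) (\<lambda>a. \<Sum>s\<in>I - {r}. x s * E s a) (\<lambda>a. \<Sum>s\<in>I - {r}. x s * E s a)" for q x
    unfolding cS' using D(2) by (intro qf_congruence[symmetric]) simp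
  have "lin_rep K M (I - {r}) S' G"
  proof (rule lin_repI)
    show "symm_on (I - {r}) (S' i)" if "i \<in> M" for i
      unfolding symm_on_def S'_def using D(3) that qf_commute by blast
  next
    fix g assume "g \<in> K"
    then obtain p where p: "nonneg_form I (comb M S p)" "g = (\<Sum>i\<in>M. p i *\<^sub>R G i)"
      using D(5) by blast
    then have "nonneg_form (I - {r}) (comb M S' p)"
      unfolding nonneg_form_def qS' by simp
    then show "\<exists>p. nonneg_form (I - {r}) (comb M S' p) \<and> g = (\<Sum>i\<in>M. p i *\<^sub>R G i)"
      using p by blast
  next
    fix p assume p: "nonneg_form (I - {r}) (comb M S' p)"
    have hyp: "0 \<le> qf I (comb M S p) x x" if x: "(\<Sum>s\<in>I. T r s * x s) = 0" for x
    proof -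
      have xr: "x r = - (\<Sum>s\<in>I - {r}. T r s * x s) / T r r"
        using x D(2) r(1) T0 by (simp add: sum.remove field_simps)
      have "(\<Sum>s\<in>I - {r}. x s * E s a) = x a" if a: "a \<in> I" for a
      proof (cases "a = r")
        case True
        have "(\<Sum>s\<in>I - {r}. x s * E s a) = (\<Sum>s\<in>I - {r}. - (T r s * x s) / T r r)"
          using True by (intro sum.cong) (auto simp: E_def unit_vec_def)
        then show ?thesis using True xr by (simp add: sum_divide_distrib sum_negf)
      next
        case False
        have "(\<Sum>s\<in>I - {r}. x s * E s a) = (\<Sum>s\<in>I - {r}. if s = a then x s else 0)"
          using False by (intro sum.cong) (auto simp: E_def unit_vec_def)
        then show ?thesis using False a D(2) by simp
      qed
      then have "qf I (comb M S p) x x = qf (I - {r}) (comb M S' p) x x"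
        unfolding qS' by (intro qf_cong) auto
      then show ?thesis using nonneg_formD[OF p] by simp
    qed
    show "(\<Sum>i\<in>M. p i *\<^sub>R G i) \<in> K"
    proof (rule clo[of _ "\<Sum>i\<in>M. p0 i *\<^sub>R G i"])
      fix \<delta> :: real assume d: "\<delta> > 0"
      have "\<exists>l. nonneg_form I (\<lambda>a b. comb M S p a b + \<delta> * comb M S p0 a b + l * T a b)"
      proof (rule nonneg_form_from_hyperplane[where T = T and A = "comb M S p" and P = "comb M S p0"])
        show "symm_on I T" "nonneg_form I T" "symm_on I (comb M S p)"
          using symm_on_comb[OF D(3)] p1(1) by (simp_all add: T_def)
      qed (fact D r T0 hyp P d)+
      then obtain l where l: "nonneg_form I (\<lambda>a b. comb M S p a b + \<delta> * comb M S p0 a b + l * T a b)"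
        by blast
      define q where "q = (\<lambda>i. p i + \<delta> * p0 i + l * p1 i)"
      have "comb M S q = (\<lambda>a b. comb M S p a b + \<delta> * comb M S p0 a b + l * T a b)"
        by (intro ext) (simp add: comb_def T_def q_def algebra_simps sum.distrib sum_distrib_left)
      then have "(\<Sum>i\<in>M. q i *\<^sub>R G i) \<in> K" using D(4)[of q] l by simp
      moreover have "(\<Sum>i\<in>M. q i *\<^sub>R G i)
        = (\<Sum>i\<in>M. p i *\<^sub>R G i) + \<delta> *\<^sub>R (\<Sum>i\<in>M. p0 i *\<^sub>R G i) + l *\<^sub>R (\<Sum>i\<in>M. p1 i *\<^sub>R G i)"
        by (simp add: q_def scaleR_add_left sum.distrib scaleR_sum_right)
      ultimately show "(\<Sum>i\<in>M. p i *\<^sub>R G i) + \<delta> *\<^sub>R (\<Sum>i\<in>M. p0 i *\<^sub>R G i) \<in> K"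
        using p1(2) by simp
    qed
  qed (use D in auto)
  then show ?thesis by blast
qed

section \<open>Strict feasibility and the normal form\<close>

text \<open>A finite subset of \<open>Q\<close> with the same span, described through annihilators
  and found by Gaussian elimination.\<close>

lemma finite_annihilator:
  fixes Q :: "('m \<Rightarrow> real) set"
  assumes "finite M"
  shows "\<exists>F\<subseteq>Q. finite F \<and>
    (\<forall>\<xi>. (\<forall>p\<in>F. (\<Sum>i\<in>M. \<xi> i * p i) = 0) \<longrightarrow> (\<forall>p\<in>Q. (\<Sum>i\<in>M. \<xi> i * p i) = 0))"
  using assms
proof (induction M arbitrary: Q rule: finite_induct)
  case empty
  show ?case by auto
next
  case (insert i M)
  show ?case
  proof (cases "\<forall>p\<in>Q. p i = 0")
    case True
    obtain F where F: "F \<subseteq> Q" "finite F" "\<And>\<xi> p. (\<forall>p\<in>F. (\<Sum>i\<in>M. \<xi> i * p i) = 0) \<Longrightarrow> p \<in> Q \<Longrightarrow> (\<Sum>i\<in>M. \<xi> i * p i) = 0"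
      using insert.IH[of Q] by blast
    have "(\<Sum>j\<in>insert i M. \<xi> j * p j) = (\<Sum>j\<in>M. \<xi> j * p j)" if "p \<in> Q" for \<xi> p
      using True that insert.hyps by simp
    then have "(\<Sum>j\<in>insert i M. \<xi> j * p j) = 0"
      if "\<forall>p\<in>F. (\<Sum>j\<in>insert i M. \<xi> j * p j) = 0" "p \<in> Q" for \<xi> p
      using F(3)[of \<xi> p] that F(1) by (simp add: subset_iff)
    then show ?thesis using F(1,2) by (intro exI[of _ F]) blast
  next
    case False
    then obtain p1 where p1: "p1 \<in> Q" "p1 i \<noteq> 0" by blast
    \<comment> \<open>Elimination of coordinate \<open>i\<close> with pivot
      \<open>p1\<close>.\<close>
    define \<tau> where "\<tau> = (\<lambda>p j. p j - p i / p1 i * p1 j)"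
    have \<tau>i: "\<tau> p i = 0" for p using p1 by (simp add: \<tau>_def)
    have split: "(\<Sum>j\<in>insert i M. \<xi> j * \<tau> p j)
        = (\<Sum>j\<in>insert i M. \<xi> j * p j) - p i / p1 i * (\<Sum>j\<in>insert i M. \<xi> j * p1 j)" for \<xi> p
      by (simp add: \<tau>_def right_diff_distrib sum_subtractf sum_distrib_left mult.left_commute
          del: sum.insert)
    have drop: "(\<Sum>j\<in>insert i M. \<xi> j * \<tau> p j) = (\<Sum>j\<in>M. \<xi> j * \<tau> p j)" for \<xi> p
      using insert.hyps \<tau>i by simp
    obtain F' where F': "F' \<subseteq> \<tau> ` Q" "finite F'"
      "\<And>\<xi> p. (\<forall>p\<in>F'. (\<Sum>i\<in>M. \<xi> i * p i) = 0) \<Longrightarrow> p \<in> \<tau> ` Q \<Longrightarrow> (\<Sum>i\<in>M. \<xi> i * p i) = 0"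
      using insert.IH[of "\<tau> ` Q"] by blast
    obtain F0 where F0: "F0 \<subseteq> Q" "finite F0" "F' = \<tau> ` F0"
      using F' by (meson finite_subset_image)
    have "(\<Sum>j\<in>insert i M. \<xi> j * p j) = 0"
      if z: "\<forall>p\<in>insert p1 F0. (\<Sum>j\<in>insert i M. \<xi> j * p j) = 0" and p: "p \<in> Q" for \<xi> p
    proof -
      have z1: "(\<Sum>j\<in>insert i M. \<xi> j * p1 j) = 0" using z by blast
      have "(\<Sum>j\<in>M. \<xi> j * \<tau> q j) = 0" if "q \<in> F0" for q
        using drop[of \<xi> q] split[of \<xi> q] z1 z that by (simp del: sum.insert)
      then have "\<forall>q\<in>F'. (\<Sum>j\<in>M. \<xi> j * q j) = 0" using F0 by blast
      from F'(3)[OF this, of "\<tau> p"] p have "(\<Sum>j\<in>M. \<xi> j * \<tau> p j) = 0" by blast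
      then show ?thesis using drop[of \<xi> p] split[of \<xi> p] z1 by (simp del: sum.insert)
    qed
    then show ?thesis
      using F0 p1 by (intro exI[of _ "insert p1 F0"]) blast
  qed
qed

text \<open>Otherwise vectors can be scaled so that the form stays at most 1 while their norms tend
  to infinity. This contradicts \<open>homogeneous_bounded\<close> applied to the form itself, of
  degree 2.\<close>

lemma positive_definite_lower_bound:
  assumes fin: "finite I" and nn: "nonneg_form I A"
    and pd: "\<And>x. qf I A x x = 0 \<Longrightarrow> \<forall>i\<in>I. x i = 0"
  shows "\<exists>\<mu>>0. \<forall>x. \<mu> * (\<Sum>i\<in>I. (x i)\<^sup>2) \<le> qf I A x x"
proof (rule ccontr)
  assume neg: "\<not> ?thesis"
  have "\<exists>x. qf I A x x < inverse (real (Suc n)) * (\<Sum>i\<in>I. (x i)\<^sup>2)" for n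
    using neg by (metis not_le inverse_positive_iff_positive of_nat_0_less_iff zero_less_Suc)
  then obtain x where x: "\<And>n. qf I A (x n) (x n) < inverse (real (Suc n)) * (\<Sum>i\<in>I. (x n i)\<^sup>2)"
    by metis
  define N where "N = (\<lambda>n. \<Sum>i\<in>I. (x n i)\<^sup>2)"
  have N: "N n > 0" for n
  proof -
    have "0 < inverse (real (Suc n)) * N n"
      using x[of n] nonneg_formD[OF nn, of "x n"] by (simp add: N_def)
    then show ?thesis by (simp add: zero_less_mult_iff)
  qed
  \<comment> \<open>The scale that makes the squared norm exactly \<open>Suc n\<close>; the failing
    inequality then bounds the form by 1.\<close>
  define c where "c = (\<lambda>n. sqrt (real (Suc n) / N n))"
  have c2: "(c n)\<^sup>2 = real (Suc n) / N n" for n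
    using N[of n] by (simp add: c_def)
  define y where "y = (\<lambda>n i. c n * x n i)"
  have yq: "qf I A (y n) (y n) \<le> 1" for n
  proof -
    have "qf I A (y n) (y n) = real (Suc n) / N n * qf I A (x n) (x n)"
      by (simp only: y_def qf_scale c2)
    also have "\<dots> \<le> real (Suc n) / N n * (inverse (real (Suc n)) * N n)"
      using x[of n] N[of n] by (intro mult_left_mono) (auto simp: N_def)
    also have "\<dots> = 1" using N[of n] by simp
    finally show ?thesis .
  qed
  have yN: "(\<Sum>i\<in>I. (y n i)\<^sup>2) = real (Suc n)" for n
  proof -
    have "(\<Sum>i\<in>I. (y n i)\<^sup>2) = (c n)\<^sup>2 * N n"
      by (simp add: y_def N_def power_mult_distrib sum_distrib_left)
    then show ?thesis using c2 N[of n] by simp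
  qed
  have "\<exists>B. \<forall>k. \<forall>i\<in>I. \<bar>y k i\<bar> \<le> B"
  proof (rule homogeneous_bounded[OF fin, where h = "\<lambda>(_::unit) x. qf I A x x" and e = 2])
    show "\<exists>C. \<forall>k. \<bar>qf I A (y k) (y k)\<bar> \<le> C"
      using yq nonneg_formD[OF nn] by (intro exI[of _ 1]) simp
  next
    fix x :: "'a \<Rightarrow> real" and y :: "nat \<Rightarrow> 'a \<Rightarrow> real"
    assume "\<And>i. i \<in> I \<Longrightarrow> (\<lambda>k. y k i) \<longlonglongrightarrow> x i"
    then show "(\<lambda>k. qf I A (y k) (y k)) \<longlonglongrightarrow> qf I A x x"
      unfolding qf_def by (intro tendsto_intros) auto
  qed (auto simp: qf_scale pd)
  then obtain B where B: "\<And>k i. i \<in> I \<Longrightarrow> \<bar>y k i\<bar> \<le> B" by blast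
  obtain n :: nat where n: "real (card I) * B\<^sup>2 < real n" using reals_Archimedean2 by blast
  have "(\<Sum>i\<in>I. (y n i)\<^sup>2) \<le> (\<Sum>i\<in>I. B\<^sup>2)"
    using B by (intro sum_mono) (metis abs_le_square_iff abs_ge_self order_trans)
  then show False using yN[of n] n by simp
qed

text \<open>The sum of finitely many feasible points that span the feasible set is strictly
  feasible: a vector isotropic for the sum lies in the kernel of each summand, hence in the kernel
  of every \<open>S i\<close> because the feasible points span the parameter space, and such a
  common kernel is excluded.\<close>

lemma lin_rep_slater:
  assumes R: "lin_rep K M I S G"
    and noxi: "\<And>\<xi>. (\<And>p. nonneg_form I (comb M S p) \<Longrightarrow> (\<Sum>i\<in>M. \<xi> i * p i) = 0) \<Longrightarrow> \<forall>i\<in>M. \<xi> i = 0"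
    and nov: "\<And>v. (\<And>i y. i \<in> M \<Longrightarrow> qf I (S i) v y = 0) \<Longrightarrow> \<forall>r\<in>I. v r = 0"
  shows "\<exists>p0 \<mu>. \<mu> > 0 \<and> (\<forall>x. \<mu> * (\<Sum>i\<in>I. (x i)\<^sup>2) \<le> qf I (comb M S p0) x x)"
proof -
  note D = lin_repD[OF R]
  define Q where "Q = {p. nonneg_form I (comb M S p)}"
  obtain F where F: "F \<subseteq> Q" "finite F"
    "\<And>\<xi> p. (\<forall>p\<in>F. (\<Sum>i\<in>M. \<xi> i * p i) = 0) \<Longrightarrow> p \<in> Q \<Longrightarrow> (\<Sum>i\<in>M. \<xi> i * p i) = 0"
    using finite_annihilator[OF D(1), of Q] by blast
  define p0 where "p0 = (\<lambda>i. \<Sum>p\<in>F. p i)"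
  have q0: "qf I (comb M S p0) x y = (\<Sum>p\<in>F. qf I (comb M S p) x y)" for x y
    unfolding qf_comb p0_def sum_distrib_right by (rule sum.swap)
  have Fn: "0 \<le> qf I (comb M S p) x x" if "p \<in> F" for p x
    using F(1) that nonneg_formD by (auto simp: Q_def)
  have nn: "nonneg_form I (comb M S p0)"
    unfolding nonneg_form_def q0 by (auto intro: sum_nonneg Fn)
  have "\<forall>r\<in>I. x r = 0" if x: "qf I (comb M S p0) x x = 0" for x
  proof (rule nov)
    fix i y assume i: "i \<in> M"
    have z: "qf I (comb M S p) x x = 0" if "p \<in> F" for p
      using x F(2) Fn that unfolding q0 by (simp add: sum_nonneg_eq_0_iff)
    have "qf I (comb M S p) x y = 0" if "p \<in> F" for p
    proof (rule nonneg_form_kernel[OF symm_on_comb[OF D(3)] _ z[OF that]])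
      show "nonneg_form I (comb M S p)" using F(1) that by (auto simp: Q_def)
    qed
    \<comment> \<open>For fixed \<open>x\<close> and \<open>y\<close>, the numbers
      \<open>qf I (S i) x y\<close> are the coefficients of a linear functional on parameters; it
      annihilates \<open>F\<close>.\<close>
    then have "\<forall>p\<in>F. (\<Sum>i\<in>M. qf I (S i) x y * p i) = 0"
      by (simp add: qf_comb mult.commute)
    from F(3)[OF this] have "\<forall>i\<in>M. qf I (S i) x y = 0"
      by (intro noxi) (auto simp: Q_def)
    then show "qf I (S i) x y = 0" using i by blast
  qed
  from positive_definite_lower_bound[OF D(2) nn this] show ?thesis by blast
qed

text \<open>Each way in which the normal form can fail allows a parameter or a matrix index to be
  deleted, so the total number of both decreases until it holds.\<close>

lemma lin_rep_normal_form:
  fixes K :: "'a::real_vector set" and M :: "'m set" and I :: "'i set"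
  assumes R: "lin_rep K M I S G"
    and clo: "\<And>g g0. (\<And>\<delta>. \<delta> > 0 \<Longrightarrow> g + \<delta> *\<^sub>R g0 \<in> K) \<Longrightarrow> g \<in> K"
  shows "\<exists>(M :: 'm set) (I :: 'i set) S G p0 \<mu>. lin_rep K M I S G \<and>
    \<mu> > 0 \<and> (\<forall>x. \<mu> * (\<Sum>i\<in>I. (x i)\<^sup>2) \<le> qf I (comb M S p0) x x) \<and>
    (\<forall>p. nonneg_form I (comb M S p) \<longrightarrow> (\<Sum>i\<in>M. p i *\<^sub>R G i) = 0 \<longrightarrow> (\<forall>i\<in>M. p i = 0))"
  using R
proof (induction "card M + card I" arbitrary: M I S G rule: less_induct)
  case less
  note R = less.prems
  note D = lin_repD[OF R]
  have M1: "card (M - {i}) + card I < card M + card I" if "i \<in> M" for i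
    using that D(1) card_Diff1_less[of M i] by linarith
  have I1: "card M + card (I - {i}) < card M + card I" if "i \<in> I" for i
    using that D(2) card_Diff1_less[of I i] by linarith
  show ?case
  proof (cases "\<exists>\<xi>. (\<forall>p. nonneg_form I (comb M S p) \<longrightarrow> (\<Sum>i\<in>M. \<xi> i * p i) = 0) \<and> (\<exists>i\<in>M. \<xi> i \<noteq> 0)")
    case True
    then obtain \<xi> i0 where "i0 \<in> M" "\<xi> i0 \<noteq> 0"
      "\<And>p. nonneg_form I (comb M S p) \<Longrightarrow> (\<Sum>i\<in>M. \<xi> i * p i) = 0" by blast
    then obtain S' G' where "lin_rep K (M - {i0}) I S' G'"
      using lin_rep_eliminate_parameter[OF R] by metis
    then show ?thesis using less.hyps[OF M1[OF \<open>i0 \<in> M\<close>]] by blast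
  next
    case noxi: False
    show ?thesis
    proof (cases "\<exists>v. (\<forall>i\<in>M. \<forall>y. qf I (S i) v y = 0) \<and> (\<exists>r\<in>I. v r \<noteq> 0)")
      case True
      then obtain v r where "r \<in> I" "v r \<noteq> 0" "\<And>i y. i \<in> M \<Longrightarrow> qf I (S i) v y = 0" by blast
      from lin_rep_drop_kernel[OF R this] less.hyps[OF I1[OF \<open>r \<in> I\<close>]]
      show ?thesis by blast
    next
      case nov: False
      obtain p0 \<mu> where sl: "\<mu> > 0" "\<forall>x. \<mu> * (\<Sum>i\<in>I. (x i)\<^sup>2) \<le> qf I (comb M S p0) x x"
        using lin_rep_slater[OF R] noxi nov by blast
      show ?thesis
      proof (cases "\<forall>p. nonneg_form I (comb M S p) \<longrightarrow> (\<Sum>i\<in>M. p i *\<^sub>R G i) = 0 \<longrightarrow> (\<forall>i\<in>M. p i = 0)")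
        case True
        then show ?thesis using R sl by blast
      next
        case False
        then obtain p1 i0 where p1: "nonneg_form I (comb M S p1)" "(\<Sum>i\<in>M. p1 i *\<^sub>R G i) = 0"
          "i0 \<in> M" "p1 i0 \<noteq> 0" by blast
        show ?thesis
        \<comment> \<open>If the pencil vanishes at \<open>p1\<close>, the parameter direction is
          redundant; otherwise \<open>p1\<close> has a positive diagonal entry, and the pencil can
          be cut down to a hyperplane.\<close>
        proof (cases "\<forall>r\<in>I. \<forall>s\<in>I. comb M S p1 r s = 0")
          case True
          then have "lin_rep K (M - {i0}) I S G"
            using lin_rep_drop_parameter[OF R p1(3,4) _ p1(2)] by blast
          then show ?thesis using less.hyps[OF M1[OF p1(3)]] by blast
        next
          case False
          then obtain r where r: "r \<in> I" "comb M S p1 r r > 0"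
            using nonneg_form_diag_pos[OF D(2) symm_on_comb[OF D(3)] p1(1)] by blast
          have "\<exists>S'. lin_rep K M (I - {r}) S' G"
          proof (rule lin_rep_restrict_hyperplane[OF R _ _ sl(1) p1(1,2) r])
            show "\<mu> * (\<Sum>i\<in>I. (x i)\<^sup>2) \<le> qf I (comb M S p0) x x" for x
              using sl(2) by blast
          qed (fact clo)
          then obtain S' where "lin_rep K M (I - {r}) S' G" by blast
          then show ?thesis using less.hyps[OF I1[OF r(1)]] by blast
        qed
      qed
    qed
  qed
qed

section \<open>Conic duality\<close>

text \<open>The new value \<open>\<beta>\<close> must separate lower bounds coming from elements
  with coefficient 1 at \<open>k\<close> from upper bounds coming from coefficient -1. They are
  compatible because the two kinds of elements add up to an element supported on \<open>J\<close>,
  and \<open>u\<close> shows that both kinds exist; \<open>\<beta>\<close> is the supremum of the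
  lower bounds.\<close>

lemma Riesz_extension_step:
  fixes Pos :: "('k \<Rightarrow> real) \<Rightarrow> bool"
  assumes J: "finite J" "k \<notin> J"
    and add: "\<And>p q. Pos p \<Longrightarrow> Pos q \<Longrightarrow> Pos (\<lambda>i. p i + q i)"
    and scale: "\<And>p c. Pos p \<Longrightarrow> c > 0 \<Longrightarrow> Pos (\<lambda>i. c * p i)"
    and nonneg: "\<And>p. Pos p \<Longrightarrow> (\<And>i. i \<notin> J \<Longrightarrow> p i = 0) \<Longrightarrow> 0 \<le> (\<Sum>i\<in>J. p i * b i)"
    and u: "\<And>i. i \<notin> J \<Longrightarrow> u i = 0" "\<epsilon> > 0"
      "Pos (\<lambda>i. u i + \<epsilon> * unit_vec k i)" "Pos (\<lambda>i. u i - \<epsilon> * unit_vec k i)"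
  shows "\<exists>\<beta>. \<forall>p. Pos p \<longrightarrow> (\<forall>i. i \<notin> insert k J \<longrightarrow> p i = 0) \<longrightarrow> 0 \<le> (\<Sum>i\<in>J. p i * b i) + p k * \<beta>"
proof -
  define lin where "lin = (\<lambda>p. \<Sum>i\<in>J. p i * b i)"
  define supp where "supp = (\<lambda>p :: 'k \<Rightarrow> real. \<forall>i. i \<notin> J \<longrightarrow> p i = 0)"
  define A where "A = {- lin p | p. supp p \<and> Pos (\<lambda>i. p i + unit_vec k i)}"
  have lin_scale: "lin (\<lambda>i. c * p i) = c * lin p" for c p
    by (simp add: lin_def sum_distrib_left mult.assoc)
  have ub: "- lin p \<le> lin q"
    if "supp p" "Pos (\<lambda>i. p i + unit_vec k i)" "supp q" "Pos (\<lambda>i. q i - unit_vec k i)" for p q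
  proof -
    have "Pos (\<lambda>i. p i + q i)" using add[OF that(2,4)] by simp
    moreover have "p i + q i = 0" if "i \<notin> J" for i
      using that \<open>supp p\<close> \<open>supp q\<close> by (simp add: supp_def)
    ultimately have "0 \<le> (\<Sum>i\<in>J. (p i + q i) * b i)" by (rule nonneg)
    then show ?thesis by (simp add: lin_def algebra_simps sum.distrib)
  qed
  define u' where "u' = (\<lambda>i. inverse \<epsilon> * u i)"
  have u': "supp u'" "Pos (\<lambda>i. u' i + unit_vec k i)" "Pos (\<lambda>i. u' i - unit_vec k i)"
    using u scale[OF u(3), of "inverse \<epsilon>"] scale[OF u(4), of "inverse \<epsilon>"]
    by (simp_all add: supp_def u'_def distrib_left right_diff_distrib flip: mult.assoc)
  have Ane: "A \<noteq> {}" using u' by (auto simp: A_def)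
  have bdd: "bdd_above A"
    unfolding bdd_above_def A_def using ub u' by (intro exI[of _ "lin u'"]) blast
  define \<beta> where "\<beta> = Sup A"
  have lo: "- lin p \<le> \<beta>" if "supp p" "Pos (\<lambda>i. p i + unit_vec k i)" for p
    unfolding \<beta>_def using that bdd by (intro cSup_upper) (auto simp: A_def)
  have hi: "\<beta> \<le> lin q" if "supp q" "Pos (\<lambda>i. q i - unit_vec k i)" for q
    unfolding \<beta>_def using Ane ub[OF _ _ that] by (intro cSup_least) (auto simp: A_def)
  have "0 \<le> lin p + p k * \<beta>" if P: "Pos p" and s: "\<forall>i. i \<notin> insert k J \<longrightarrow> p i = 0" for p
  proof -
    consider "p k = 0" | "p k > 0" | "p k < 0" by linarith
    then show ?thesis
    proof cases
      case 1
      then have "p i = 0" if "i \<notin> J" for i using s that by (cases "i = k") auto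
      then show ?thesis using nonneg[OF P] 1 by (simp add: lin_def)
    next
      case 2
      define q where "q = (\<lambda>i. inverse (p k) * (if i = k then 0 else p i))"
      have "supp q" using s by (auto simp: supp_def q_def)
      moreover have "(\<lambda>i. q i + unit_vec k i) = (\<lambda>i. inverse (p k) * p i)"
        using 2 by (auto simp: q_def unit_vec_def)
      then have "Pos (\<lambda>i. q i + unit_vec k i)" using scale[OF P, of "inverse (p k)"] 2 by simp
      ultimately have "- lin q \<le> \<beta>" by (rule lo)
      moreover have "lin q = inverse (p k) * lin p"
        unfolding q_def lin_scale using J by (auto simp: lin_def intro!: sum.cong)
      ultimately have "- (inverse (p k) * lin p) \<le> \<beta>" by simp
      then show ?thesis using 2 by (simp add: field_simps)
    next
      case 3
      define q where "q = (\<lambda>i. inverse (- p k) * (if i = k then 0 else p i))"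
      have "supp q" using s by (auto simp: supp_def q_def)
      moreover have "(\<lambda>i. q i - unit_vec k i) = (\<lambda>i. inverse (- p k) * p i)"
        using 3 by (auto simp: q_def unit_vec_def)
      then have "Pos (\<lambda>i. q i - unit_vec k i)" using scale[OF P, of "inverse (- p k)"] 3 by simp
      ultimately have "\<beta> \<le> lin q" by (rule hi)
      moreover have "lin q = inverse (- p k) * lin p"
        unfolding q_def lin_scale using J by (auto simp: lin_def intro!: sum.cong)
      ultimately have "\<beta> \<le> inverse (- p k) * lin p" by simp
      then show ?thesis using 3 by (simp add: field_simps)
    qed
  qed
  then show ?thesis unfolding lin_def by blast
qed

text \<open>One coordinate at a time; the same \<open>u\<close> serves throughout, since it is
  supported on the initial set \<open>J\<close>.\<close>

lemma Riesz_extension: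
  fixes Pos :: "('k \<Rightarrow> real) \<Rightarrow> bool"
  assumes J: "finite J" and E: "finite E" "E \<inter> J = {}"
    and add: "\<And>p q. Pos p \<Longrightarrow> Pos q \<Longrightarrow> Pos (\<lambda>i. p i + q i)"
    and scale: "\<And>p c. Pos p \<Longrightarrow> c > 0 \<Longrightarrow> Pos (\<lambda>i. c * p i)"
    and nonneg: "\<And>p. Pos p \<Longrightarrow> (\<And>i. i \<notin> J \<Longrightarrow> p i = 0) \<Longrightarrow> 0 \<le> (\<Sum>i\<in>J. p i * b i)"
    and u: "\<And>i. i \<notin> J \<Longrightarrow> u i = 0" "\<epsilon> > 0"
      "\<And>k. k \<in> E \<Longrightarrow> Pos (\<lambda>i. u i + \<epsilon> * unit_vec k i)"
      "\<And>k. k \<in> E \<Longrightarrow> Pos (\<lambda>i. u i - \<epsilon> * unit_vec k i)"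
  shows "\<exists>b'. (\<forall>i\<in>J. b' i = b i) \<and>
    (\<forall>p. Pos p \<longrightarrow> (\<forall>i. i \<notin> E \<union> J \<longrightarrow> p i = 0) \<longrightarrow> 0 \<le> (\<Sum>i\<in>E \<union> J. p i * b' i))"
  using E u
proof (induction E rule: finite_induct)
  case empty
  then show ?case using nonneg by auto
next
  case (insert k E)
  then obtain b' where b': "\<forall>i\<in>J. b' i = b i"
    "\<And>p. Pos p \<Longrightarrow> (\<And>i. i \<notin> E \<union> J \<Longrightarrow> p i = 0) \<Longrightarrow> 0 \<le> (\<Sum>i\<in>E \<union> J. p i * b' i)"
    by auto
  have kn: "k \<notin> E \<union> J" using insert by auto
  have fin: "finite (E \<union> J)" using insert J by auto
  have "\<exists>\<beta>. \<forall>p. Pos p \<longrightarrow> (\<forall>i. i \<notin> insert k (E \<union> J) \<longrightarrow> p i = 0) \<longrightarrow>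
      0 \<le> (\<Sum>i\<in>E \<union> J. p i * b' i) + p k * \<beta>"
  proof (rule Riesz_extension_step[where u = u and \<epsilon> = \<epsilon>])
    show "u i = 0" if "i \<notin> E \<union> J" for i using that insert.prems by blast
    show "Pos (\<lambda>i. u i + \<epsilon> * unit_vec k i)" "Pos (\<lambda>i. u i - \<epsilon> * unit_vec k i)"
      using insert.prems by blast+
  qed (fact fin kn add scale b'(2) \<open>\<epsilon> > 0\<close>)+
  then obtain \<beta> where \<beta>: "\<And>p. Pos p \<Longrightarrow> (\<forall>i. i \<notin> insert k (E \<union> J) \<longrightarrow> p i = 0) \<Longrightarrow>
      0 \<le> (\<Sum>i\<in>E \<union> J. p i * b' i) + p k * \<beta>"
    by blast
  have eq: "(\<Sum>i\<in>insert k E \<union> J. p i * (b'(k := \<beta>)) i) = (\<Sum>i\<in>E \<union> J. p i * b' i) + p k * \<beta>" for p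
  proof -
    have "(\<Sum>i\<in>E \<union> J. p i * (b'(k := \<beta>)) i) = (\<Sum>i\<in>E \<union> J. p i * b' i)"
      using kn by (intro sum.cong) auto
    then show ?thesis using fin kn by simp
  qed
  show ?case
  proof (intro exI[of _ "b'(k := \<beta>)"] conjI allI impI)
    show "\<forall>i\<in>J. (b'(k := \<beta>)) i = b i" using b'(1) kn by auto
  next
    fix p assume "Pos p" "\<forall>i. i \<notin> insert k E \<union> J \<longrightarrow> p i = 0"
    then show "0 \<le> (\<Sum>i\<in>insert k E \<union> J. p i * (b'(k := \<beta>)) i)"
      unfolding eq by (intro \<beta>) auto
  qed
qed

lemma sum_Inl_Inr:
  assumes "finite A" "finite B"
  shows "(\<Sum>i\<in>Inr ` B \<union> Inl ` A. f i) = (\<Sum>i\<in>A. f (Inl i)) + (\<Sum>j\<in>B. f (Inr j))"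
  using assms by (subst sum.union_disjoint) (auto simp: sum.reindex add.commute)

lemma abs_mult_le_sum_squares:
  fixes x :: "'i \<Rightarrow> real"
  assumes "finite I" "a \<in> I" "c \<in> I"
  shows "\<bar>x a * x c\<bar> \<le> (\<Sum>i\<in>I. (x i)\<^sup>2)"
proof -
  have 1: "(x i)\<^sup>2 \<le> (\<Sum>i\<in>I. (x i)\<^sup>2)" if "i \<in> I" for i
    using assms(1) that by (intro member_le_sum) auto
  have "2 * \<bar>x a * x c\<bar> \<le> (x a)\<^sup>2 + (x c)\<^sup>2"
    using sum_squares_bound[of "\<bar>x a\<bar>" "\<bar>x c\<bar>"] by (simp add: abs_mult)
  then show ?thesis using 1[OF assms(2)] 1[OF assms(3)] by linarith
qed

text \<open>Extend the functional to all forms and represent the extension by a nonnegative matrix, which is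
  then factored.\<close>

lemma slater_duality:
  fixes S :: "'m \<Rightarrow> 'i \<Rightarrow> 'i \<Rightarrow> real"
  assumes fin: "finite M" "finite I" and sym: "\<forall>i\<in>M. symm_on I (S i)"
    and slater: "\<mu> > 0" "\<And>x. \<mu> * (\<Sum>i\<in>I. (x i)\<^sup>2) \<le> qf I (comb M S p0) x x"
    and nonneg: "\<And>p. nonneg_form I (comb M S p) \<Longrightarrow> 0 \<le> (\<Sum>i\<in>M. p i * b i)"
  shows "\<exists>V. \<forall>i\<in>M. b i = (\<Sum>l\<in>I. qf I (S i) (V l) (V l))"
proof -
  \<comment> \<open>Parameters are enlarged by free matrix entries: coordinate
    \<open>Inr (a, c)\<close> contributes the monomial \<open>x a * x c\<close>. The functional
    \<open>b\<close> is given on \<open>Inl\<close> only and has to be extended to these.\<close>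
  define Q where "Q = (\<lambda>(p :: 'm + 'i \<times> 'i \<Rightarrow> real) x.
    qf I (comb M S (\<lambda>i. p (Inl i))) x x + (\<Sum>a\<in>I. \<Sum>c\<in>I. p (Inr (a, c)) * (x a * x c)))"
  define Pos where "Pos = (\<lambda>p. \<forall>x. 0 \<le> Q p x)"
  define E where "E = (Inr ` (I \<times> I) :: ('m + 'i \<times> 'i) set)"
  define J where "J = (Inl ` M :: ('m + 'i \<times> 'i) set)"
  define u where "u = (\<lambda>j :: 'm + 'i \<times> 'i. case j of Inl i \<Rightarrow> if i \<in> M then p0 i else 0 | Inr _ \<Rightarrow> 0)"
  have Q_add: "Q (\<lambda>i. p i + q i) x = Q p x + Q q x" for p q x
    by (simp add: Q_def qf_comb algebra_simps sum.distrib)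
  have Q_scale: "Q (\<lambda>i. c * p i) x = c * Q p x" for p c x
    by (simp add: Q_def qf_comb algebra_simps sum_distrib_left)
  have Q_unit: "Q (unit_vec (Inr (a, c))) x = x a * x c" if "a \<in> I" "c \<in> I" for a c x
  proof -
    have "(\<Sum>a'\<in>I. \<Sum>c'\<in>I. unit_vec (Inr (a, c)) (Inr (a', c') :: 'm + 'i \<times> 'i) * (x a' * x c'))
      = (\<Sum>a'\<in>I. if a' = a then (\<Sum>c'\<in>I. if c' = c then x a' * x c' else 0) else 0)"
      by (intro sum.cong refl) (auto simp: unit_vec_def intro!: sum.cong)
    then show ?thesis
      using fin that by (simp add: Q_def qf_comb unit_vec_def)
  qed
  have Q_u: "\<mu> * (\<Sum>i\<in>I. (x i)\<^sup>2) \<le> Q u x" for x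
  proof -
    have "Q u x = qf I (comb M S p0) x x"
      by (simp add: Q_def u_def qf_comb)
    then show ?thesis using slater(2) by simp
  qed
  \<comment> \<open>The Slater bound dominates each monomial, so moving \<open>u\<close> by
    \<open>\<mu>\<close> along any matrix entry keeps the form nonnegative.\<close>
  have unit: "Pos (\<lambda>i. u i + s * \<mu> * unit_vec k i)" if k: "k \<in> E" and s: "\<bar>s\<bar> = 1" for k s
  proof -
    obtain a c where ac: "a \<in> I" "c \<in> I" "k = Inr (a, c)" using k by (auto simp: E_def)
    have "0 \<le> Q u x + s * \<mu> * (x a * x c)" for x
    proof -
      have "\<bar>s * \<mu> * (x a * x c)\<bar> \<le> \<mu> * (\<Sum>i\<in>I. (x i)\<^sup>2)"
        using abs_mult_le_sum_squares[OF fin(2) ac(1,2), of x] slater(1) s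
        by (simp add: abs_mult)
      then show ?thesis using Q_u[of x] by linarith
    qed
    then show ?thesis
      using ac by (simp add: Pos_def Q_add Q_scale Q_unit)
  qed
  obtain \<beta> where \<beta>: "\<forall>j\<in>J. \<beta> j = (case j of Inl i \<Rightarrow> b i | Inr _ \<Rightarrow> 0)"
    "\<And>p. Pos p \<Longrightarrow> (\<forall>i. i \<notin> E \<union> J \<longrightarrow> p i = 0) \<Longrightarrow> 0 \<le> (\<Sum>i\<in>E \<union> J. p i * \<beta> i)"
  proof -
    have "\<exists>b'. (\<forall>i\<in>J. b' i = (case i of Inl i \<Rightarrow> b i | Inr _ \<Rightarrow> 0)) \<and>
      (\<forall>p. Pos p \<longrightarrow> (\<forall>i. i \<notin> E \<union> J \<longrightarrow> p i = 0) \<longrightarrow> 0 \<le> (\<Sum>i\<in>E \<union> J. p i * b' i))"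
    proof (rule Riesz_extension[where u = u and \<epsilon> = \<mu>])
      show "finite J" "finite E" "E \<inter> J = {}" using fin by (auto simp: J_def E_def)
      show "Pos (\<lambda>i. p i + q i)" if "Pos p" "Pos q" for p q
        using that by (simp add: Pos_def Q_add)
      show "Pos (\<lambda>i. c * p i)" if "Pos p" "c > 0" for p c
        using that by (simp add: Pos_def Q_scale)
      show "u i = 0" if "i \<notin> J" for i
        using that by (auto simp: u_def J_def split: sum.splits)
      show "Pos (\<lambda>i. u i + \<mu> * unit_vec k i)" "Pos (\<lambda>i. u i - \<mu> * unit_vec k i)" if "k \<in> E" for k
        using unit[OF that, of 1] unit[OF that, of "- 1"] by simp_all
      show "0 \<le> (\<Sum>i\<in>J. p i * (case i of Inl i \<Rightarrow> b i | Inr _ \<Rightarrow> 0))"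
        if "Pos p" "\<And>i. i \<notin> J \<Longrightarrow> p i = 0" for p
      proof -
        have "p (Inr ac) = 0" for ac using that(2) by (auto simp: J_def)
        then have "nonneg_form I (comb M S (\<lambda>i. p (Inl i)))"
          using that(1) by (simp add: Pos_def Q_def nonneg_form_def)
        from nonneg[OF this] show ?thesis by (simp add: J_def sum.reindex)
      qed
    qed (fact slater(1))
    then show ?thesis using that by blast
  qed
  have \<beta>b: "\<beta> (Inl i) = b i" if "i \<in> M" for i
    using \<beta>(1) that by (auto simp: J_def)
  have sumEJ: "(\<Sum>i\<in>E \<union> J. p i * \<beta> i)
      = (\<Sum>i\<in>M. p (Inl i) * b i) + (\<Sum>a\<in>I. \<Sum>c\<in>I. p (Inr (a, c)) * \<beta> (Inr (a, c)))" for p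
    unfolding E_def J_def using fin
    by (subst sum_Inl_Inr) (auto simp: \<beta>b sum.cartesian_product case_prod_unfold intro!: sum.cong)
  \<comment> \<open>The extension need not be symmetric in \<open>a\<close> and \<open>c\<close>;
    symmetrizing does not alter its pairing with symmetric matrices.\<close>
  define U where "U = (\<lambda>a c. (\<beta> (Inr (a, c)) + \<beta> (Inr (c, a))) / 2)"
  have symU: "symm_on I U" by (simp add: symm_on_def U_def add.commute)
  have pairU: "(\<Sum>a\<in>I. \<Sum>c\<in>I. T a c * U a c) = (\<Sum>a\<in>I. \<Sum>c\<in>I. T a c * \<beta> (Inr (a, c)))"
    if T: "symm_on I T" for T
  proof -
    have "(\<Sum>a\<in>I. \<Sum>c\<in>I. T a c * \<beta> (Inr (c, a))) = (\<Sum>c\<in>I. \<Sum>a\<in>I. T a c * \<beta> (Inr (c, a)))"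
      by (rule sum.swap)
    also have "\<dots> = (\<Sum>c\<in>I. \<Sum>a\<in>I. T c a * \<beta> (Inr (c, a)))"
      using T by (intro sum.cong) (simp_all add: symm_on_def)
    finally show ?thesis
      by (simp add: U_def add_divide_distrib distrib_left sum.distrib flip: sum_divide_distrib)
  qed
  have "nonneg_form I U"
    unfolding nonneg_form_def
  proof
    fix x :: "'i \<Rightarrow> real"
    \<comment> \<open>The coordinates of the rank-one form
      \<open>w \<mapsto> (\<Sum>a\<in>I. x a * w a)\<^sup>2\<close>; nonnegativity of the extension
      there is nonnegativity of \<open>U\<close> at \<open>x\<close>.\<close>
    define p where "p = (\<lambda>j :: 'm + 'i \<times> 'i. case j of Inl _ \<Rightarrow> 0 | Inr (a, c) \<Rightarrow> if a \<in> I \<and> c \<in> I then x a * x c else 0)"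
    have "Q p w = (\<Sum>a\<in>I. x a * w a)\<^sup>2" for w
    proof -
      have "Q p w = (\<Sum>a\<in>I. \<Sum>c\<in>I. x a * x c * (w a * w c))"
        unfolding Q_def by (simp add: p_def qf_comb)
      also have "\<dots> = (\<Sum>a\<in>I. x a * w a)\<^sup>2"
        by (simp add: power2_eq_square sum_product algebra_simps)
      finally show ?thesis .
    qed
    then have "Pos p" by (simp add: Pos_def)
    then have "0 \<le> (\<Sum>i\<in>E \<union> J. p i * \<beta> i)"
      by (rule \<beta>(2)) (auto simp: p_def E_def split: sum.splits)
    also have "\<dots> = (\<Sum>a\<in>I. \<Sum>c\<in>I. x a * x c * \<beta> (Inr (a, c)))"
      unfolding sumEJ by (simp add: p_def)
    also have "\<dots> = (\<Sum>a\<in>I. \<Sum>c\<in>I. x a * x c * U a c)"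
      by (rule pairU[symmetric]) (simp add: symm_on_def mult.commute)
    also have "\<dots> = qf I U x x"
      by (simp add: qf_def algebra_simps)
    finally show "0 \<le> qf I U x x" .
  qed
  from nonneg_form_factor[OF fin(2) symU this]
  obtain V where V: "\<And>r s. r \<in> I \<Longrightarrow> s \<in> I \<Longrightarrow> U r s = (\<Sum>l\<in>I. V l r * V l s)" by blast
  have "b i = (\<Sum>l\<in>I. qf I (S i) (V l) (V l))" if i: "i \<in> M" for i
  proof -
    have S: "symm_on I (S i)" using sym i by blast
    \<comment> \<open>The matrix \<open>S i\<close> taken once as a parameter and once, with
      opposite sign, through its entries: the resulting form is zero. Using both signs of
      \<open>\<sigma>\<close> turns positivity of the functional into an equation for
      \<open>b i\<close>.\<close>
    define p where "p = (\<lambda>\<sigma> (j :: 'm + 'i \<times> 'i). case j of Inl j \<Rightarrow> \<sigma> * unit_vec i j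
      | Inr (a, c) \<Rightarrow> if a \<in> I \<and> c \<in> I then - \<sigma> * S i a c else 0)"
    have "Q (p \<sigma>) x = 0" for \<sigma> x
    proof -
      have "(\<Sum>j\<in>M. \<sigma> * unit_vec i j * qf I (S j) x x) = (\<Sum>j\<in>M. if j = i then \<sigma> * qf I (S j) x x else 0)"
        by (intro sum.cong) (auto simp: unit_vec_def)
      also have "\<dots> = \<sigma> * qf I (S i) x x"
        using fin i by simp
      moreover have "(\<Sum>a\<in>I. \<Sum>c\<in>I. p \<sigma> (Inr (a, c)) * (x a * x c)) = - \<sigma> * qf I (S i) x x"
        by (simp add: p_def qf_def sum_distrib_left sum_negf algebra_simps)
      ultimately show ?thesis by (simp add: Q_def qf_comb p_def)
    qed
    then have "Pos (p \<sigma>)" for \<sigma> by (simp add: Pos_def)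
    then have "0 \<le> (\<Sum>j\<in>E \<union> J. p \<sigma> j * \<beta> j)" for \<sigma>
      by (rule \<beta>(2)) (use i in \<open>auto simp: p_def E_def J_def unit_vec_def split: sum.splits\<close>)
    moreover have "(\<Sum>j\<in>E \<union> J. p \<sigma> j * \<beta> j)
        = \<sigma> * (b i - (\<Sum>a\<in>I. \<Sum>c\<in>I. S i a c * \<beta> (Inr (a, c))))" for \<sigma>
    proof -
      have "(\<Sum>j\<in>M. \<sigma> * unit_vec i j * b j) = (\<Sum>j\<in>M. if j = i then \<sigma> * b j else 0)"
        by (intro sum.cong) (auto simp: unit_vec_def)
      then have "(\<Sum>j\<in>M. \<sigma> * unit_vec i j * b j) = \<sigma> * b i" using fin i by simp
      then show ?thesis
        unfolding sumEJ by (simp add: p_def sum_distrib_left sum_negf algebra_simps)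
    qed
    ultimately have sgn: "0 \<le> \<sigma> * (b i - (\<Sum>a\<in>I. \<Sum>c\<in>I. S i a c * \<beta> (Inr (a, c))))" for \<sigma>
      by simp
    have "b i = (\<Sum>a\<in>I. \<Sum>c\<in>I. S i a c * \<beta> (Inr (a, c)))"
      using sgn[of 1] sgn[of "- 1"] by simp
    also have "\<dots> = (\<Sum>a\<in>I. \<Sum>c\<in>I. S i a c * U a c)" by (rule pairU[OF S, symmetric])
    also have "\<dots> = (\<Sum>a\<in>I. \<Sum>c\<in>I. \<Sum>l\<in>I. V l a * S i a c * V l c)"
      by (intro sum.cong refl) (simp add: V sum_distrib_left algebra_simps)
    also have "\<dots> = (\<Sum>a\<in>I. \<Sum>l\<in>I. \<Sum>c\<in>I. V l a * S i a c * V l c)"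
      by (intro sum.cong refl sum.swap)
    also have "\<dots> = (\<Sum>l\<in>I. qf I (S i) (V l) (V l))"
      unfolding qf_def by (rule sum.swap)
    finally show ?thesis .
  qed
  then show ?thesis by blast
qed

section \<open>Derivations of the reals\<close>

text \<open>A derivation on a subring of the reals, represented by its graph; equivalently, a subring of
  the trivial square-zero extension of the reals meeting \<open>{0} \<times> UNIV\<close> only in zero.\<close>

definition derivation_graph :: "(real \<times> 'b::real_vector) set \<Rightarrow> bool" where
  "derivation_graph \<Gamma> \<longleftrightarrow> (1, 0) \<in> \<Gamma> \<and>
     (\<forall>a u b v. (a, u) \<in> \<Gamma> \<longrightarrow> (b, v) \<in> \<Gamma> \<longrightarrow>
        (a - b, u - v) \<in> \<Gamma> \<and> (a * b, a *\<^sub>R v + b *\<^sub>R u) \<in> \<Gamma>) \<and>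
     (\<forall>u. (0, u) \<in> \<Gamma> \<longrightarrow> u = 0)"

lemma derivation_graphD:
  assumes "derivation_graph \<Gamma>"
  shows "(1, 0) \<in> \<Gamma>"
    and "(a, u) \<in> \<Gamma> \<Longrightarrow> (b, v) \<in> \<Gamma> \<Longrightarrow> (a - b, u - v) \<in> \<Gamma>"
    and "(a, u) \<in> \<Gamma> \<Longrightarrow> (b, v) \<in> \<Gamma> \<Longrightarrow> (a * b, a *\<^sub>R v + b *\<^sub>R u) \<in> \<Gamma>"
    and "(0, u) \<in> \<Gamma> \<Longrightarrow> u = 0"
  using assms unfolding derivation_graph_def by blast+

lemma derivation_graph_unique:
  assumes "derivation_graph \<Gamma>" "(a, u) \<in> \<Gamma>" "(a, v) \<in> \<Gamma>"
  shows "u = v"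
  using derivation_graphD(2)[OF assms] derivation_graphD(4)[OF assms(1), of "u - v"] by simp

section \<open>Passing to fractions\<close>

text \<open>The second component is the quotient rule, taken over all representations of a fraction
  at once.\<close>

definition fraction_graph :: "(real \<times> 'b::real_vector) set \<Rightarrow> (real \<times> 'b) set" where
  "fraction_graph \<Gamma> = {(a / b, (1 / b) *\<^sub>R u - (a / b\<^sup>2) *\<^sub>R v) | a u b v.
     (a, u) \<in> \<Gamma> \<and> (b, v) \<in> \<Gamma> \<and> b \<noteq> 0}"

lemma fraction_graphI:
  "(a, u) \<in> \<Gamma> \<Longrightarrow> (b, v) \<in> \<Gamma> \<Longrightarrow> b \<noteq> 0 \<Longrightarrow> x = a / b \<Longrightarrow>
   w = (1 / b) *\<^sub>R u - (a / b\<^sup>2) *\<^sub>R v \<Longrightarrow> (x, w) \<in> fraction_graph \<Gamma>"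
  unfolding fraction_graph_def by blast

lemma fraction_graphE:
  assumes "(x, w) \<in> fraction_graph \<Gamma>"
  obtains a u b v where "(a, u) \<in> \<Gamma>" "(b, v) \<in> \<Gamma>" "b \<noteq> 0" "x = a / b"
    "w = (1 / b) *\<^sub>R u - (a / b\<^sup>2) *\<^sub>R v"
  using assms unfolding fraction_graph_def by auto

lemma fraction_graph_superset:
  assumes "derivation_graph \<Gamma>"
  shows "\<Gamma> \<subseteq> fraction_graph \<Gamma>"
proof
  fix x assume "x \<in> \<Gamma>"
  then show "x \<in> fraction_graph \<Gamma>"
    using fraction_graphI[OF _ derivation_graphD(1)[OF assms], of "fst x" "snd x" "fst x" "snd x"]
    by simp
qed

lemma derivation_graph_fraction:
  assumes "derivation_graph \<Gamma>"
  shows "derivation_graph (fraction_graph \<Gamma>)"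
proof -
  note D = derivation_graphD[OF assms]
  have closed: "(x - y, s - t) \<in> fraction_graph \<Gamma> \<and> (x * y, x *\<^sub>R t + y *\<^sub>R s) \<in> fraction_graph \<Gamma>"
    if xs: "(x, s) \<in> fraction_graph \<Gamma>" and yt: "(y, t) \<in> fraction_graph \<Gamma>" for x s y t
  proof -
    obtain a u b v where 1: "(a, u) \<in> \<Gamma>" "(b, v) \<in> \<Gamma>" "b \<noteq> 0" "x = a / b"
      "s = (1 / b) *\<^sub>R u - (a / b\<^sup>2) *\<^sub>R v"
      by (rule fraction_graphE[OF xs])
    obtain c w d z where 2: "(c, w) \<in> \<Gamma>" "(d, z) \<in> \<Gamma>" "d \<noteq> 0" "y = c / d"
      "t = (1 / d) *\<^sub>R w - (c / d\<^sup>2) *\<^sub>R z"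
      by (rule fraction_graphE[OF yt])
    note den = D(3)[OF 1(2) 2(2)]
    have "(x - y, s - t) \<in> fraction_graph \<Gamma>"
    proof (rule fraction_graphI[OF D(2)[OF D(3)[OF 1(1) 2(2)] D(3)[OF 1(2) 2(1)]] den])
      have "(1 / (b * d)) *\<^sub>R (a *\<^sub>R z + d *\<^sub>R u - (b *\<^sub>R w + c *\<^sub>R v))
          - ((a * d - b * c) / (b * d)\<^sup>2) *\<^sub>R (b *\<^sub>R z + d *\<^sub>R v)
        = (d / (b * d)) *\<^sub>R u + (- (b / (b * d))) *\<^sub>R w
          + (a / (b * d) - (a * d - b * c) / (b * d)\<^sup>2 * b) *\<^sub>R z
          + (- (c / (b * d)) - (a * d - b * c) / (b * d)\<^sup>2 * d) *\<^sub>R v"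
        by (simp add: scaleR_add_right scaleR_diff_right scaleR_add_left scaleR_diff_left)
      moreover have "d / (b * d) = 1 / b" "- (b / (b * d)) = - (1 / d)"
        "a / (b * d) - (a * d - b * c) / (b * d)\<^sup>2 * b = c / d\<^sup>2"
        "- (c / (b * d)) - (a * d - b * c) / (b * d)\<^sup>2 * d = - (a / b\<^sup>2)"
        using 1(3) 2(3) by (simp_all add: field_simps power2_eq_square)
      ultimately show "s - t = (1 / (b * d)) *\<^sub>R (a *\<^sub>R z + d *\<^sub>R u - (b *\<^sub>R w + c *\<^sub>R v))
          - ((a * d - b * c) / (b * d)\<^sup>2) *\<^sub>R (b *\<^sub>R z + d *\<^sub>R v)"
        by (simp add: 1(5) 2(5))
    qed (use 1 2 in \<open>simp_all add: field_simps\<close>)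
    moreover have "(x * y, x *\<^sub>R t + y *\<^sub>R s) \<in> fraction_graph \<Gamma>"
    proof (rule fraction_graphI[OF D(3)[OF 1(1) 2(1)] den])
      have eqs: "(a * c) / (b * d)\<^sup>2 * b = a / b * (c / d\<^sup>2)" "(a * c) / (b * d)\<^sup>2 * d = c / d * (a / b\<^sup>2)"
        "1 / (b * d) * a = a / b * (1 / d)" "1 / (b * d) * c = c / d * (1 / b)"
        using 1(3) 2(3) by (simp_all add: field_simps power2_eq_square)
      have "x *\<^sub>R t + y *\<^sub>R s = ((a / b * (1 / d)) *\<^sub>R w - (a / b * (c / d\<^sup>2)) *\<^sub>R z)
          + ((c / d * (1 / b)) *\<^sub>R u - (c / d * (a / b\<^sup>2)) *\<^sub>R v)"
        by (simp only: 1(4,5) 2(4,5) scaleR_diff_right scaleR_scaleR)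
      also have "\<dots> = ((a / b * (1 / d)) *\<^sub>R w + (c / d * (1 / b)) *\<^sub>R u)
          - ((a / b * (c / d\<^sup>2)) *\<^sub>R z + (c / d * (a / b\<^sup>2)) *\<^sub>R v)"
        by (rule add_diff_add[symmetric])
      also have "\<dots> = (1 / (b * d)) *\<^sub>R (a *\<^sub>R w + c *\<^sub>R u)
          - ((a * c) / (b * d)\<^sup>2) *\<^sub>R (b *\<^sub>R z + d *\<^sub>R v)"
        by (simp only: eqs scaleR_add_right scaleR_scaleR)
      finally show "x *\<^sub>R t + y *\<^sub>R s = (1 / (b * d)) *\<^sub>R (a *\<^sub>R w + c *\<^sub>R u)
          - ((a * c) / (b * d)\<^sup>2) *\<^sub>R (b *\<^sub>R z + d *\<^sub>R v)" .
    qed (use 1 2 in simp_all)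
    ultimately show ?thesis ..
  qed
  \<comment> \<open>Single-valuedness is a question over \<open>0\<close> only: there the numerator
    is \<open>0\<close>, hence so is its derivative.\<close>
  have "u = 0" if "(0, u) \<in> fraction_graph \<Gamma>" for u
    using that D(4) by (auto elim!: fraction_graphE)
  moreover have "(1, 0) \<in> fraction_graph \<Gamma>"
    using fraction_graph_superset[OF assms] D(1) by blast
  ultimately show ?thesis
    unfolding derivation_graph_def by (intro conjI allI impI) (simp_all add: closed)
qed

definition inverse_closed :: "(real \<times> 'b) set \<Rightarrow> bool" where
  "inverse_closed \<Gamma> \<longleftrightarrow> (\<forall>a\<in>fst ` \<Gamma>. inverse a \<in> fst ` \<Gamma>)"

lemma inverse_closed_fraction:
  assumes "derivation_graph \<Gamma>"
  shows "inverse_closed (fraction_graph \<Gamma>)"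
  unfolding inverse_closed_def
proof
  fix x assume "x \<in> fst ` fraction_graph \<Gamma>"
  then obtain a u b v where 1: "(a, u) \<in> \<Gamma>" "(b, v) \<in> \<Gamma>" "b \<noteq> 0" "x = a / b"
    unfolding fraction_graph_def by auto
  show "inverse x \<in> fst ` fraction_graph \<Gamma>"
  proof (cases "a = 0")
    case True
    then show ?thesis using \<open>x \<in> _\<close> 1 by simp
  next
    case False
    then have "(inverse x, (1 / a) *\<^sub>R v - (b / a\<^sup>2) *\<^sub>R u) \<in> fraction_graph \<Gamma>"
      using 1 by (intro fraction_graphI[OF 1(2,1)]) auto
    then show ?thesis by force
  qed
qed

lemma countable_fraction:
  assumes "countable \<Gamma>"
  shows "countable (fraction_graph \<Gamma>)"
proof -
  have "fraction_graph \<Gamma> \<subseteq> (\<lambda>((a, u), (b, v)). (a / b, (1 / b) *\<^sub>R u - (a / b\<^sup>2) *\<^sub>R v)) ` (\<Gamma> \<times> \<Gamma>)"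
    unfolding fraction_graph_def by force
  then show ?thesis using assms by (meson countable_SIGMA countable_image countable_subset)
qed

section \<open>Adjoining one real number\<close>

locale subfield_derivation =
  fixes F :: "real set" and D :: "real \<Rightarrow> 'b::real_vector"
  assumes one_F: "1 \<in> F"
    and diff_F: "a \<in> F \<Longrightarrow> b \<in> F \<Longrightarrow> a - b \<in> F"
    and mult_F: "a \<in> F \<Longrightarrow> b \<in> F \<Longrightarrow> a * b \<in> F"
    and inverse_F: "a \<in> F \<Longrightarrow> inverse a \<in> F"
    and D_diff: "a \<in> F \<Longrightarrow> b \<in> F \<Longrightarrow> D (a - b) = D a - D b"
    and D_mult: "a \<in> F \<Longrightarrow> b \<in> F \<Longrightarrow> D (a * b) = a *\<^sub>R D b + b *\<^sub>R D a"
begin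

lemma zero_F: "0 \<in> F" using diff_F[OF one_F one_F] by simp

lemma add_F: "a \<in> F \<Longrightarrow> b \<in> F \<Longrightarrow> a + b \<in> F"
  using diff_F[OF _ diff_F[OF zero_F], of a b] by simp

lemma D_zero: "D 0 = 0" using D_diff[OF one_F one_F] by simp

lemma D_one: "D 1 = 0" using D_mult[OF one_F one_F] by simp

lemma D_add: "a \<in> F \<Longrightarrow> b \<in> F \<Longrightarrow> D (a + b) = D a + D b"
  using D_diff[of "a + b" b] add_F[of a b] by simp

lemma of_nat_F: "of_nat n \<in> F"
  by (induction n) (auto intro: zero_F one_F add_F)

definition over :: "real poly \<Rightarrow> bool" where
  "over p \<longleftrightarrow> (\<forall>i. coeff p i \<in> F)"

lemma over_0: "over 0" by (simp add: over_def zero_F)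

lemma over_pCons_iff: "over (pCons a p) \<longleftrightarrow> a \<in> F \<and> over p"
  by (auto simp: over_def coeff_pCons split: nat.splits)

lemma over_diff: "over p \<Longrightarrow> over q \<Longrightarrow> over (p - q)"
  by (simp add: over_def diff_F)

lemma over_add: "over p \<Longrightarrow> over q \<Longrightarrow> over (p + q)"
  by (simp add: over_def add_F)

lemma over_smult: "a \<in> F \<Longrightarrow> over p \<Longrightarrow> over (smult a p)"
  by (simp add: over_def mult_F)

lemma over_mult: "over p \<Longrightarrow> over q \<Longrightarrow> over (p * q)"
  by (induction p) (auto simp: over_pCons_iff over_0 zero_F intro!: over_add over_smult)

lemma over_monom: "a \<in> F \<Longrightarrow> over (monom a n)"
  by (simp add: over_def zero_F)

lemma over_pderiv: "over p \<Longrightarrow> over (pderiv p)"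
  unfolding over_def coeff_pderiv by (metis of_nat_F mult_F)

text \<open>\<open>D\<close> applied to the coefficients of \<open>p\<close>, then evaluated at
  \<open>a\<close>.\<close>

definition coeff_deriv :: "real \<Rightarrow> real poly \<Rightarrow> 'b" where
  "coeff_deriv a p = (\<Sum>i\<le>degree p. a ^ i *\<^sub>R D (coeff p i))"

lemma coeff_deriv_bound:
  assumes "degree p \<le> n"
  shows "coeff_deriv a p = (\<Sum>i\<le>n. a ^ i *\<^sub>R D (coeff p i))"
  unfolding coeff_deriv_def using assms
  by (intro sum.mono_neutral_left) (auto simp: D_zero coeff_eq_0)

lemma coeff_deriv_0 [simp]: "coeff_deriv a 0 = 0"
  by (simp add: coeff_deriv_def D_zero)

lemma coeff_deriv_pCons: "coeff_deriv a (pCons c p) = D c + a *\<^sub>R coeff_deriv a p"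
proof -
  have "coeff_deriv a (pCons c p) = (\<Sum>i\<le>Suc (degree p). a ^ i *\<^sub>R D (coeff (pCons c p) i))"
    by (intro coeff_deriv_bound degree_pCons_le)
  also have "\<dots> = D c + a *\<^sub>R coeff_deriv a p"
    by (subst sum.atMost_Suc_shift) (simp add: coeff_deriv_def scaleR_sum_right)
  finally show ?thesis .
qed

lemma coeff_deriv_diff:
  assumes "over p" "over q"
  shows "coeff_deriv a (p - q) = coeff_deriv a p - coeff_deriv a q"
proof -
  let ?n = "max (degree p) (degree q)"
  have "coeff_deriv a (p - q) = (\<Sum>i\<le>?n. a ^ i *\<^sub>R D (coeff (p - q) i))"
    by (intro coeff_deriv_bound degree_diff_le_max)
  also have "\<dots> = (\<Sum>i\<le>?n. a ^ i *\<^sub>R D (coeff p i)) - (\<Sum>i\<le>?n. a ^ i *\<^sub>R D (coeff q i))"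
    using assms by (simp add: over_def D_diff scaleR_diff_right sum_subtractf)
  finally show ?thesis
    by (simp add: coeff_deriv_bound[of p ?n] coeff_deriv_bound[of q ?n])
qed

lemma coeff_deriv_add:
  assumes "over p" "over q"
  shows "coeff_deriv a (p + q) = coeff_deriv a p + coeff_deriv a q"
  using coeff_deriv_diff[OF over_add[OF assms] assms(2), of a] by simp

lemma coeff_deriv_smult:
  assumes "c \<in> F" "over p"
  shows "coeff_deriv a (smult c p) = c *\<^sub>R coeff_deriv a p + poly p a *\<^sub>R D c"
  using assms(2)
proof (induction p)
  case (pCons b p)
  then show ?case
    using assms(1) by (simp add: over_pCons_iff coeff_deriv_pCons D_mult algebra_simps)
qed simp

lemma coeff_deriv_mult:
  assumes "over p" "over q"
  shows "coeff_deriv a (p * q) = poly p a *\<^sub>R coeff_deriv a q + poly q a *\<^sub>R coeff_deriv a p"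
  using assms(1)
proof (induction p)
  case (pCons b p)
  then have "b \<in> F" "over p" by (auto simp: over_pCons_iff)
  then have "coeff_deriv a (pCons b p * q) = coeff_deriv a (smult b q) + coeff_deriv a (pCons 0 (p * q))"
    using assms(2) by (simp add: coeff_deriv_add over_smult over_mult over_pCons_iff zero_F)
  then show ?case
    using pCons.IH \<open>over p\<close> \<open>b \<in> F\<close> assms(2)
    by (simp add: coeff_deriv_smult coeff_deriv_pCons D_zero algebra_simps)
qed simp

text \<open>By the chain rule, the only possible value at \<open>poly p a\<close> of a derivation
  that extends \<open>D\<close> and sends \<open>a\<close> to \<open>\<delta>\<close>.\<close>

definition eval_deriv :: "real \<Rightarrow> 'b \<Rightarrow> real poly \<Rightarrow> 'b" where
  "eval_deriv a \<delta> p = coeff_deriv a p + poly (pderiv p) a *\<^sub>R \<delta>"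

lemma eval_deriv_diff:
  "over p \<Longrightarrow> over q \<Longrightarrow> eval_deriv a \<delta> (p - q) = eval_deriv a \<delta> p - eval_deriv a \<delta> q"
  by (simp add: eval_deriv_def coeff_deriv_diff pderiv_diff scaleR_diff_left)

lemma eval_deriv_mult:
  "over p \<Longrightarrow> over q \<Longrightarrow>
   eval_deriv a \<delta> (p * q) = poly p a *\<^sub>R eval_deriv a \<delta> q + poly q a *\<^sub>R eval_deriv a \<delta> p"
  by (simp add: eval_deriv_def coeff_deriv_mult pderiv_mult algebra_simps)

definition adjoin :: "real \<Rightarrow> 'b \<Rightarrow> (real \<times> 'b) set" where
  "adjoin a \<delta> = {(poly p a, eval_deriv a \<delta> p) | p. over p}"

lemma adjoin_in: "(a, \<delta>) \<in> adjoin a \<delta>"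
  unfolding adjoin_def
  by (rule CollectI, rule exI[of _ "[:0, 1:]"])
    (simp add: over_pCons_iff over_0 zero_F one_F eval_deriv_def coeff_deriv_pCons D_zero D_one
      pderiv_pCons)

lemma adjoin_base: "x \<in> F \<Longrightarrow> (x, D x) \<in> adjoin a \<delta>"
  unfolding adjoin_def
  by (rule CollectI, rule exI[of _ "[:x:]"])
    (simp add: over_pCons_iff over_0 eval_deriv_def coeff_deriv_pCons pderiv_pCons)

text \<open>The hypothesis is well-definedness: a number in the ring generated by \<open>a\<close>
  may be represented by several polynomials.\<close>

lemma derivation_graph_adjoin:
  assumes "\<And>p. over p \<Longrightarrow> poly p a = 0 \<Longrightarrow> eval_deriv a \<delta> p = 0"
  shows "derivation_graph (adjoin a \<delta>)"
  unfolding derivation_graph_def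
proof (intro conjI allI impI)
  show "(1, 0) \<in> adjoin a \<delta>" using adjoin_base[OF one_F, of a \<delta>] by (simp add: D_one)
next
  fix x u y v assume "(x, u) \<in> adjoin a \<delta>" "(y, v) \<in> adjoin a \<delta>"
  then obtain p q where p: "over p" "x = poly p a" "u = eval_deriv a \<delta> p"
    and q: "over q" "y = poly q a" "v = eval_deriv a \<delta> q"
    unfolding adjoin_def by blast
  show "(x - y, u - v) \<in> adjoin a \<delta>"
    unfolding adjoin_def using p q over_diff[OF p(1) q(1)]
    by (intro CollectI exI[of _ "p - q"]) (simp add: eval_deriv_diff)
  show "(x * y, x *\<^sub>R v + y *\<^sub>R u) \<in> adjoin a \<delta>"
    unfolding adjoin_def using p q over_mult[OF p(1) q(1)]
    by (intro CollectI exI[of _ "p * q"]) (simp add: eval_deriv_mult)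
next
  fix u assume "(0, u) \<in> adjoin a \<delta>"
  then show "u = 0" using assms unfolding adjoin_def by fastforce
qed

text \<open>If \<open>a\<close> is algebraic with minimal polynomial \<open>p\<close>, the value at \<open>a\<close> is forced by \<open>p(a) = 0\<close>.\<close>

lemma adjoin_exists: "\<exists>\<delta>. \<forall>p. over p \<longrightarrow> poly p a = 0 \<longrightarrow> eval_deriv a \<delta> p = 0"
proof (cases "\<exists>p. over p \<and> p \<noteq> 0 \<and> poly p a = 0")
  case False
  then have "eval_deriv a 0 p = 0" if "over p" "poly p a = 0" for p
    using that by (cases "p = 0") (auto simp: eval_deriv_def)
  then show ?thesis by blast
next
  case True
  define P where "P = (\<lambda>p. over p \<and> p \<noteq> 0 \<and> poly p a = 0)"
  obtain p where p: "P p" and min: "\<And>q. P q \<Longrightarrow> degree p \<le> degree q"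
    using ex_has_least_nat[of P _ degree] True unfolding P_def by blast
  \<comment> \<open>Separability in characteristic zero: the derivative is nonzero of smaller
    degree, so it cannot vanish at \<open>a\<close> by minimality.\<close>
  have "poly (pderiv p) a \<noteq> 0"
  proof
    assume z: "poly (pderiv p) a = 0"
    have "degree p \<noteq> 0"
    proof
      assume "degree p = 0"
      then obtain c where "p = [:c:]" by (rule degree_eq_zeroE)
      then show False using p by (simp add: P_def)
    qed
    then have "pderiv p \<noteq> 0" "degree (pderiv p) < degree p"
      by (auto simp: pderiv_eq_0_iff degree_pderiv)
    then show False using min[of "pderiv p"] z p over_pderiv by (auto simp: P_def)
  qed
  define \<delta> where "\<delta> = - ((1 / poly (pderiv p) a) *\<^sub>R coeff_deriv a p)"
  have p0: "eval_deriv a \<delta> p = 0"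
    using \<open>poly (pderiv p) a \<noteq> 0\<close> by (simp add: eval_deriv_def \<delta>_def)
  have "eval_deriv a \<delta> q = 0" if "over q" "poly q a = 0" for q
    using that
  proof (induction "degree q" arbitrary: q rule: less_induct)
    case less
    show ?case
    proof (cases "q = 0")
      case True
      then show ?thesis by (simp add: eval_deriv_def)
    next
      case False
      then have le: "degree p \<le> degree q" using less.prems by (intro min) (simp add: P_def)
      \<comment> \<open>One step of division by \<open>p\<close>: subtracting \<open>m * p\<close>
        removes the leading term of \<open>q\<close>. Coefficients stay in \<open>F\<close> because
        it is closed under inverses.\<close>
      define m where "m = monom (lead_coeff q * inverse (lead_coeff p)) (degree q - degree p)"
      have pn: "p \<noteq> 0" "over p" "poly p a = 0" using p by (auto simp: P_def)
      have m: "over m"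
        unfolding m_def using less.prems pn
        by (intro over_monom mult_F inverse_F) (auto simp: over_def)
      have z: "eval_deriv a \<delta> (m * p) = 0"
        using m pn p0 by (simp add: eval_deriv_mult)
      let ?q = "q - m * p"
      have oq: "over ?q" using less.prems m pn by (intro over_diff over_mult)
      have "eval_deriv a \<delta> ?q = 0"
      proof (cases "?q = 0")
        case True
        then show ?thesis by (simp add: eval_deriv_def)
      next
        case False
        have "degree (m * p) \<le> degree q"
          using le degree_mult_le[of m p] degree_monom_le[of "lead_coeff q * inverse (lead_coeff p)" "degree q - degree p"]
          by (simp add: m_def)
        then have "degree ?q \<le> degree q" by (intro degree_diff_le) auto
        moreover have "coeff ?q (degree q) = 0"
          using le pn by (simp add: m_def coeff_monom_mult)
        then have "degree ?q \<noteq> degree q" using False by (metis leading_coeff_neq_0)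
        ultimately have "degree ?q < degree q" by simp
        then show ?thesis using less.hyps[of ?q] oq less.prems pn by simp
      qed
      then show ?thesis
        using z eval_deriv_diff[of q "m * p"] less.prems m pn over_mult by simp
    qed
  qed
  then show ?thesis by blast
qed

lemma countable_over:
  assumes "countable F"
  shows "countable {p. over p}"
proof -
  have "coeffs ` {p. over p} \<subseteq> lists F"
    by (auto simp: over_def coeffs_def)
  then have "countable (coeffs ` {p. over p})"
    using assms by (meson countable_lists countable_subset)
  then show ?thesis by (rule countable_image_inj_on) (simp add: coeffs_eq_iff inj_onI)
qed

lemma countable_adjoin: "countable F \<Longrightarrow> countable (adjoin a \<delta>)"
proof -
  assume "countable F"
  then have "countable ((\<lambda>p. (poly p a, eval_deriv a \<delta> p)) ` {p. over p})"
    using countable_over by blast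
  then show ?thesis unfolding adjoin_def by (simp add: image_Collect)
qed

text \<open>Over a countable field there are only countably many algebraic numbers.\<close>

lemma transcendental_exists:
  assumes "countable F"
  shows "\<exists>a. \<forall>p. over p \<longrightarrow> poly p a = 0 \<longrightarrow> p = 0"
proof -
  have "countable (\<Union>p\<in>{p. over p} - {0}. {a. poly p a = 0})"
    using countable_over[OF assms]
    by (intro countable_UN countable_Diff) (auto intro: countable_finite poly_roots_finite)
  then have "(\<Union>p\<in>{p. over p} - {0}. {a. poly p a = 0}) \<noteq> UNIV"
    using uncountable_UNIV_real by metis
  then show ?thesis by blast
qed

end

section \<open>Derivations with prescribed values at a generic point\<close>

lemma derivation_graph_subfield:
  fixes \<Gamma> :: "(real \<times> 'b::real_vector) set"
  assumes "derivation_graph \<Gamma>" "inverse_closed \<Gamma>"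
  obtains F D where "subfield_derivation F D" "\<Gamma> = (\<lambda>x. (x, D x)) ` F" "F = fst ` \<Gamma>"
proof -
  define F where "F = fst ` \<Gamma>"
  define D where "D = (\<lambda>x. THE u. (x, u) \<in> \<Gamma>)"
  have D: "D x = u" if "(x, u) \<in> \<Gamma>" for x u
    unfolding D_def using that derivation_graph_unique[OF assms(1)] by blast
  have DF: "(x, D x) \<in> \<Gamma>" if "x \<in> F" for x
    using that D by (auto simp: F_def)
  note G = derivation_graphD[OF assms(1)]
  have "subfield_derivation F D"
  proof
    show "1 \<in> F" using G(1) by (force simp: F_def)
  next
    fix a b assume a: "a \<in> F" and b: "b \<in> F"
    note G(2)[OF DF[OF a] DF[OF b]] G(3)[OF DF[OF a] DF[OF b]]
    then show "a - b \<in> F" "a * b \<in> F" "D (a - b) = D a - D b" "D (a * b) = a *\<^sub>R D b + b *\<^sub>R D a"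
      using D by (force simp: F_def)+
  next
    fix a assume "a \<in> F"
    then show "inverse a \<in> F" using assms(2) unfolding F_def inverse_closed_def by blast
  qed
  moreover have "\<Gamma> = (\<lambda>x. (x, D x)) ` F"
    using D unfolding F_def by force
  ultimately show thesis using that F_def by blast
qed

text \<open>By Zorn's lemma there is a maximal graph. Passing to fractions cannot enlarge it, so its
  domain is a field; adjoining a real cannot enlarge it either, so its domain is everything.\<close>

lemma derivation_graph_maximal:
  fixes \<Gamma>0 :: "(real \<times> 'b::real_vector) set"
  assumes "derivation_graph \<Gamma>0"
  shows "\<exists>D. (\<forall>(x, u)\<in>\<Gamma>0. D x = u) \<and> (\<forall>a b. D (a - b) = D a - D b) \<and>
    (\<forall>a b. D (a * b) = a *\<^sub>R D b + b *\<^sub>R D a)"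
proof -
  define \<A> where "\<A> = {\<Gamma>. derivation_graph \<Gamma> \<and> \<Gamma>0 \<subseteq> \<Gamma>}"
  have "\<exists>M\<in>\<A>. \<forall>X\<in>\<A>. M \<subseteq> X \<longrightarrow> X = M"
  proof (rule subset_Zorn_nonempty)
    show "\<A> \<noteq> {}" using assms by (auto simp: \<A>_def)
  next
    fix \<C> assume ne: "\<C> \<noteq> {}" and ch: "subset.chain \<A> \<C>"
    have dg: "derivation_graph X" "\<Gamma>0 \<subseteq> X" if "X \<in> \<C>" for X
      using ch that by (auto simp: \<A>_def subset.chain_def)
    have common: "\<exists>X\<in>\<C>. x \<in> X \<and> y \<in> X" if "x \<in> \<Union>\<C>" "y \<in> \<Union>\<C>" for x y
    proof -
      obtain X Y where XY: "X \<in> \<C>" "Y \<in> \<C>" "x \<in> X" "y \<in> Y" using \<open>x \<in> \<Union>\<C>\<close> \<open>y \<in> \<Union>\<C>\<close> by blast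
      then have "X \<subseteq> Y \<or> Y \<subseteq> X" using ch by (auto simp: subset_chain_def)
      then show ?thesis using XY by blast
    qed
    have "derivation_graph (\<Union>\<C>)"
      unfolding derivation_graph_def
    proof (intro conjI allI impI)
      show "(1, 0) \<in> \<Union>\<C>" using ne dg(1) derivation_graphD(1) by blast
    next
      fix a u b v assume "(a, u) \<in> \<Union>\<C>" "(b, v) \<in> \<Union>\<C>"
      then obtain X where X: "X \<in> \<C>" "(a, u) \<in> X" "(b, v) \<in> X" using common by blast
      show "(a - b, u - v) \<in> \<Union>\<C>" "(a * b, a *\<^sub>R v + b *\<^sub>R u) \<in> \<Union>\<C>"
        using derivation_graphD(2,3)[OF dg(1)[OF X(1)] X(2,3)] X(1) by blast+
    next
      fix u assume "(0, u) \<in> \<Union>\<C>"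
      then show "u = 0" using dg(1) derivation_graphD(4) by blast
    qed
    moreover have "\<Gamma>0 \<subseteq> \<Union>\<C>" using ne dg(2) by blast
    ultimately show "\<Union>\<C> \<in> \<A>" by (simp add: \<A>_def)
  qed
  then obtain M where "M \<in> \<A>" and maxA: "\<And>X. X \<in> \<A> \<Longrightarrow> M \<subseteq> X \<Longrightarrow> X = M"
    by metis
  then have M: "derivation_graph M" "\<Gamma>0 \<subseteq> M" by (simp_all add: \<A>_def)
  have max: "X = M" if "derivation_graph X" "M \<subseteq> X" for X
    using that M(2) by (intro maxA) (auto simp: \<A>_def)
  have "fraction_graph M = M"
    using max derivation_graph_fraction[OF M(1)] fraction_graph_superset[OF M(1)] by blast
  then have "inverse_closed M" using inverse_closed_fraction[OF M(1)] by simp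
  from derivation_graph_subfield[OF M(1) this]
  obtain F D where FD: "subfield_derivation F D" "M = (\<lambda>x. (x, D x)) ` F" by metis
  interpret subfield_derivation F D by (rule FD(1))
  have "a \<in> F" for a
  proof -
    obtain \<delta> where "\<And>p. over p \<Longrightarrow> poly p a = 0 \<Longrightarrow> eval_deriv a \<delta> p = 0"
      using adjoin_exists by blast
    then have "derivation_graph (adjoin a \<delta>)" by (rule derivation_graph_adjoin)
    moreover have "M \<subseteq> adjoin a \<delta>" using adjoin_base FD(2) by auto
    ultimately have "adjoin a \<delta> = M" by (rule max)
    then have "(a, \<delta>) \<in> M" using adjoin_in by blast
    then show ?thesis using FD(2) by auto
  qed
  then show ?thesis
    using D_diff D_mult M(2) FD(2) by (intro exI[of _ D]) auto
qed

text \<open>The zero derivation on the rationals, extended by adjoining the given constants with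
  derivative zero. Countability is carried along so that transcendental numbers remain
  available.\<close>

lemma constant_derivation_exists:
  assumes "finite C"
  shows "\<exists>\<Gamma> :: (real \<times> 'b::real_vector) set. derivation_graph \<Gamma> \<and> inverse_closed \<Gamma> \<and>
    countable \<Gamma> \<and> (\<forall>(x, u)\<in>\<Gamma>. u = 0) \<and> C \<subseteq> fst ` \<Gamma>"
  using assms
proof (induction C rule: finite_induct)
  case empty
  let ?\<Gamma> = "(\<lambda>q. (of_rat q, 0)) ` UNIV :: (real \<times> 'b) set"
  have "derivation_graph ?\<Gamma>"
    unfolding derivation_graph_def
  proof (intro conjI allI impI)
    show "(1, 0) \<in> ?\<Gamma>" by (rule image_eqI[of _ _ 1]) auto
  next
    fix a b :: real and u v :: 'b assume "(a, u) \<in> ?\<Gamma>" "(b, v) \<in> ?\<Gamma>"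
    then obtain p q where "a = of_rat p" "u = 0" "b = of_rat q" "v = 0" by auto
    then show "(a - b, u - v) \<in> ?\<Gamma>" "(a * b, a *\<^sub>R v + b *\<^sub>R u) \<in> ?\<Gamma>"
      by (auto simp flip: of_rat_diff of_rat_mult)
  qed auto
  moreover have "inverse_closed ?\<Gamma>"
    unfolding inverse_closed_def by (auto simp: image_image simp flip: of_rat_inverse)
  ultimately show ?case by (intro exI[of _ ?\<Gamma>]) auto
next
  case (insert c C)
  then obtain \<Gamma> :: "(real \<times> 'b) set" where \<Gamma>: "derivation_graph \<Gamma>" "inverse_closed \<Gamma>" "countable \<Gamma>"
    "\<forall>(x, u)\<in>\<Gamma>. u = 0" "C \<subseteq> fst ` \<Gamma>" by blast
  obtain F D where FD: "subfield_derivation F D" "\<Gamma> = (\<lambda>x. (x, D x)) ` F" "F = fst ` \<Gamma>"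
    using derivation_graph_subfield[OF \<Gamma>(1,2)] by metis
  interpret subfield_derivation F D by (rule FD(1))
  have D0: "D x = 0" if "x \<in> F" for x using that \<Gamma>(4) FD(2) by auto
  have z: "eval_deriv c 0 p = 0" if "over p" for p
    using that D0 by (simp add: eval_deriv_def coeff_deriv_def over_def)
  let ?\<Gamma> = "fraction_graph (adjoin c 0)"
  have dg: "derivation_graph (adjoin c 0)" by (rule derivation_graph_adjoin) (rule z)
  have sub: "adjoin c 0 \<subseteq> ?\<Gamma>" by (rule fraction_graph_superset[OF dg])
  have "\<forall>(x, u)\<in>adjoin c 0. u = 0" using z by (auto simp: adjoin_def)
  then have z0: "u = 0" if "(x, u) \<in> adjoin c 0" for x u using that by blast
  have "\<forall>(x, u)\<in>?\<Gamma>. u = 0"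
    by (auto elim!: fraction_graphE dest!: z0)
  moreover have "insert c C \<subseteq> fst ` ?\<Gamma>"
  proof -
    have "c \<in> fst ` ?\<Gamma>" using adjoin_in sub by (force simp: image_iff)
    moreover have "C \<subseteq> fst ` ?\<Gamma>"
    proof
      fix x assume "x \<in> C"
      then have "(x, D x) \<in> ?\<Gamma>" using \<Gamma>(5) FD(3) adjoin_base sub by blast
      then show "x \<in> fst ` ?\<Gamma>" by force
    qed
    ultimately show ?thesis by simp
  qed
  moreover have "countable ?\<Gamma>"
    using \<Gamma>(3) FD(3) by (intro countable_fraction countable_adjoin) simp
  ultimately show ?case
    using derivation_graph_fraction[OF dg] inverse_closed_fraction[OF dg] by blast
qed

text \<open>Each new coordinate is chosen transcendental over the countable field built so far, so
  no relation restricts its derivative and \<open>z i\<close> may be prescribed.\<close>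

lemma generic_point_graph_exists:
  fixes z :: "'n \<Rightarrow> 'b::real_vector"
  assumes "finite C" "finite A"
  shows "\<exists>(\<Gamma> :: (real \<times> 'b) set) y. derivation_graph \<Gamma> \<and> inverse_closed \<Gamma> \<and> countable \<Gamma> \<and>
    (\<forall>c\<in>C. (c, 0) \<in> \<Gamma>) \<and> (\<forall>i\<in>A. (y i, z i) \<in> \<Gamma>)"
  using assms(2)
proof (induction A rule: finite_induct)
  case empty
  obtain \<Gamma> :: "(real \<times> 'b) set" where \<Gamma>: "derivation_graph \<Gamma>" "inverse_closed \<Gamma>" "countable \<Gamma>"
    "\<forall>(x, u)\<in>\<Gamma>. u = 0" "C \<subseteq> fst ` \<Gamma>" using constant_derivation_exists[OF assms(1)] by blast
  have "(c, 0) \<in> \<Gamma>" if "c \<in> C" for c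
  proof -
    have "c \<in> fst ` \<Gamma>" using that \<Gamma>(5) by blast
    then obtain u where "(c, u) \<in> \<Gamma>" by auto
    then show ?thesis using \<Gamma>(4) by auto
  qed
  then show ?case using \<Gamma> by blast
next
  case (insert i A)
  then obtain \<Gamma> :: "(real \<times> 'b) set" and y where \<Gamma>: "derivation_graph \<Gamma>" "inverse_closed \<Gamma>" "countable \<Gamma>"
    "\<forall>c\<in>C. (c, 0) \<in> \<Gamma>" "\<forall>i\<in>A. (y i, z i) \<in> \<Gamma>" by blast
  obtain F D where FD: "subfield_derivation F D" "\<Gamma> = (\<lambda>x. (x, D x)) ` F" "F = fst ` \<Gamma>"
    using derivation_graph_subfield[OF \<Gamma>(1,2)] by metis
  interpret subfield_derivation F D by (rule FD(1))
  have cF: "countable F" using \<Gamma>(3) FD(3) by simp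
  obtain a where a: "\<And>p. over p \<Longrightarrow> poly p a = 0 \<Longrightarrow> p = 0"
    using transcendental_exists[OF cF] by blast
  have dg: "derivation_graph (adjoin a (z i))"
    by (rule derivation_graph_adjoin) (auto dest!: a simp: eval_deriv_def)
  let ?\<Gamma> = "fraction_graph (adjoin a (z i))"
  have sub: "adjoin a (z i) \<subseteq> ?\<Gamma>" by (rule fraction_graph_superset[OF dg])
  have sub': "\<Gamma> \<subseteq> ?\<Gamma>" using FD(2) adjoin_base sub by blast
  have "((y(i := a)) j, z j) \<in> ?\<Gamma>" if "j \<in> insert i A" for j
    using that adjoin_in sub \<Gamma>(5) sub' by auto
  moreover have "\<forall>c\<in>C. (c, 0) \<in> ?\<Gamma>" using \<Gamma>(4) sub' by blast
  ultimately show ?case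
    using derivation_graph_fraction[OF dg] inverse_closed_fraction[OF dg]
      countable_fraction[OF countable_adjoin[OF cF]] by blast
qed

text \<open>The derivation must be defined on all reals, because it will be applied to the entries
  of a certificate, which may lie outside the countable field.\<close>

lemma generic_derivation_exists:
  fixes z :: "'n::finite \<Rightarrow> 'b::real_vector"
  assumes "finite C"
  shows "\<exists>(D :: real \<Rightarrow> 'b) y. (\<forall>a b. D (a - b) = D a - D b) \<and>
    (\<forall>a b. D (a * b) = a *\<^sub>R D b + b *\<^sub>R D a) \<and> (\<forall>c\<in>C. D c = 0) \<and> (\<forall>i. D (y i) = z i)"
proof -
  obtain \<Gamma> :: "(real \<times> 'b) set" and y where \<Gamma>: "derivation_graph \<Gamma>"
    "\<forall>c\<in>C. (c, 0) \<in> \<Gamma>" "\<forall>i\<in>UNIV. (y i, z i) \<in> \<Gamma>"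
    using generic_point_graph_exists[OF assms finite, of UNIV z] by blast
  from derivation_graph_maximal[OF \<Gamma>(1)] \<Gamma>(2,3) show ?thesis by (auto simp: Ball_def) metis
qed

section \<open>The Taylor homomorphism at a generic point\<close>

unbundle no vec_syntax
unbundle fps_syntax

lemma lookup_scaleR [simp]: "Poly_Mapping.lookup (c *\<^sub>R p) k = c *\<^sub>R Poly_Mapping.lookup p k"
proof -
  have "finite {i. c *\<^sub>R Poly_Mapping.lookup p i \<noteq> 0}"
    by (rule finite_subset[OF _ finite_keys[of p]]) (auto simp: in_keys_iff)
  then show ?thesis by (simp add: scaleR_poly_mapping_def)
qed

lemma poly_mapping_sum_single:
  fixes p :: "'a \<Rightarrow>\<^sub>0 'b::comm_monoid_add"
  assumes "finite A" "Poly_Mapping.keys p \<subseteq> A"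
  shows "p = (\<Sum>m\<in>A. Poly_Mapping.single m (Poly_Mapping.lookup p m))"
proof (rule poly_mapping_eqI)
  fix k
  have "Poly_Mapping.lookup (\<Sum>m\<in>A. Poly_Mapping.single m (Poly_Mapping.lookup p m)) k
     = (\<Sum>m\<in>A. if m = k then Poly_Mapping.lookup p m else 0)"
    by (simp add: lookup_sum lookup_single when_def)
  also have "\<dots> = Poly_Mapping.lookup p k"
    using assms by (auto simp: in_keys_iff)
  finally show "Poly_Mapping.lookup p k
    = Poly_Mapping.lookup (\<Sum>m\<in>A. Poly_Mapping.single m (Poly_Mapping.lookup p m)) k" ..
qed

lemma poly_mapping_single_induct [case_names zero single add]:
  fixes p :: "'a \<Rightarrow>\<^sub>0 'b::comm_monoid_add"
  assumes "P 0" "\<And>m a. P (Poly_Mapping.single m a)" "\<And>p q. P p \<Longrightarrow> P q \<Longrightarrow> P (p + q)"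
  shows "P p"
proof -
  have "P (\<Sum>m\<in>A. Poly_Mapping.single m (Poly_Mapping.lookup p m))" if "finite A" for A
    using that by (induction A rule: finite_induct) (auto intro: assms)
  then show ?thesis
    using poly_mapping_sum_single[OF finite_keys order.refl, of p] by (metis finite_keys)
qed

lemma Const_mult: "Const a * p = a *\<^sub>R p"
proof (induction p rule: poly_mapping_single_induct)
  case (single m b)
  show ?case
    by (rule poly_mapping_eqI) (simp add: Const_def mult_single lookup_single when_def)
qed (simp_all add: distrib_left scaleR_add_right)

lemma Const_0 [simp]: "Const 0 = 0" by (simp add: Const_def)

lemma Const_1 [simp]: "Const 1 = 1" by (simp add: Const_def)

lemma Const_add: "Const (a + b) = Const a + Const b" by (simp add: Const_def single_add)

lemma Const_times: "Const (a * b) = Const a * Const b" by (simp add: Const_def mult_single)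

lemma mpoly_of_nat_times: "of_nat n * (p :: 'v mpoly) = real n *\<^sub>R p"
  by (induction n) (simp_all add: algebra_simps)

lemma mpoly_scaleR_left: "(a *\<^sub>R p) * q = a *\<^sub>R (p * (q :: 'v mpoly))"
  by (simp add: mult.assoc flip: Const_mult)

lemma mpoly_scaleR_right: "p * (a *\<^sub>R q) = a *\<^sub>R (p * (q :: 'v mpoly))"
  by (simp add: mult.left_commute flip: Const_mult)

section \<open>The exponential of a derivation\<close>

locale mpoly_valued_derivation =
  fixes D :: "real \<Rightarrow> 'v mpoly"
  assumes D_diff: "D (a - b) = D a - D b"
    and D_mult: "D (a * b) = a *\<^sub>R D b + b *\<^sub>R D a"
begin

lemma D_0: "D 0 = 0" using D_diff[of 0 0] by simp

lemma D_1: "D 1 = 0" using D_mult[of 1 1] by simp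

lemma D_add: "D (a + b) = D a + D b" using D_diff[of "a + b" b] by simp

text \<open>\<open>D\<close> has polynomial values and so cannot be iterated; \<open>lift\<close> is
  its extension to polynomials that treats the variables as constants.\<close>

definition lift :: "'v mpoly \<Rightarrow> 'v mpoly" where
  "lift p = (\<Sum>m\<in>Poly_Mapping.keys p. Poly_Mapping.single m 1 * D (Poly_Mapping.lookup p m))"

lemma lift_superset:
  assumes "finite A" "Poly_Mapping.keys p \<subseteq> A"
  shows "lift p = (\<Sum>m\<in>A. Poly_Mapping.single m 1 * D (Poly_Mapping.lookup p m))"
  unfolding lift_def using assms
  by (intro sum.mono_neutral_left) (auto simp: in_keys_iff D_0)

lemma lift_0 [simp]: "lift 0 = 0" by (simp add: lift_def)

lemma lift_single: "lift (Poly_Mapping.single m a) = Poly_Mapping.single m 1 * D a"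
  by (subst lift_superset[of "{m}"]) (auto simp: lookup_single)

lemma lift_add: "lift (p + q) = lift p + lift q"
proof -
  let ?A = "Poly_Mapping.keys p \<union> Poly_Mapping.keys q"
  have "lift (p + q) = (\<Sum>m\<in>?A. Poly_Mapping.single m 1 * D (Poly_Mapping.lookup (p + q) m))"
    by (intro lift_superset) (auto simp: in_keys_iff lookup_add)
  also have "\<dots> = lift p + lift q"
    by (simp add: lift_superset[of ?A p] lift_superset[of ?A q] lookup_add D_add distrib_left sum.distrib)
  finally show ?thesis .
qed

lemma lift_sum: "lift (\<Sum>i\<in>A. f i) = (\<Sum>i\<in>A. lift (f i))"
  by (induction A rule: infinite_finite_induct) (simp_all add: lift_add)

lemma lift_mult: "lift (p * q) = p * lift q + lift p * q"
proof (induction p rule: poly_mapping_single_induct)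
  case (single m a)
  show ?case
  proof (induction q rule: poly_mapping_single_induct)
    case (single n b)
    have 1: "Poly_Mapping.single k c = c *\<^sub>R Poly_Mapping.single k (1::real)" for k :: "'v \<Rightarrow>\<^sub>0 nat" and c
      by (rule poly_mapping_eqI) (simp add: lookup_single when_def)
    have "lift (Poly_Mapping.single m a * Poly_Mapping.single n b)
      = Poly_Mapping.single m 1 * Poly_Mapping.single n 1 * (a *\<^sub>R D b + b *\<^sub>R D a)"
      by (simp add: mult_single lift_single D_mult)
    moreover have "Poly_Mapping.single m a * lift (Poly_Mapping.single n b)
        + lift (Poly_Mapping.single m a) * Poly_Mapping.single n b
      = Poly_Mapping.single m 1 * Poly_Mapping.single n 1 * (a *\<^sub>R D b + b *\<^sub>R D a)"
      unfolding lift_single unfolding 1[of m a] 1[of n b]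
      by (simp only: mpoly_scaleR_left mpoly_scaleR_right distrib_left mult_ac)
    ultimately show ?case by simp
  qed (simp_all add: lift_add algebra_simps)
qed (simp_all add: lift_add algebra_simps)

text \<open>A derivation kills the rationals, so the factorial denominators of the exponential pass
  through it.\<close>

lemma lift_scaleR_rat: "lift (inverse (real n) *\<^sub>R p) = inverse (real n) *\<^sub>R lift p"
proof -
  have "D (real k) = 0" for k by (induction k) (simp_all add: D_0 D_1 D_add add.commute)
  then have "D (inverse (real n)) = 0"
    using D_mult[of "inverse (real n)" "real n"] by (cases "n = 0") (simp_all add: D_0 D_1)
  then have "lift (Const (inverse (real n))) = 0"
    by (simp add: Const_def lift_single)
  then show ?thesis by (simp add: lift_mult flip: Const_mult)
qed

text \<open>\<open>taylor p\<close> is \<open>exp (\<tau> D) p\<close> as a formal power series in \<open>\<tau>\<close>.\<close>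

definition taylor :: "'v mpoly \<Rightarrow> 'v mpoly fps" where
  "taylor p = Abs_fps (\<lambda>k. inverse (fact k) *\<^sub>R (lift ^^ k) p)"

lemma lift_taylor_nth: "lift (taylor p $ k) = of_nat (Suc k) * taylor p $ Suc k"
proof -
  have "lift (taylor p $ k) = inverse (fact k) *\<^sub>R (lift ^^ Suc k) p"
    using lift_scaleR_rat[of "fact k" "(lift ^^ k) p"] by (simp add: taylor_def)
  also have "\<dots> = real (Suc k) *\<^sub>R taylor p $ Suc k"
    by (simp add: taylor_def field_simps del: funpow.simps of_nat_Suc)
  finally show ?thesis by (simp only: mpoly_of_nat_times)
qed

lemma taylor_add: "taylor (p + q) = taylor p + taylor q"
proof -
  have "(lift ^^ k) (p + q) = (lift ^^ k) p + (lift ^^ k) q" for k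
    by (induction k) (simp_all add: lift_add)
  then show ?thesis by (intro fps_ext) (simp add: taylor_def scaleR_add_right)
qed

text \<open>Both sides solve the same differential equation in \<open>\<tau>\<close>.\<close>

lemma taylor_mult: "taylor (p * q) = taylor p * taylor q"
proof (rule fps_ext)
  fix n
  let ?h = "taylor p * taylor q"
  \<comment> \<open>The differential equation read coefficientwise: each coefficient determines the
    next, so a solution is fixed by its constant term.\<close>
  have step: "lift (?h $ k) = of_nat (Suc k) * ?h $ Suc k" for k
  proof -
    have "lift (?h $ k) = (\<Sum>i=0..k. taylor p $ i * lift (taylor q $ (k - i)))
        + (\<Sum>i=0..k. lift (taylor p $ i) * taylor q $ (k - i))"
      by (simp add: fps_mult_nth lift_sum lift_mult sum.distrib)
    also have "\<dots> = (taylor p * fps_deriv (taylor q) + fps_deriv (taylor p) * taylor q) $ k"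
      by (simp add: fps_mult_nth lift_taylor_nth)
    also have "\<dots> = fps_deriv ?h $ k" by (simp only: fps_deriv_mult)
    also have "\<dots> = of_nat (Suc k) * ?h $ Suc k" by (simp only: fps_deriv_nth Suc_eq_plus1)
    finally show ?thesis .
  qed
  show "taylor (p * q) $ n = ?h $ n"
  proof (induction n)
    case 0
    show ?case by (simp add: taylor_def)
  next
    case (Suc n)
    have "real (Suc n) *\<^sub>R taylor (p * q) $ Suc n = real (Suc n) *\<^sub>R ?h $ Suc n"
      using lift_taylor_nth[of "p * q" n] step[of n] Suc by (simp only: mpoly_of_nat_times)
    then show ?case by simp
  qed
qed

lemma taylor_const:
  assumes "lift p = 0"
  shows "taylor p = fps_const p"
proof (rule fps_ext)
  fix n
  have "(lift ^^ Suc k) p = 0" for k by (induction k) (simp_all add: assms)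
  then show "taylor p $ n = fps_const p $ n" by (cases n) (simp_all add: taylor_def)
qed

lemma taylor_linear:
  assumes "lift (lift p) = 0"
  shows "taylor p = fps_const p + fps_X * fps_const (lift p)"
proof (rule fps_ext)
  fix n
  have z: "(lift ^^ Suc (Suc k)) p = 0" for k by (induction k) (simp_all add: assms)
  show "taylor p $ n = (fps_const p + fps_X * fps_const (lift p)) $ n"
  proof (cases n)
    case (Suc m)
    then show ?thesis using z by (cases m) (simp_all add: taylor_def)
  qed (simp add: taylor_def)
qed

end

text \<open>\<open>\<phi>\<close> is the exponential series restricted to constants. It fixes
  \<open>C\<close> because \<open>D\<close> vanishes there, and it stops after the linear term at
  \<open>y i\<close> because \<open>D (y i)\<close> is a variable, which \<open>lift\<close>
  kills.\<close>

lemma generic_taylor_homomorphism: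
  assumes "finite C"
  shows "\<exists>(\<phi> :: real \<Rightarrow> 'n::finite mpoly fps) y. \<phi> 0 = 0 \<and> \<phi> 1 = 1 \<and> (\<forall>a b. \<phi> (a + b) = \<phi> a + \<phi> b) \<and>
    (\<forall>a b. \<phi> (a * b) = \<phi> a * \<phi> b) \<and> (\<forall>c\<in>C. \<phi> c = fps_const (Const c)) \<and>
    (\<forall>i. \<phi> (y i) = fps_const (Const (y i)) + fps_X * fps_const (Var i))"
proof -
  obtain D :: "real \<Rightarrow> 'n mpoly" and y where D: "\<And>a b. D (a - b) = D a - D b"
    "\<And>a b. D (a * b) = a *\<^sub>R D b + b *\<^sub>R D a" "\<And>c. c \<in> C \<Longrightarrow> D c = 0" "\<And>i. D (y i) = Var i"
    using generic_derivation_exists[OF assms, of Var] by metis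
  interpret mpoly_valued_derivation D by unfold_locales (rule D)+
  have lC: "lift (Const a) = D a" for a by (simp add: Const_def lift_single)
  have lV: "lift (Var i) = 0" for i by (simp add: Var_def lift_single D_1)
  define \<phi> where "\<phi> = (\<lambda>a. taylor (Const a))"
  have const: "\<phi> c = fps_const (Const c)" if "D c = 0" for c
    unfolding \<phi>_def by (rule taylor_const) (simp add: lC that)
  have "\<phi> 0 = 0" "\<phi> 1 = 1" using const[of 0] const[of 1] D_0 D_1 by simp_all
  moreover have "\<phi> (y i) = fps_const (Const (y i)) + fps_X * fps_const (Var i)" for i
    unfolding \<phi>_def by (subst taylor_linear) (simp_all add: lC D(4) lV)
  ultimately show ?thesis
    using const D(3) by (intro exI[of _ \<phi>] exI[of _ y])
      (simp add: \<phi>_def Const_add Const_times taylor_add taylor_mult)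
qed

unbundle no fps_syntax
unbundle vec_syntax

section \<open>Evaluation homomorphisms\<close>

definition unital_hom :: "('a::comm_ring_1 \<Rightarrow> 'b::comm_ring_1) \<Rightarrow> bool" where
  "unital_hom h \<longleftrightarrow> h 0 = 0 \<and> h 1 = 1 \<and> (\<forall>a b. h (a + b) = h a + h b) \<and> (\<forall>a b. h (a * b) = h a * h b)"

lemma unital_homI:
  "h 0 = 0 \<Longrightarrow> h 1 = 1 \<Longrightarrow> (\<And>a b. h (a + b) = h a + h b) \<Longrightarrow> (\<And>a b. h (a * b) = h a * h b) \<Longrightarrow>
   unital_hom h"
  by (simp add: unital_hom_def)

lemma unital_homD:
  assumes "unital_hom h"
  shows "h 0 = 0" "h 1 = 1" "h (a + b) = h a + h b" "h (a * b) = h a * h b"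
  using assms by (simp_all add: unital_hom_def)

lemma unital_hom_diff:
  assumes "unital_hom h"
  shows "h (a - b) = h a - h b"
  using unital_homD(3)[OF assms, of "a - b" b] by (simp add: algebra_simps)

lemma unital_hom_sum: "unital_hom h \<Longrightarrow> h (\<Sum>i\<in>A. f i) = (\<Sum>i\<in>A. h (f i))"
  by (induction A rule: infinite_finite_induct) (simp_all add: unital_homD)

lemma unital_hom_power: "unital_hom h \<Longrightarrow> h (a ^ n) = h a ^ n"
  by (induction n) (simp_all add: unital_homD)

lemma unital_hom_prod: "unital_hom h \<Longrightarrow> h (\<Prod>i\<in>A. f i) = (\<Prod>i\<in>A. h (f i))"
  by (induction A rule: infinite_finite_induct) (simp_all add: unital_homD)

lemma unital_hom_Const: "unital_hom Const"
  by (rule unital_homI) (simp_all add: Const_add Const_times)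

lemma unital_hom_id: "unital_hom (\<lambda>a. a)"
  by (rule unital_homI) simp_all

definition eval_monom :: "('v \<Rightarrow> 'b::comm_ring_1) \<Rightarrow> ('v \<Rightarrow>\<^sub>0 nat) \<Rightarrow> 'b" where
  "eval_monom v m = (\<Prod>i\<in>Poly_Mapping.keys m. v i ^ Poly_Mapping.lookup m i)"

lemma eval_mpoly_alt:
  "eval_mpoly c v p = (\<Sum>m\<in>Poly_Mapping.keys p. c (Poly_Mapping.lookup p m) * eval_monom v m)"
  by (simp add: eval_mpoly_def eval_monom_def)

lemma eval_monom_superset:
  assumes "finite A" "Poly_Mapping.keys m \<subseteq> A"
  shows "eval_monom v m = (\<Prod>i\<in>A. v i ^ Poly_Mapping.lookup m i)"
  unfolding eval_monom_def using assms
  by (intro prod.mono_neutral_left) (auto simp: in_keys_iff)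

lemma eval_monom_0 [simp]: "eval_monom v 0 = 1"
  by (simp add: eval_monom_def)

lemma eval_monom_add: "eval_monom v (m + n) = eval_monom v m * eval_monom v n"
proof -
  let ?A = "Poly_Mapping.keys m \<union> Poly_Mapping.keys n"
  have "eval_monom v (m + n) = (\<Prod>i\<in>?A. v i ^ Poly_Mapping.lookup (m + n) i)"
    by (intro eval_monom_superset) (auto simp: in_keys_iff lookup_add)
  also have "\<dots> = eval_monom v m * eval_monom v n"
    by (simp add: eval_monom_superset[of ?A m] eval_monom_superset[of ?A n] lookup_add power_add
        prod.distrib)
  finally show ?thesis .
qed

lemma eval_monom_scale: "eval_monom (\<lambda>i. t * v i) m = t ^ monom_degree m * eval_monom v m"
  by (simp add: eval_monom_def monom_degree_def power_mult_distrib prod.distrib power_sum)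

lemma eval_mpoly_superset:
  assumes "c 0 = 0" "finite A" "Poly_Mapping.keys p \<subseteq> A"
  shows "eval_mpoly c v p = (\<Sum>m\<in>A. c (Poly_Mapping.lookup p m) * eval_monom v m)"
  unfolding eval_mpoly_alt using assms
  by (intro sum.mono_neutral_left) (auto simp: in_keys_iff)

lemma eval_mpoly_single:
  assumes "c 0 = 0"
  shows "eval_mpoly c v (Poly_Mapping.single m a) = c a * eval_monom v m"
  by (subst eval_mpoly_superset[of c "{m}"]) (auto simp: assms lookup_single)

lemma eval_mpoly_add:
  assumes "unital_hom c"
  shows "eval_mpoly c v (p + q) = eval_mpoly c v p + eval_mpoly c v q"
proof -
  let ?A = "Poly_Mapping.keys p \<union> Poly_Mapping.keys q"
  note c = unital_homD[OF assms]
  have "eval_mpoly c v (p + q) = (\<Sum>m\<in>?A. c (Poly_Mapping.lookup (p + q) m) * eval_monom v m)"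
    by (intro eval_mpoly_superset) (auto simp: c in_keys_iff lookup_add)
  also have "\<dots> = eval_mpoly c v p + eval_mpoly c v q"
    by (simp add: eval_mpoly_superset[of c ?A p] eval_mpoly_superset[of c ?A q] lookup_add c
        distrib_right sum.distrib)
  finally show ?thesis .
qed

lemma eval_mpoly_mult:
  assumes "unital_hom c"
  shows "eval_mpoly c v (p * q) = eval_mpoly c v p * eval_mpoly c v q"
proof -
  note c = unital_homD[OF assms]
  have 0: "eval_mpoly c v 0 = 0" by (simp add: eval_mpoly_alt)
  show ?thesis
  proof (induction p rule: poly_mapping_single_induct)
    case (single m a)
    show ?case
    proof (induction q rule: poly_mapping_single_induct)
      case (single n b)
      then show ?case
        by (simp add: mult_single eval_mpoly_single c eval_monom_add mult_ac)
    qed (simp_all add: 0 eval_mpoly_add[OF assms] distrib_left)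
  qed (simp_all add: 0 eval_mpoly_add[OF assms] distrib_right)
qed

lemma unital_hom_eval_mpoly:
  assumes "unital_hom c"
  shows "unital_hom (eval_mpoly c v)"
proof (rule unital_homI)
  show "eval_mpoly c v 1 = 1"
    using eval_mpoly_single[of c v 0 1] unital_homD[OF assms] by simp
qed (simp_all add: eval_mpoly_alt[of c v 0] eval_mpoly_add[OF assms] eval_mpoly_mult[OF assms])

lemma eval_mpoly_Const: "unital_hom c \<Longrightarrow> eval_mpoly c v (Const a) = c a"
  by (simp add: Const_def eval_mpoly_single unital_homD)

lemma eval_mpoly_Var: "unital_hom c \<Longrightarrow> eval_mpoly c v (Var i) = v i"
  by (simp add: Var_def eval_mpoly_single unital_homD eval_monom_def)

lemma eval_mpoly_scaleR: "unital_hom c \<Longrightarrow> eval_mpoly c v (a *\<^sub>R p) = c a * eval_mpoly c v p"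
  by (simp add: eval_mpoly_mult eval_mpoly_Const flip: Const_mult)

lemma unital_hom_eval_commute:
  assumes "unital_hom h"
  shows "h (eval_mpoly c v p) = eval_mpoly (\<lambda>a. h (c a)) (\<lambda>i. h (v i)) p"
  by (simp add: eval_mpoly_def unital_hom_sum[OF assms] unital_homD[OF assms]
      unital_hom_prod[OF assms] unital_hom_power[OF assms])

lemma eval_mpoly_coeff_cong:
  "(\<And>m. m \<in> Poly_Mapping.keys p \<Longrightarrow> c (Poly_Mapping.lookup p m) = c' (Poly_Mapping.lookup p m)) \<Longrightarrow>
   eval_mpoly c v p = eval_mpoly c' v p"
  by (simp add: eval_mpoly_def)

lemma eval_mpoly_homogeneous:
  assumes "\<And>m. m \<in> Poly_Mapping.keys h \<Longrightarrow> monom_degree m = e"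
  shows "eval_mpoly c (\<lambda>i. t * v i) h = t ^ e * eval_mpoly c v h"
  by (simp add: eval_mpoly_alt eval_monom_scale assms sum_distrib_left mult.left_commute)

lemma unital_hom_value_at: "unital_hom (\<lambda>p. value_at p x)"
  unfolding value_at_def by (rule unital_hom_eval_mpoly[OF unital_hom_id])

lemma value_at_scaleR: "value_at (a *\<^sub>R p) x = a * value_at p x"
  by (simp add: value_at_def eval_mpoly_scaleR unital_hom_id)

section \<open>Sums of squares\<close>

lemma lookup_mult_superset:
  fixes p q :: "'a::comm_monoid_add \<Rightarrow>\<^sub>0 'b::comm_ring_1"
  assumes "finite A" "Poly_Mapping.keys p \<subseteq> A" "finite B" "Poly_Mapping.keys q \<subseteq> B"
  shows "Poly_Mapping.lookup (p * q) k =
    (\<Sum>a\<in>A. \<Sum>b\<in>B. if a + b = k then Poly_Mapping.lookup p a * Poly_Mapping.lookup q b else 0)"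
proof -
  have "p * q = (\<Sum>a\<in>A. \<Sum>b\<in>B.
      Poly_Mapping.single (a + b) (Poly_Mapping.lookup p a * Poly_Mapping.lookup q b))"
    by (subst poly_mapping_sum_single[OF assms(1,2)], subst poly_mapping_sum_single[OF assms(3,4)])
      (simp add: sum_product mult_single)
  then show ?thesis by (simp add: lookup_sum lookup_single when_def)
qed

text \<open>Among all exponents occurring, one of maximal Euclidean norm is a midpoint of two others only
  trivially, by strict convexity; so its double occurs in the sum of squares with coefficient a sum
  of real squares.\<close>

lemma sum_squares_eq_0:
  fixes q :: "'j \<Rightarrow> 'n::finite mpoly"
  assumes J: "finite J" and zero: "(\<Sum>j\<in>J. (q j)\<^sup>2) = 0"
  shows "\<forall>j\<in>J. q j = 0"
proof (rule ccontr)
  assume neg: "\<not> ?thesis"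
  define X where "X = (\<Union>j\<in>J. Poly_Mapping.keys (q j))"
  have X: "finite X" "X \<noteq> {}" using J neg by (auto simp: X_def)
  define nrm where "nrm = (\<lambda>m :: 'n \<Rightarrow>\<^sub>0 nat. \<Sum>i\<in>UNIV. (real (Poly_Mapping.lookup m i))\<^sup>2)"
  obtain M where M: "M \<in> X" "\<And>m. m \<in> X \<Longrightarrow> nrm m \<le> nrm M"
  proof -
    have "Max (nrm ` X) \<in> nrm ` X" using X by (intro Max_in) auto
    then obtain M where "M \<in> X" "nrm M = Max (nrm ` X)" by (metis imageE)
    then show ?thesis using that X by simp
  qed
  have mid: "a = M \<and> b = M" if ab: "a \<in> X" "b \<in> X" "a + b = M + M" for a b
  proof -
    have l: "real (Poly_Mapping.lookup a i) + real (Poly_Mapping.lookup b i) = 2 * real (Poly_Mapping.lookup M i)" for i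
      using arg_cong[OF ab(3), of "\<lambda>m. real (Poly_Mapping.lookup m i)"] by (simp add: lookup_add)
    \<comment> \<open>The parallelogram law for \<open>a + b = M + M\<close>.\<close>
    have "(real (Poly_Mapping.lookup a i) - real (Poly_Mapping.lookup b i))\<^sup>2
      = 2 * (real (Poly_Mapping.lookup a i))\<^sup>2 + 2 * (real (Poly_Mapping.lookup b i))\<^sup>2
        - 4 * (real (Poly_Mapping.lookup M i))\<^sup>2" for i
    proof -
      have "4 * (real (Poly_Mapping.lookup M i))\<^sup>2 = (real (Poly_Mapping.lookup a i) + real (Poly_Mapping.lookup b i))\<^sup>2"
        by (simp add: l power2_eq_square)
      then show ?thesis by (simp add: power2_eq_square algebra_simps)
    qed
    then have "(\<Sum>i\<in>UNIV. (real (Poly_Mapping.lookup a i) - real (Poly_Mapping.lookup b i))\<^sup>2)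
      = 2 * nrm a + 2 * nrm b - 4 * nrm M"
      by (simp add: nrm_def sum.distrib sum_subtractf sum_distrib_left)
    also have "\<dots> \<le> 0" using M(2)[OF ab(1)] M(2)[OF ab(2)] by linarith
    finally have "(\<Sum>i\<in>UNIV. (real (Poly_Mapping.lookup a i) - real (Poly_Mapping.lookup b i))\<^sup>2) = 0"
      by (intro antisym sum_nonneg) auto
    then have "Poly_Mapping.lookup a i = Poly_Mapping.lookup b i" for i
      by (simp add: sum_nonneg_eq_0_iff)
    then have "Poly_Mapping.lookup a i = Poly_Mapping.lookup M i \<and> Poly_Mapping.lookup b i = Poly_Mapping.lookup M i" for i
      using l[of i] by simp
    then show ?thesis by (auto intro!: poly_mapping_eqI)
  qed
  have "Poly_Mapping.lookup ((q j)\<^sup>2) (M + M) = (Poly_Mapping.lookup (q j) M)\<^sup>2" if "j \<in> J" for j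
  proof -
    have sub: "Poly_Mapping.keys (q j) \<subseteq> X" using that by (auto simp: X_def)
    have "Poly_Mapping.lookup ((q j)\<^sup>2) (M + M) =
      (\<Sum>a\<in>X. \<Sum>b\<in>X. if a + b = M + M then Poly_Mapping.lookup (q j) a * Poly_Mapping.lookup (q j) b else 0)"
      unfolding power2_eq_square by (rule lookup_mult_superset[OF X(1) sub X(1) sub])
    also have "\<dots> = (\<Sum>a\<in>X. if a = M then (\<Sum>b\<in>X. if b = M then Poly_Mapping.lookup (q j) a * Poly_Mapping.lookup (q j) b else 0) else 0)"
    proof (intro sum.cong refl)
      fix a assume a: "a \<in> X"
      show "(\<Sum>b\<in>X. if a + b = M + M then Poly_Mapping.lookup (q j) a * Poly_Mapping.lookup (q j) b else 0)
        = (if a = M then (\<Sum>b\<in>X. if b = M then Poly_Mapping.lookup (q j) a * Poly_Mapping.lookup (q j) b else 0) else 0)"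
      proof (cases "a = M")
        case False
        then have "a + b \<noteq> M + M" if "b \<in> X" for b using mid[OF a that] by blast
        then show ?thesis using False by simp
      qed simp
    qed
    also have "\<dots> = (Poly_Mapping.lookup (q j) M)\<^sup>2"
      using X(1) M(1) by (simp add: power2_eq_square)
    finally show ?thesis .
  qed
  then have "(\<Sum>j\<in>J. (Poly_Mapping.lookup (q j) M)\<^sup>2) = Poly_Mapping.lookup (\<Sum>j\<in>J. (q j)\<^sup>2) (M + M)"
    by (simp add: lookup_sum)
  then have "\<forall>j\<in>J. Poly_Mapping.lookup (q j) M = 0"
    using J zero by (simp add: sum_nonneg_eq_0_iff)
  then show False using M(1) by (auto simp: X_def in_keys_iff)
qed

lemma sum_of_squares_finite:
  assumes "finite J"
  shows "sum_of_squares (\<Sum>j\<in>J. (q j)\<^sup>2)"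
proof -
  obtain b where "bij_betw b {0..<card J} J" using ex_bij_betw_nat_finite[OF assms] by blast
  then have "bij_betw b {..<card J} J" by (simp add: atLeast0LessThan)
  from sum.reindex_bij_betw[OF this, of "\<lambda>j. (q j)\<^sup>2"]
  have "(\<Sum>j\<in>J. (q j)\<^sup>2) = (\<Sum>i<card J. (q (b i))\<^sup>2)" ..
  then show ?thesis unfolding sum_of_squares_def by (rule exI[of _ "card J", OF exI[of _ "\<lambda>i. q (b i)"]])
qed

text \<open>The coefficients of the sum are quadratic forms in the coefficients of the
  \<open>Q k j\<close>, with no common zero but the trivial one by \<open>sum_squares_eq_0\<close>.
  Convergence of the sums therefore bounds the summands, and a subsequence converges to a
  representation of \<open>f\<close>.\<close>

lemma sum_of_squares_closed:
  fixes Q :: "nat \<Rightarrow> 'j \<Rightarrow> 'n::finite mpoly"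
  assumes J: "finite J" and X: "finite X" "\<And>k j. j \<in> J \<Longrightarrow> Poly_Mapping.keys (Q k j) \<subseteq> X"
    and lim: "\<And>m. (\<lambda>k. Poly_Mapping.lookup (\<Sum>j\<in>J. (Q k j)\<^sup>2) m) \<longlonglongrightarrow> Poly_Mapping.lookup f m"
  shows "sum_of_squares f"
proof -
  define h where "h = (\<lambda>m (x :: 'j \<times> ('n \<Rightarrow>\<^sub>0 nat) \<Rightarrow> real).
    \<Sum>j\<in>J. \<Sum>a\<in>X. \<Sum>b\<in>X. if a + b = m then x (j, a) * x (j, b) else 0)"
  define P where "P = (\<lambda>(x :: 'j \<times> ('n \<Rightarrow>\<^sub>0 nat) \<Rightarrow> real) j. \<Sum>m\<in>X. Poly_Mapping.single m (x (j, m)))"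
  define x where "x = (\<lambda>k (j, m). Poly_Mapping.lookup (Q k j) m)"
  have lookP: "Poly_Mapping.lookup (P w j) m = (if m \<in> X then w (j, m) else 0)" for w j m
    using X(1) by (simp add: P_def lookup_sum lookup_single when_def)
  have hP: "Poly_Mapping.lookup (\<Sum>j\<in>J. (P w j)\<^sup>2) m = h m w" for w m
  proof -
    have "Poly_Mapping.keys (P w j) \<subseteq> X" for j
      by (auto simp: in_keys_iff lookP split: if_splits)
    then have "Poly_Mapping.lookup ((P w j)\<^sup>2) m =
      (\<Sum>a\<in>X. \<Sum>b\<in>X. if a + b = m then Poly_Mapping.lookup (P w j) a * Poly_Mapping.lookup (P w j) b else 0)" for j
      unfolding power2_eq_square by (intro lookup_mult_superset X(1))
    then show ?thesis
      unfolding h_def lookup_sum by (simp add: lookP cong: sum.cong if_cong)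
  qed
  have Px: "P (x k) j = Q k j" if "j \<in> J" for k j
    using X(2)[OF that, of k] by (intro poly_mapping_eqI) (auto simp: lookP x_def in_keys_iff)
  have hx: "h m (x k) = Poly_Mapping.lookup (\<Sum>j\<in>J. (Q k j)\<^sup>2) m" for m k
    by (simp add: Px flip: hP)
  have cont: "(\<lambda>k. h m (y k)) \<longlonglongrightarrow> h m z"
    if "\<And>i. i \<in> J \<times> X \<Longrightarrow> (\<lambda>k. y k i) \<longlonglongrightarrow> z i" for m z and y :: "nat \<Rightarrow> _"
    unfolding h_def
  proof (intro tendsto_sum)
    fix j a b assume "j \<in> J" "a \<in> X" "b \<in> X"
    then have "(\<lambda>k. y k (j, a) * y k (j, b)) \<longlonglongrightarrow> z (j, a) * z (j, b)"
      by (intro tendsto_mult that) auto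
    then show "(\<lambda>k. if a + b = m then y k (j, a) * y k (j, b) else 0)
      \<longlonglongrightarrow> (if a + b = m then z (j, a) * z (j, b) else 0)" by simp
  qed
  have "\<exists>B. \<forall>k. \<forall>i\<in>J \<times> X. \<bar>x k i\<bar> \<le> B"
  proof (rule homogeneous_bounded[where h = h and e = 2])
    show "finite (J \<times> X)" using J X by simp
    show "h m (\<lambda>i. c * w i) = c\<^sup>2 * h m w" for m w c
      unfolding h_def sum_distrib_left
      by (intro sum.cong refl) (simp add: power2_eq_square algebra_simps)
    show "\<exists>C. \<forall>k. \<bar>h m (x k)\<bar> \<le> C" for m
      using convergent_imp_Bseq[OF convergentI[OF lim[of m]]]
      unfolding Bseq_def hx real_norm_def by blast
    show "\<forall>i\<in>J \<times> X. w i = 0" if "\<And>m. h m w = 0" for w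
    proof -
      have "(\<Sum>j\<in>J. (P w j)\<^sup>2) = 0" by (intro poly_mapping_eqI) (simp add: hP that)
      from sum_squares_eq_0[OF J this] have "w (j, m) = 0" if "j \<in> J" "m \<in> X" for j m
        using lookP[of w j m] that by simp
      then show ?thesis by auto
    qed
  qed (auto intro: cont)
  then obtain B where "\<And>k i. i \<in> J \<times> X \<Longrightarrow> \<bar>x k i\<bar> \<le> B" by blast
  then have "\<exists>l \<sigma>. strict_mono (\<sigma> :: nat \<Rightarrow> nat) \<and> (\<forall>i\<in>J \<times> X. (\<lambda>k. x (\<sigma> k) i) \<longlonglongrightarrow> l i)"
    using J X(1) by (intro common_convergent_subsequence) auto
  then obtain l \<sigma> where s: "strict_mono (\<sigma> :: nat \<Rightarrow> nat)"
    "\<And>i. i \<in> J \<times> X \<Longrightarrow> (\<lambda>k. x (\<sigma> k) i) \<longlonglongrightarrow> l i" by blast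
  have "f = (\<Sum>j\<in>J. (P l j)\<^sup>2)"
  proof (rule poly_mapping_eqI)
    fix m
    have "(\<lambda>k. h m (x (\<sigma> k))) \<longlonglongrightarrow> h m l" by (rule cont) (rule s(2))
    moreover have "(\<lambda>k. h m (x (\<sigma> k))) \<longlonglongrightarrow> Poly_Mapping.lookup f m"
      using LIMSEQ_subseq_LIMSEQ[OF lim[of m] s(1)] by (simp add: hx o_def)
    ultimately show "Poly_Mapping.lookup f m = Poly_Mapping.lookup (\<Sum>j\<in>J. (P l j)\<^sup>2) m"
      unfolding hP by (rule LIMSEQ_unique[symmetric])
  qed
  then show ?thesis using sum_of_squares_finite[OF J] by simp
qed

section \<open>Spectrahedral shadows as linear representations\<close>

lemma linear_isomorphism_expand:
  assumes "linear_isomorphism N V \<phi>" and x: "x \<in> topspace (Euclidean_space N)"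
  shows "\<phi> x = (\<Sum>i<N. x i *\<^sub>R \<phi> (unit_vec i))"
proof -
  have top: "y \<in> topspace (Euclidean_space N) \<longleftrightarrow> (\<forall>i\<ge>N. y i = 0)" for y
    by (simp add: topspace_Euclidean_space)
  have add: "\<phi> (\<lambda>i. x i + y i) = \<phi> x + \<phi> y"
    if "x \<in> topspace (Euclidean_space N)" "y \<in> topspace (Euclidean_space N)" for x y
    using assms(1) that by (simp add: linear_isomorphism_def)
  have scale: "\<phi> (\<lambda>i. c * x i) = c *\<^sub>R \<phi> x" if "x \<in> topspace (Euclidean_space N)" for c x
    using assms(1) that by (simp add: linear_isomorphism_def)
  have u: "unit_vec n \<in> topspace (Euclidean_space N)" if "n < N" for n
    using that by (auto simp: top unit_vec_def)
  have "\<phi> (\<lambda>i. if i < n then x i else 0) = (\<Sum>i<n. x i *\<^sub>R \<phi> (unit_vec i))" if "n \<le> N" for n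
    using that
  proof (induction n)
    case 0
    show ?case using scale[OF x, of 0] by simp
  next
    case (Suc n)
    have eq: "(\<lambda>i. if i < Suc n then x i else 0) = (\<lambda>i. (if i < n then x i else 0) + x n * unit_vec n i)"
      by (auto simp: unit_vec_def less_Suc_eq)
    have "\<phi> (\<lambda>i. if i < Suc n then x i else 0)
      = \<phi> (\<lambda>i. if i < n then x i else 0) + \<phi> (\<lambda>i. x n * unit_vec n i)"
      unfolding eq by (rule add) (use Suc.prems in \<open>auto simp: top unit_vec_def\<close>)
    then show ?case using Suc scale[OF u] by simp
  qed
  from this[of N] have "\<phi> (\<lambda>i. if i < N then x i else 0) = (\<Sum>i<N. x i *\<^sub>R \<phi> (unit_vec i))" by simp
  moreover have "(\<lambda>i. if i < N then x i else 0) = x" using x by (auto simp: top)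
  ultimately show ?thesis by simp
qed

text \<open>Homogenize: the constant matrix gets a coefficient \<open>s\<close>, forced to be nonnegative by an extra
  diagonal entry at index \<open>None\<close>.\<close>

lemma spectrahedral_shadow_lin_rep:
  fixes K V :: "'a::real_vector set"
  assumes shadow: "spectrahedral_shadow_in V K"
    and K0: "0 \<in> K" and cone: "\<And>g c. g \<in> K \<Longrightarrow> c > 0 \<Longrightarrow> c *\<^sub>R g \<in> K"
  shows "\<exists>(M :: (nat + nat option) set) (I :: nat option set) S G. lin_rep K M I S G"
proof -
  obtain N \<phi> T where iso: "linear_isomorphism N V \<phi>" and sh: "spectrahedral_shadow N T"
    and K: "K = \<phi> ` T"
    using shadow unfolding spectrahedral_shadow_in_def by blast
  obtain d m A B C where A: "symmetric_matrix d A" and B: "\<And>i. i < N \<Longrightarrow> symmetric_matrix d (B i)"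
    and C: "\<And>j. j < m \<Longrightarrow> symmetric_matrix d (C j)"
    and T: "T = {x \<in> topspace (Euclidean_space N). \<exists>y \<in> topspace (Euclidean_space m).
       psd_matrix d (\<lambda>r s. A r s + (\<Sum>i<N. x i * B i r s) + (\<Sum>j<m. y j * C j r s))}"
    using sh unfolding spectrahedral_shadow_def by blast
  have top: "y \<in> topspace (Euclidean_space n) \<longleftrightarrow> (\<forall>i\<ge>n. y i = 0)" for y n
    by (simp add: topspace_Euclidean_space)
  note expand = linear_isomorphism_expand[OF iso]
  define pencil where "pencil = (\<lambda>s x y r t. s * A r t + (\<Sum>i<N. x i * B i r t) + (\<Sum>j<m. y j * C j r t))"
  have sym: "symmetric_matrix d (pencil s x y)" for s x y
    using A B C by (auto simp: symmetric_matrix_def pencil_def)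
  have psd: "psd_matrix d (pencil s x y) \<longleftrightarrow> nonneg_form {..<d} (pencil s x y)" for s x y
    using sym by (simp add: psd_matrix_def nonneg_form_def qf_def)
  have psd1: "psd_matrix d (\<lambda>r s. A r s + (\<Sum>i<N. x i * B i r s) + (\<Sum>j<m. y j * C j r s)) \<longleftrightarrow>
      nonneg_form {..<d} (pencil 1 x y)" for x y
    using psd[of 1 x y] by (simp add: pencil_def)
  have TI: "x \<in> T" if "x \<in> topspace (Euclidean_space N)" "y \<in> topspace (Euclidean_space m)"
    "nonneg_form {..<d} (pencil 1 x y)" for x y
    using that unfolding T psd1 by blast
  have TE: "x \<in> topspace (Euclidean_space N) \<and>
      (\<exists>y\<in>topspace (Euclidean_space m). nonneg_form {..<d} (pencil 1 x y))" if "x \<in> T" for x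
    using that unfolding T psd1 by blast
  \<comment> \<open>Parameter \<open>Inl i\<close> is the coordinate \<open>x i\<close>,
    \<open>Inr (Some j)\<close> is the auxiliary \<open>y j\<close>, and \<open>Inr None\<close> is
    the homogenizing coefficient.\<close>
  define S :: "nat + nat option \<Rightarrow> nat option \<Rightarrow> nat option \<Rightarrow> real" where
    "S = (\<lambda>k a b. case (a, b) of
       (Some r, Some t) \<Rightarrow> (case k of Inl i \<Rightarrow> B i r t | Inr None \<Rightarrow> A r t | Inr (Some j) \<Rightarrow> C j r t)
     | (None, None) \<Rightarrow> (if k = Inr None then 1 else 0) | _ \<Rightarrow> 0)"
  define G :: "nat + nat option \<Rightarrow> 'a" where
    "G = (\<lambda>k. case k of Inl i \<Rightarrow> \<phi> (unit_vec i) | Inr _ \<Rightarrow> 0)"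
  define I where "I = insert None (Some ` {..<d})"
  define M :: "(nat + nat option) set" where "M = Inr ` (insert None (Some ` {..<m})) \<union> Inl ` {..<N}"
  have sumM: "(\<Sum>k\<in>M. f k) = (\<Sum>i<N. f (Inl i)) + (f (Inr None) + (\<Sum>j<m. f (Inr (Some j))))"
    for f :: "nat + nat option \<Rightarrow> 'z::comm_monoid_add"
    unfolding M_def by (subst sum_Inl_Inr) (auto simp: sum.reindex)
  have comb: "comb M S p None None = p (Inr None)" "comb M S p None (Some t) = 0"
    "comb M S p (Some r) None = 0"
    "comb M S p (Some r) (Some t)
      = pencil (p (Inr None)) (\<lambda>i. p (Inl i)) (\<lambda>j. p (Inr (Some j))) r t" for p r t
    by (simp_all add: comb_def sumM S_def pencil_def)
  have qfI: "qf I (comb M S p) v v = p (Inr None) * (v None)\<^sup>2 +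
      qf {..<d} (pencil (p (Inr None)) (\<lambda>i. p (Inl i)) (\<lambda>j. p (Inr (Some j)))) (\<lambda>r. v (Some r)) (\<lambda>r. v (Some r))"
    for p v
    unfolding qf_def I_def by (simp add: sum.reindex comb power2_eq_square)
  have nonneg: "nonneg_form I (comb M S p) \<longleftrightarrow> 0 \<le> p (Inr None) \<and>
      nonneg_form {..<d} (pencil (p (Inr None)) (\<lambda>i. p (Inl i)) (\<lambda>j. p (Inr (Some j))))" for p
  proof
    assume n: "nonneg_form I (comb M S p)"
    have "0 \<le> p (Inr None)"
      using nonneg_formD[OF n, of "unit_vec None"] unfolding qfI by (simp add: unit_vec_def qf_def)
    moreover have "0 \<le> qf {..<d} (pencil (p (Inr None)) (\<lambda>i. p (Inl i)) (\<lambda>j. p (Inr (Some j)))) v v" for v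
      using nonneg_formD[OF n, of "\<lambda>a. case a of None \<Rightarrow> 0 | Some r \<Rightarrow> v r"] unfolding qfI by simp
    ultimately show "0 \<le> p (Inr None) \<and>
      nonneg_form {..<d} (pencil (p (Inr None)) (\<lambda>i. p (Inl i)) (\<lambda>j. p (Inr (Some j))))"
      by (simp add: nonneg_form_def)
  next
    assume "0 \<le> p (Inr None) \<and>
      nonneg_form {..<d} (pencil (p (Inr None)) (\<lambda>i. p (Inl i)) (\<lambda>j. p (Inr (Some j))))"
    then show "nonneg_form I (comb M S p)"
      unfolding nonneg_form_def qfI by (simp add: nonneg_form_def)
  qed
  have sumG: "(\<Sum>k\<in>M. p k *\<^sub>R G k) = (\<Sum>i<N. p (Inl i) *\<^sub>R \<phi> (unit_vec i))" for p
    by (simp add: sumM G_def)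
  have pencil_cong: "pencil s x y = pencil s x' y'"
    if "\<And>i. i < N \<Longrightarrow> x i = x' i" "\<And>j. j < m \<Longrightarrow> y j = y' j" for s x y x' y'
    using that by (simp add: pencil_def)
  obtain x0 y0 where x0: "x0 \<in> topspace (Euclidean_space N)" "y0 \<in> topspace (Euclidean_space m)"
    "nonneg_form {..<d} (pencil 1 x0 y0)" "\<phi> x0 = 0"
    using K0 TE unfolding K by (metis image_iff)
  have "lin_rep K M I S G"
  proof (rule lin_repI)
    show "finite M" "finite I" by (simp_all add: M_def I_def)
    show "symm_on I (S k)" if "k \<in> M" for k
      using that A B C by (auto simp: symm_on_def S_def I_def M_def symmetric_matrix_def)
  next
    fix p assume "nonneg_form I (comb M S p)"
    then have s: "0 \<le> p (Inr None)"
      and n: "nonneg_form {..<d} (pencil (p (Inr None)) (\<lambda>i. p (Inl i)) (\<lambda>j. p (Inr (Some j))))"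
      by (simp_all add: nonneg)
    define s where "s = p (Inr None)"
    define x where "x = (\<lambda>i. if i < N then p (Inl i) else 0)"
    define y where "y = (\<lambda>j. if j < m then p (Inr (Some j)) else 0)"
    have x: "x \<in> topspace (Euclidean_space N)" and y: "y \<in> topspace (Euclidean_space m)"
      by (simp_all add: top x_def y_def)
    have G: "(\<Sum>k\<in>M. p k *\<^sub>R G k) = \<phi> x"
      unfolding sumG expand[OF x] by (simp add: x_def)
    have n': "nonneg_form {..<d} (pencil s x y)"
      using n pencil_cong[of "\<lambda>i. p (Inl i)" x "\<lambda>j. p (Inr (Some j))" y s] by (simp add: s_def x_def y_def)
    show "(\<Sum>k\<in>M. p k *\<^sub>R G k) \<in> K"
    proof (cases "s = 0")
      \<comment> \<open>Here \<open>x\<close> is a recession direction. Adding it to a feasible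
        point above \<open>0\<close> gives a feasible point with the same image as
        \<open>x\<close>.\<close>
      case True
      let ?x = "\<lambda>i. x0 i + x i" and ?y = "\<lambda>i. y0 i + y i"
      have "pencil 1 ?x ?y = (\<lambda>r t. pencil 1 x0 y0 r t + pencil s x y r t)"
        using True by (intro ext) (simp add: pencil_def algebra_simps sum.distrib)
      then have "qf {..<d} (pencil 1 ?x ?y) v v = qf {..<d} (pencil 1 x0 y0) v v + qf {..<d} (pencil s x y) v v" for v
        by (simp add: qf_def algebra_simps sum.distrib)
      then have "nonneg_form {..<d} (pencil 1 ?x ?y)"
        using x0(3) n' by (simp add: nonneg_form_def)
      then have "?x \<in> T" using x y x0 by (intro TI[of _ ?y]) (auto simp: top)
      then have "\<phi> ?x \<in> K" by (simp add: K)
      moreover have "\<phi> ?x = \<phi> x0 + \<phi> x"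
        using iso x x0 by (simp add: linear_isomorphism_def)
      ultimately show ?thesis using x0(4) G by simp
    next
      case False
      then have sp: "s > 0" using s by (simp add: s_def)
      let ?x = "\<lambda>i. inverse s * x i" and ?y = "\<lambda>i. inverse s * y i"
      have "pencil 1 ?x ?y = (\<lambda>r t. inverse s * pencil s x y r t)"
        using sp by (intro ext) (simp add: pencil_def algebra_simps sum_distrib_left)
      then have "qf {..<d} (pencil 1 ?x ?y) v v = inverse s * qf {..<d} (pencil s x y) v v" for v
        by (simp add: qf_def algebra_simps sum_distrib_left)
      then have "nonneg_form {..<d} (pencil 1 ?x ?y)"
        using n' sp by (simp add: nonneg_form_def)
      then have "?x \<in> T" using x y by (intro TI[of _ ?y]) (auto simp: top)
      then have "\<phi> ?x \<in> K" by (simp add: K)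
      moreover have "\<phi> ?x = inverse s *\<^sub>R \<phi> x"
        using iso x by (simp add: linear_isomorphism_def)
      ultimately show ?thesis using cone[of "\<phi> ?x" s] sp G by simp
    qed
  next
    fix g assume "g \<in> K"
    then obtain x where x: "x \<in> T" "g = \<phi> x" by (auto simp: K)
    then obtain y where y: "x \<in> topspace (Euclidean_space N)" "nonneg_form {..<d} (pencil 1 x y)"
      using TE by blast
    define p where "p = (\<lambda>k. case k of Inl i \<Rightarrow> x i | Inr None \<Rightarrow> 1 | Inr (Some j) \<Rightarrow> y j)"
    have "nonneg_form I (comb M S p)" using y by (simp add: nonneg p_def)
    moreover have "g = (\<Sum>k\<in>M. p k *\<^sub>R G k)"
      unfolding sumG by (simp add: p_def x(2) expand[OF y(1)])
    ultimately show "\<exists>p. nonneg_form I (comb M S p) \<and> g = (\<Sum>k\<in>M. p k *\<^sub>R G k)" by blast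
  qed
  then show ?thesis by blast
qed

section \<open>Generic certificates\<close>

lemma Const_power: "Const t ^ k = Const (t ^ k)"
  by (rule unital_hom_power[OF unital_hom_Const, symmetric])

lemma poly_Const_eq: "poly q (Const t) = (\<Sum>k\<le>degree q. t ^ k *\<^sub>R coeff q k)"
  by (simp add: poly_altdef Const_power mult.commute flip: Const_mult)

lemma lookup_poly_Const_bounded:
  assumes "0 \<le> t" "t \<le> 1"
  shows "\<bar>Poly_Mapping.lookup (poly q (Const t)) m\<bar> \<le> (\<Sum>k\<le>degree q. \<bar>Poly_Mapping.lookup (coeff q k) m\<bar>)"
proof -
  have "\<bar>Poly_Mapping.lookup (poly q (Const t)) m\<bar> = \<bar>\<Sum>k\<le>degree q. t ^ k * Poly_Mapping.lookup (coeff q k) m\<bar>"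
    by (simp add: poly_Const_eq lookup_sum)
  also have "\<dots> \<le> (\<Sum>k\<le>degree q. \<bar>t ^ k * Poly_Mapping.lookup (coeff q k) m\<bar>)"
    by (rule sum_abs)
  also have "\<dots> \<le> (\<Sum>k\<le>degree q. \<bar>Poly_Mapping.lookup (coeff q k) m\<bar>)"
    using assms by (intro sum_mono) (simp add: abs_mult mult_left_le_one_le power_le_one)
  finally show ?thesis .
qed

lemma unital_hom_poly: "unital_hom (\<lambda>p. poly p a)"
  by (rule unital_homI) simp_all

section \<open>The homogenization under specialization and substitution\<close>

lemma keys_homogenization:
  assumes "m \<in> Poly_Mapping.keys (homogenization f)"
  shows "monom_degree m = total_degree f"
proof -
  let ?h = "homogenization f"
  have h: "homogeneous ?h" "total_degree ?h = total_degree f"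
    using is_homogenization_homogenization[of f] by (auto simp: is_homogenization_def)
  obtain d where d: "\<And>m. m \<in> Poly_Mapping.keys ?h \<Longrightarrow> monom_degree m = d"
    using h(1) by (auto simp: homogeneous_def)
  have "monom_degree ` Poly_Mapping.keys ?h = {d}" using d assms by auto
  then have "total_degree ?h = d" by (simp add: total_degree_def)
  then show ?thesis using d[OF assms] h(2) by simp
qed

lemma eval_homogenization: "eval_mpoly Const (case_option 1 Var) (homogenization f) = f"
  using is_homogenization_homogenization[of f] by (simp add: is_homogenization_def)

lemma eval_homogenization_scaled:
  "eval_mpoly c (case_option t (\<lambda>i. t * v i)) (homogenization f)
    = t ^ total_degree f * eval_mpoly c (case_option 1 v) (homogenization f)"
proof -
  have "case_option t (\<lambda>i. t * v i) = (\<lambda>j. t * case_option 1 v j)"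
    by (auto split: option.splits)
  then show ?thesis by (simp add: eval_mpoly_homogeneous[OF keys_homogenization])
qed

lemma poly_shifted_homogenization:
  "poly (shifted_homogenization f y) (Const t)
    = eval_mpoly Const (case_option (Const t) (\<lambda>i. Var i - Const (y $ i))) (homogenization f)"
proof -
  have "(\<lambda>j. poly (case_option [:0, 1:] (\<lambda>i. [:Var i - Const (y $ i):]) j) (Const t))
    = case_option (Const t) (\<lambda>i. Var i - Const (y $ i))"
    by (auto split: option.splits)
  then show ?thesis
    unfolding shifted_homogenization_def
    by (subst unital_hom_eval_commute[OF unital_hom_poly]) simp
qed

text \<open>For positive \<open>t\<close> this makes the specialization nonnegative, since it is a
  positive multiple of a value of \<open>f\<close>.\<close>

lemma value_at_shifted_homogenization:
  assumes "t \<noteq> 0"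
  shows "value_at (poly (shifted_homogenization f y) (Const t)) x
    = t ^ total_degree f * value_at f ((1 / t) *\<^sub>R (x - y))"
proof -
  let ?z = "(1 / t) *\<^sub>R (x - y)" and ?h = "homogenization f"
  note vh = unital_hom_value_at[of x] and vz = unital_hom_value_at[of ?z]
  have vC: "value_at (Const a) w = a" and vV: "value_at (Var i) w = w $ i" for a i and w :: "real ^ 'a"
    by (simp_all add: value_at_def eval_mpoly_Const eval_mpoly_Var unital_hom_id)
  have "value_at (poly (shifted_homogenization f y) (Const t)) x
    = eval_mpoly (\<lambda>a. a) (case_option t (\<lambda>i. x $ i - y $ i)) ?h"
  proof -
    have "(\<lambda>j. value_at (case_option (Const t) (\<lambda>i. Var i - Const (y $ i)) j) x)
      = case_option t (\<lambda>i. x $ i - y $ i)"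
      by (auto simp: vC vV unital_hom_diff[OF vh] split: option.splits)
    then show ?thesis
      unfolding poly_shifted_homogenization by (subst unital_hom_eval_commute[OF vh]) (simp add: vC)
  qed
  also have "case_option t (\<lambda>i. x $ i - y $ i) = case_option t (\<lambda>i. t * (?z $ i))"
    using assms by (auto split: option.splits)
  also have "eval_mpoly (\<lambda>a. a) (case_option t (\<lambda>i. t * (?z $ i))) ?h
    = t ^ total_degree f * eval_mpoly (\<lambda>a. a) (case_option 1 (\<lambda>i. ?z $ i)) ?h"
    by (rule eval_homogenization_scaled)
  also have "eval_mpoly (\<lambda>a. a) (case_option 1 (\<lambda>i. ?z $ i)) ?h = value_at f ?z"
  proof -
    have eq: "(\<lambda>j. value_at (case_option 1 Var j) ?z) = case_option 1 (\<lambda>i. ?z $ i)"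
      by (auto simp: vV unital_homD[OF vz] split: option.splits)
    have "value_at (eval_mpoly Const (case_option 1 Var) ?h) ?z
      = eval_mpoly (\<lambda>a. a) (case_option 1 (\<lambda>i. ?z $ i)) ?h"
      by (simp only: unital_hom_eval_commute[OF vz] eq vC)
    then show ?thesis by (simp add: eval_homogenization)
  qed
  finally show ?thesis .
qed

text \<open>Along the line through \<open>y\<close> the shift cancels, and homogeneity extracts the
  power of \<open>t\<close>.\<close>

lemma substitute_shifted_homogenization:
  "eval_mpoly Const (\<lambda>j. Const (y $ j) + Const t * Var j) (poly (shifted_homogenization f y) (Const t))
    = t ^ total_degree f *\<^sub>R f"
proof -
  let ?s = "eval_mpoly Const (\<lambda>j. Const (y $ j) + Const t * Var j)"
  have hs: "unital_hom ?s" by (rule unital_hom_eval_mpoly[OF unital_hom_Const])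
  have "(\<lambda>j. ?s (case_option (Const t) (\<lambda>i. Var i - Const (y $ i)) j))
    = case_option (Const t) (\<lambda>i. Const t * Var i)"
    by (auto simp: unital_hom_diff[OF hs] eval_mpoly_Const[OF unital_hom_Const]
        eval_mpoly_Var[OF unital_hom_Const] split: option.splits)
  then have "?s (poly (shifted_homogenization f y) (Const t))
    = eval_mpoly Const (case_option (Const t) (\<lambda>i. Const t * Var i)) (homogenization f)"
    unfolding poly_shifted_homogenization
    by (subst unital_hom_eval_commute[OF hs]) (simp add: eval_mpoly_Const[OF unital_hom_Const])
  also have "\<dots> = Const t ^ total_degree f * f"
    by (simp add: eval_homogenization_scaled eval_homogenization)
  also have "\<dots> = t ^ total_degree f *\<^sub>R f"
    by (simp add: Const_mult Const_power)
  finally show ?thesis .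
qed

lemma fps_mult_nth_cong:
  assumes "\<And>k. k \<le> n \<Longrightarrow> fps_nth a k = fps_nth a' k" "\<And>k. k \<le> n \<Longrightarrow> fps_nth b k = fps_nth b' k" "k \<le> n"
  shows "fps_nth (a * b) k = fps_nth (a' * b') k"
  unfolding fps_mult_nth using assms by (intro sum.cong) auto

lemma qf_mpoly_sum_of_squares:
  assumes "finite I" and b: "\<And>r s. r \<in> I \<Longrightarrow> s \<in> I \<Longrightarrow> T r s = (\<Sum>c\<in>I. b c r * b c s)"
  shows "(\<Sum>r\<in>I. \<Sum>s\<in>I. T r s *\<^sub>R (u r * u s)) = (\<Sum>c\<in>I. (\<Sum>r\<in>I. b c r *\<^sub>R (u r :: 'v mpoly))\<^sup>2)"
proof -
  have "(\<Sum>r\<in>I. \<Sum>s\<in>I. T r s *\<^sub>R (u r * u s)) = (\<Sum>r\<in>I. \<Sum>s\<in>I. \<Sum>c\<in>I. (b c r *\<^sub>R u r) * (b c s *\<^sub>R u s))"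
    by (intro sum.cong refl) (simp add: b scaleR_sum_left mpoly_scaleR_left mpoly_scaleR_right mult.commute)
  also have "\<dots> = (\<Sum>r\<in>I. \<Sum>c\<in>I. \<Sum>s\<in>I. (b c r *\<^sub>R u r) * (b c s *\<^sub>R u s))"
    by (intro sum.cong refl sum.swap)
  also have "\<dots> = (\<Sum>c\<in>I. \<Sum>r\<in>I. \<Sum>s\<in>I. (b c r *\<^sub>R u r) * (b c s *\<^sub>R u s))"
    by (rule sum.swap)
  finally show ?thesis by (simp add: power2_eq_square sum_product)
qed

text \<open>At a generic point, the dual certificate spreads, along the Taylor homomorphism, to a polynomial
  family of certificates that is exact up to order \<open>N\<close>.\<close>

lemma generic_certificate:
  fixes S :: "'m \<Rightarrow> 'i \<Rightarrow> 'i \<Rightarrow> real" and G :: "'m \<Rightarrow> 'n::finite mpoly"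
  assumes fin: "finite M" "finite I" and sym: "\<forall>i\<in>M. symm_on I (S i)"
    and slater: "\<mu> > 0" "\<And>x. \<mu> * (\<Sum>i\<in>I. (x i)\<^sup>2) \<le> qf I (comb M S p0) x x"
    and nonneg: "\<And>p. nonneg_form I (comb M S p) \<Longrightarrow> nonneg_mpoly (\<Sum>i\<in>M. p i *\<^sub>R G i)"
  shows "\<exists>y (P :: 'i \<Rightarrow> 'i \<Rightarrow> 'n mpoly poly) R. \<forall>i\<in>M. \<forall>t.
    (\<Sum>l\<in>I. \<Sum>r\<in>I. \<Sum>s\<in>I. S i r s *\<^sub>R (poly (P l r) (Const t) * poly (P l s) (Const t)))
    = eval_mpoly Const (\<lambda>j. Const (y $ j) + Const t * Var j) (G i) + t ^ Suc N *\<^sub>R poly (R i) (Const t)"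
proof -
  \<comment> \<open>Everything \<open>\<phi>\<close> has to fix: the matrix entries and the
    coefficients of the generators. Then \<open>\<phi>\<close> changes only the point and the
    certificate.\<close>
  define C where "C = (\<Union>i\<in>M. \<Union>r\<in>I. \<Union>s\<in>I. {S i r s}) \<union>
    (\<Union>i\<in>M. Poly_Mapping.lookup (G i) ` Poly_Mapping.keys (G i))"
  have "finite C" using fin by (auto simp: C_def)
  from generic_taylor_homomorphism[OF this]
  obtain \<phi> :: "real \<Rightarrow> 'n mpoly fps" and y0 where \<phi>: "\<phi> 0 = 0" "\<phi> 1 = 1" "\<And>a b. \<phi> (a + b) = \<phi> a + \<phi> b"
    "\<And>a b. \<phi> (a * b) = \<phi> a * \<phi> b" and \<phi>C: "\<And>c. c \<in> C \<Longrightarrow> \<phi> c = fps_const (Const c)"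
    and \<phi>y: "\<And>i. \<phi> (y0 i) = fps_const (Const (y0 i)) + fps_X * fps_const (Var i)"
    by blast
  have h\<phi>: "unital_hom \<phi>" by (rule unital_homI) (rule \<phi>)+
  define y :: "real ^ 'n" where "y = (\<chi> i. y0 i)"
  have "\<exists>V. \<forall>i\<in>M. value_at (G i) y = (\<Sum>l\<in>I. qf I (S i) (V l) (V l))"
  proof (rule slater_duality[OF fin sym slater])
    fix p assume "nonneg_form I (comb M S p)"
    then have "0 \<le> value_at (\<Sum>i\<in>M. p i *\<^sub>R G i) y" using nonneg by (simp add: nonneg_mpoly_def)
    then show "0 \<le> (\<Sum>i\<in>M. p i * value_at (G i) y)"
      by (simp add: unital_hom_sum[OF unital_hom_value_at] value_at_scaleR)
  qed
  then obtain V where V: "\<And>i. i \<in> M \<Longrightarrow> value_at (G i) y = (\<Sum>l\<in>I. qf I (S i) (V l) (V l))" by blast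
  \<comment> \<open>The truncation at order \<open>N\<close> of the image of the real number
    \<open>V l r\<close>.\<close>
  define P where "P = (\<lambda>l r. \<Sum>k\<le>N. monom (fps_nth (\<phi> (V l r)) k) k)"
  have P: "fps_nth (fps_of_poly (P l r)) k = fps_nth (\<phi> (V l r)) k" if "k \<le> N" for l r k
    using that by (simp add: P_def coeff_sum)
  \<comment> \<open>The generator at the moving point, with the indeterminate as time;
    \<open>W\<close> is what the truncated certificate gives instead.\<close>
  define H where "H = (\<lambda>i. eval_mpoly (\<lambda>a. [:Const a:]) (\<lambda>j. [:Const (y $ j), Var j:]) (G i))"
  define W where "W = (\<lambda>i. \<Sum>l\<in>I. \<Sum>r\<in>I. \<Sum>s\<in>I. P l r * [:Const (S i r s):] * P l s)"
  have hfps: "unital_hom fps_of_poly"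
    by (rule unital_homI) (simp_all add: fps_of_poly_add fps_of_poly_mult)
  have "\<exists>R. W i - H i = monom 1 (Suc N) * R" if i: "i \<in> M" for i
  proof -
    have "fps_of_poly (H i)
      = eval_mpoly (\<lambda>a. fps_const (Const a)) (\<lambda>j. fps_const (Const (y $ j)) + fps_X * fps_const (Var j)) (G i)"
      unfolding H_def by (subst unital_hom_eval_commute[OF hfps])
        (simp add: fps_of_poly_const fps_of_poly_pCons mult.commute)
    also have "\<dots> = eval_mpoly \<phi> (\<lambda>j. \<phi> (y $ j)) (G i)"
    proof -
      have "(\<lambda>j. \<phi> (y $ j)) = (\<lambda>j. fps_const (Const (y $ j)) + fps_X * fps_const (Var j))"
        by (simp add: y_def \<phi>y)
      moreover have "\<phi> (Poly_Mapping.lookup (G i) m) = fps_const (Const (Poly_Mapping.lookup (G i) m))"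
        if "m \<in> Poly_Mapping.keys (G i)" for m
        using that i by (intro \<phi>C) (auto simp: C_def)
      ultimately show ?thesis by (simp add: eval_mpoly_coeff_cong[of "G i" \<phi> "\<lambda>a. fps_const (Const a)"])
    qed
    also have "\<dots> = \<phi> (value_at (G i) y)"
      unfolding value_at_def by (rule unital_hom_eval_commute[OF h\<phi>, symmetric])
    also have "\<dots> = (\<Sum>l\<in>I. \<Sum>r\<in>I. \<Sum>s\<in>I. \<phi> (V l r) * \<phi> (S i r s) * \<phi> (V l s))"
      unfolding V[OF i] qf_def by (simp add: unital_hom_sum[OF h\<phi>] \<phi>(4))
    also have "\<dots> = (\<Sum>l\<in>I. \<Sum>r\<in>I. \<Sum>s\<in>I. \<phi> (V l r) * fps_const (Const (S i r s)) * \<phi> (V l s))"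
    proof -
      have "\<phi> (S i r s) = fps_const (Const (S i r s))" if "r \<in> I" "s \<in> I" for r s
        using that i by (intro \<phi>C) (auto simp: C_def)
      then show ?thesis by simp
    qed
    finally have HV: "fps_of_poly (H i)
      = (\<Sum>l\<in>I. \<Sum>r\<in>I. \<Sum>s\<in>I. \<phi> (V l r) * fps_const (Const (S i r s)) * \<phi> (V l s))" .
    have WP: "fps_of_poly (W i)
      = (\<Sum>l\<in>I. \<Sum>r\<in>I. \<Sum>s\<in>I. fps_of_poly (P l r) * fps_const (Const (S i r s)) * fps_of_poly (P l s))"
      by (simp only: W_def fps_of_poly_sum fps_of_poly_mult fps_of_poly_const)
    \<comment> \<open>Coefficients of a product up to order \<open>N\<close> depend only on those of
      the factors up to order \<open>N\<close>, so truncation is harmless in this range.\<close>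
    have "coeff (W i) k = coeff (H i) k" if k: "k \<le> N" for k
    proof -
      have "fps_nth (fps_of_poly (W i)) k = fps_nth (fps_of_poly (H i)) k"
        unfolding WP HV fps_sum_nth
        by (intro sum.cong refl fps_mult_nth_cong[of N]) (simp_all add: P k del: fps_of_poly_nth)
      then show ?thesis by simp
    qed
    then have "monom 1 (Suc N) dvd W i - H i"
      unfolding monom_1_dvd_iff' by simp
    then show ?thesis by (simp add: dvd_def)
  qed
  then obtain R where R: "\<And>i. i \<in> M \<Longrightarrow> W i - H i = monom 1 (Suc N) * R i" by metis
  have "(\<Sum>l\<in>I. \<Sum>r\<in>I. \<Sum>s\<in>I. S i r s *\<^sub>R (poly (P l r) (Const t) * poly (P l s) (Const t)))
    = eval_mpoly Const (\<lambda>j. Const (y $ j) + Const t * Var j) (G i) + t ^ Suc N *\<^sub>R poly (R i) (Const t)"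
    if i: "i \<in> M" for i t
  proof -
    have "W i = H i + monom 1 (Suc N) * R i" using R[OF i] by (simp add: algebra_simps)
    then have "poly (W i) (Const t) = poly (H i) (Const t) + t ^ Suc N *\<^sub>R poly (R i) (Const t)"
      by (simp add: poly_monom Const_power Const_mult del: power_Suc)
    moreover have "poly (H i) (Const t) = eval_mpoly Const (\<lambda>j. Const (y $ j) + Const t * Var j) (G i)"
      unfolding H_def by (subst unital_hom_eval_commute[OF unital_hom_poly]) simp
    moreover have "poly (W i) (Const t)
      = (\<Sum>l\<in>I. \<Sum>r\<in>I. \<Sum>s\<in>I. S i r s *\<^sub>R (poly (P l r) (Const t) * poly (P l s) (Const t)))"
      by (simp add: W_def poly_sum Const_mult mpoly_scaleR_left mpoly_scaleR_right mult.commute)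
    ultimately show ?thesis by simp
  qed
  then show ?thesis by blast
qed

section \<open>Closedness of the cone, bounded lifts, conclusion\<close>

text \<open>Membership in \<open>L\<close> is linear algebra from the values 1 and 2 of
  \<open>\<delta>\<close>; nonnegativity is the limit of small \<open>\<delta>\<close> at each
  point.\<close>

lemma nonneg_cone_closed:
  assumes L: "subspace L"
    and K: "\<And>\<delta>. \<delta> > 0 \<Longrightarrow> g + \<delta> *\<^sub>R g0 \<in> {g \<in> L. nonneg_mpoly g}"
  shows "g \<in> {g \<in> L. nonneg_mpoly g}"
proof -
  have g1: "g + g0 \<in> L" and g2: "g + 2 *\<^sub>R g0 \<in> L" using K[of 1] K[of 2] by simp_all
  have "2 *\<^sub>R (g + g0) - (g + 2 *\<^sub>R g0) \<in> L"
    by (rule subspace_diff[OF L subspace_scale[OF L g1] g2])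
  moreover have "2 *\<^sub>R (g + g0) - (g + 2 *\<^sub>R g0) = g"
    by (simp add: scaleR_add_right scaleR_2)
  ultimately have "g \<in> L" by simp
  moreover have "0 \<le> value_at g x" for x
  proof (rule ccontr)
    assume neg: "\<not> 0 \<le> value_at g x"
    have *: "0 \<le> value_at g x + \<delta> * value_at g0 x" if "\<delta> > 0" for \<delta>
      using K[OF that] by (simp add: nonneg_mpoly_def unital_homD[OF unital_hom_value_at] value_at_scaleR)
    \<comment> \<open>Small enough that the perturbation offsets at most half of the negative
      value.\<close>
    define \<delta> where "\<delta> = - value_at g x / (2 * (\<bar>value_at g0 x\<bar> + 1))"
    have d: "\<delta> > 0" unfolding \<delta>_def by (rule divide_pos_pos) (use neg in auto)
    have "\<delta> * value_at g0 x \<le> \<delta> * (\<bar>value_at g0 x\<bar> + 1)"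
      using d by (intro mult_left_mono) auto
    also have "\<dots> = - value_at g x / 2" by (simp add: \<delta>_def field_simps)
    finally show False using *[OF d] neg by simp
  qed
  ultimately show ?thesis by (simp add: nonneg_mpoly_def)
qed

text \<open>Feasible parameters with zero image form the common zero set of functions homogeneous of
  degree 1: the coefficients of the image and the negative parts \<open>min 0\<close> of the values
  of the form. \<open>pointed\<close> says that this set is trivial, so
  \<open>homogeneous_bounded\<close> applies.\<close>

lemma lifts_bounded:
  fixes G :: "'m \<Rightarrow> 'n::finite mpoly" and p :: "nat \<Rightarrow> 'm \<Rightarrow> real"
  assumes "finite M"
    and psd: "\<And>k. nonneg_form I (comb M S (p k))"
    and bd: "\<And>m. \<exists>C. \<forall>k. \<bar>Poly_Mapping.lookup (\<Sum>i\<in>M. p k i *\<^sub>R G i) m\<bar> \<le> C"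
    and pointed: "\<And>p. nonneg_form I (comb M S p) \<Longrightarrow> (\<Sum>i\<in>M. p i *\<^sub>R G i) = 0 \<Longrightarrow> \<forall>i\<in>M. p i = 0"
  shows "\<exists>B. \<forall>k. \<forall>i\<in>M. \<bar>p k i\<bar> \<le> B"
proof -
  define h where "h = (\<lambda>l p. case l of
      Inl m \<Rightarrow> \<Sum>i\<in>M. p i * Poly_Mapping.lookup (G i) m
    | Inr x \<Rightarrow> min 0 (\<Sum>i\<in>M. p i * qf I (S i) x x))"
  show ?thesis
  proof (rule homogeneous_bounded[where h = h and e = 1])
    fix l :: "('n \<Rightarrow>\<^sub>0 nat) + ('a \<Rightarrow> real)" and q :: "'m \<Rightarrow> real" and c :: real
    assume "c > 0"
    then show "h l (\<lambda>i. c * q i) = c ^ 1 * h l q"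
      by (cases l) (simp_all add: h_def sum_distrib_left mult.assoc min_mult_distrib_left)
  next
    fix l and q and r :: "nat \<Rightarrow> 'm \<Rightarrow> real"
    assume "\<And>i. i \<in> M \<Longrightarrow> (\<lambda>k. r k i) \<longlonglongrightarrow> q i"
    then show "(\<lambda>k. h l (r k)) \<longlonglongrightarrow> h l q"
      by (cases l) (auto simp: h_def intro!: tendsto_intros)
  next
    fix l
    show "\<exists>C. \<forall>k. \<bar>h l (p k)\<bar> \<le> C"
    proof (cases l)
      case (Inl m)
      then show ?thesis using bd[of m] by (simp add: h_def lookup_sum)
    next
      case (Inr x)
      then show ?thesis
        using nonneg_formD[OF psd] by (auto simp: h_def qf_comb intro!: exI[of _ 0])
    qed
  next
    fix q assume z: "\<And>l. h l q = 0"
    show "\<forall>i\<in>M. q i = 0"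
    proof (rule pointed)
      have "0 \<le> (\<Sum>i\<in>M. q i * qf I (S i) x x)" for x
        using z[of "Inr x"] by (simp add: h_def)
      then show "nonneg_form I (comb M S q)" by (simp add: nonneg_form_def qf_comb)
      show "(\<Sum>i\<in>M. q i *\<^sub>R G i) = 0"
        using z[of "Inl _"] by (intro poly_mapping_eqI) (simp add: h_def lookup_sum)
    qed
  qed (use assms(1) in auto)
qed

theorem theorem2p14:
  fixes L :: "'n::finite mpoly set" and f :: "'n mpoly"
  assumes "subspace L"
    and "\<exists>B. finite B \<and> span B = L"
    and "1 \<in> L"
    and "nonneg_mpoly f"
    and "\<not> sum_of_squares f"
    and "\<And>y k. coeff (shifted_homogenization f y) k \<in> L"
  shows "\<not> spectrahedral_shadow_in L {g \<in> L. nonneg_mpoly g}"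
proof
  define K where "K = {g \<in> L. nonneg_mpoly g}"
  assume "spectrahedral_shadow_in L {g \<in> L. nonneg_mpoly g}"
  then have shadow: "spectrahedral_shadow_in L K" by (simp add: K_def)
  note L = assms(1)
  have v0: "value_at 0 x = 0" for x :: "real ^ 'n" by (rule unital_homD(1)[OF unital_hom_value_at])
  have "0 \<in> K" using subspace_0[OF L] by (simp add: K_def nonneg_mpoly_def v0)
  moreover have "c *\<^sub>R g \<in> K" if "g \<in> K" "c > 0" for g c
    using that subspace_scale[OF L] by (simp add: K_def nonneg_mpoly_def value_at_scaleR)
  ultimately obtain M0 :: "(nat + nat option) set" and I0 :: "nat option set" and S0 G0
    where "lin_rep K M0 I0 S0 G0"
    using spectrahedral_shadow_lin_rep[OF shadow] by blast
  from lin_rep_normal_form[OF this] nonneg_cone_closed[OF L, folded K_def]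
  obtain M :: "(nat + nat option) set" and I :: "nat option set" and S G p0 \<mu> where rep: "lin_rep K M I S G"
    and slater: "\<mu> > 0" "\<And>x. \<mu> * (\<Sum>i\<in>I. (x i)\<^sup>2) \<le> qf I (comb M S p0) x x"
    and pointed: "\<And>p. nonneg_form I (comb M S p) \<Longrightarrow> (\<Sum>i\<in>M. p i *\<^sub>R G i) = 0 \<Longrightarrow> \<forall>i\<in>M. p i = 0"
    by blast
  note rep = lin_repD[OF rep]
  define e where "e = total_degree f"
  have "nonneg_mpoly (\<Sum>i\<in>M. p i *\<^sub>R G i)" if "nonneg_form I (comb M S p)" for p
    using rep(4)[OF that] by (simp add: K_def)
  from generic_certificate[OF rep(1-3) slater this, of e]
  obtain y :: "real ^ 'n" and P :: "nat option \<Rightarrow> nat option \<Rightarrow> 'n mpoly poly" and R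
    where cert: "\<And>i t. i \<in> M \<Longrightarrow>
      (\<Sum>l\<in>I. \<Sum>r\<in>I. \<Sum>s\<in>I. S i r s *\<^sub>R (poly (P l r) (Const t) * poly (P l s) (Const t)))
      = eval_mpoly Const (\<lambda>j. Const (y $ j) + Const t * Var j) (G i) + t ^ Suc e *\<^sub>R poly (R i) (Const t)"
    by blast
  \<comment> \<open>Specializations of \<open>t\<close> tending to zero within the interval (0, 1],
    as the coefficient bounds require.\<close>
  define \<tau> where "\<tau> = (\<lambda>k. inverse (real (Suc k)))"
  have \<tau>: "0 < \<tau> k" "\<tau> k \<le> 1" for k by (simp_all add: \<tau>_def inverse_le_1_iff)
  define g where "g = (\<lambda>k. poly (shifted_homogenization f y) (Const (\<tau> k)))"
  have "g k \<in> K" for k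
  proof -
    have "g k \<in> L"
      unfolding g_def poly_Const_eq by (intro subspace_sum[OF L] subspace_scale[OF L] assms(6))
    moreover have "0 \<le> value_at (g k) x" for x
      using \<tau>(1)[of k] assms(4) by (simp add: g_def value_at_shifted_homogenization nonneg_mpoly_def)
    ultimately show ?thesis by (simp add: K_def nonneg_mpoly_def)
  qed
  then have "\<forall>k. \<exists>p. nonneg_form I (comb M S p) \<and> g k = (\<Sum>i\<in>M. p i *\<^sub>R G i)"
    using rep(5) by blast
  then obtain p where p: "\<And>k. nonneg_form I (comb M S (p k))" "\<And>k. g k = (\<Sum>i\<in>M. p k i *\<^sub>R G i)"
    by metis
  have "\<exists>B. \<forall>k. \<forall>i\<in>M. \<bar>p k i\<bar> \<le> B"
  proof (rule lifts_bounded[OF rep(1) p(1) _ pointed])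
    show "\<exists>C. \<forall>k. \<bar>Poly_Mapping.lookup (\<Sum>i\<in>M. p k i *\<^sub>R G i) m\<bar> \<le> C" for m
      unfolding p(2)[symmetric] g_def
      using lookup_poly_Const_bounded less_imp_le[OF \<tau>(1)] \<tau>(2) by blast
  qed
  then obtain B where B: "\<And>k i. i \<in> M \<Longrightarrow> \<bar>p k i\<bar> \<le> B" by blast
  have "\<forall>k. \<exists>b. \<forall>r\<in>I. \<forall>s\<in>I. comb M S (p k) r s = (\<Sum>c\<in>I. b c r * b c s)"
    using nonneg_form_factor[OF rep(2) symm_on_comb[OF rep(3)] p(1)] by blast
  then obtain b where b: "\<And>k r s. r \<in> I \<Longrightarrow> s \<in> I \<Longrightarrow> comb M S (p k) r s = (\<Sum>c\<in>I. b k c r * b k c s)"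
    by metis
  define u where "u = (\<lambda>k l r. poly (P l r) (Const (\<tau> k)))"
  define E where "E = (\<lambda>k. \<Sum>i\<in>M. p k i *\<^sub>R poly (R i) (Const (\<tau> k)))"
  \<comment> \<open>The certificate is linear in the generators, so it can be paired with the lift
    \<open>p k\<close>. One side becomes a sum of squares through the factorization
    \<open>b k\<close>; the other is the substituted \<open>g k\<close> plus the truncation
    error.\<close>
  have main: "(\<Sum>l\<in>I. \<Sum>c\<in>I. (\<Sum>r\<in>I. b k c r *\<^sub>R u k l r)\<^sup>2) = \<tau> k ^ e *\<^sub>R f + \<tau> k ^ Suc e *\<^sub>R E k" for k
  proof -
    let ?s = "eval_mpoly Const (\<lambda>j. Const (y $ j) + Const (\<tau> k) * Var j)"
    have hs: "unital_hom ?s" by (rule unital_hom_eval_mpoly[OF unital_hom_Const])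
    have sG: "(\<Sum>i\<in>M. p k i *\<^sub>R ?s (G i)) = ?s (\<Sum>i\<in>M. p k i *\<^sub>R G i)"
      unfolding unital_hom_sum[OF hs] eval_mpoly_scaleR[OF unital_hom_Const] by (simp add: Const_mult)
    have "(\<Sum>l\<in>I. \<Sum>c\<in>I. (\<Sum>r\<in>I. b k c r *\<^sub>R u k l r)\<^sup>2)
      = (\<Sum>l\<in>I. \<Sum>r\<in>I. \<Sum>s\<in>I. comb M S (p k) r s *\<^sub>R (u k l r * u k l s))"
      by (intro sum.cong refl qf_mpoly_sum_of_squares[symmetric] rep(2) b)
    also have "\<dots> = (\<Sum>l\<in>I. \<Sum>r\<in>I. \<Sum>s\<in>I. \<Sum>i\<in>M. p k i *\<^sub>R (S i r s *\<^sub>R (u k l r * u k l s)))"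
      by (simp add: comb_def scaleR_sum_left)
    also have "\<dots> = (\<Sum>l\<in>I. \<Sum>r\<in>I. \<Sum>i\<in>M. \<Sum>s\<in>I. p k i *\<^sub>R (S i r s *\<^sub>R (u k l r * u k l s)))"
      by (intro sum.cong refl sum.swap)
    also have "\<dots> = (\<Sum>l\<in>I. \<Sum>i\<in>M. \<Sum>r\<in>I. \<Sum>s\<in>I. p k i *\<^sub>R (S i r s *\<^sub>R (u k l r * u k l s)))"
      by (intro sum.cong refl sum.swap)
    also have "\<dots> = (\<Sum>i\<in>M. \<Sum>l\<in>I. \<Sum>r\<in>I. \<Sum>s\<in>I. p k i *\<^sub>R (S i r s *\<^sub>R (u k l r * u k l s)))"
      by (rule sum.swap)
    also have "\<dots> = (\<Sum>i\<in>M. p k i *\<^sub>R (?s (G i) + \<tau> k ^ Suc e *\<^sub>R poly (R i) (Const (\<tau> k))))"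
      unfolding u_def by (intro sum.cong refl) (simp only: cert[symmetric] scaleR_sum_right)
    also have "\<dots> = ?s (\<Sum>i\<in>M. p k i *\<^sub>R G i) + \<tau> k ^ Suc e *\<^sub>R E k"
      unfolding sG[symmetric] E_def scaleR_add_right sum.distrib scaleR_sum_right
      by (simp only: scaleR_left_commute)
    also have "?s (\<Sum>i\<in>M. p k i *\<^sub>R G i) = \<tau> k ^ e *\<^sub>R f"
      unfolding p(2)[symmetric] g_def e_def by (rule substitute_shifted_homogenization)
    finally show ?thesis .
  qed
  \<comment> \<open>The real square root of the positive scalar is absorbed into the squares, so the
    parity of \<open>e\<close> does not matter.\<close>
  define Q where "Q = (\<lambda>k (l, c). inverse (sqrt (\<tau> k ^ e)) *\<^sub>R (\<Sum>r\<in>I. b k c r *\<^sub>R u k l r))"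
  have sumQ: "(\<Sum>j\<in>I \<times> I. (Q k j)\<^sup>2) = f + \<tau> k *\<^sub>R E k" for k
  proof -
    have t: "\<tau> k ^ e > 0" using \<tau>(1) by simp
    have "(Q k (l, c))\<^sup>2 = inverse (\<tau> k ^ e) *\<^sub>R (\<Sum>r\<in>I. b k c r *\<^sub>R u k l r)\<^sup>2" for l c
      using t by (simp add: Q_def power2_eq_square mpoly_scaleR_left mpoly_scaleR_right
          flip: inverse_mult_distrib)
    moreover have "(\<Sum>j\<in>I \<times> I. (Q k j)\<^sup>2) = (\<Sum>l\<in>I. \<Sum>c\<in>I. (Q k (l, c))\<^sup>2)"
      by (simp add: sum.cartesian_product case_prod_unfold)
    ultimately have "(\<Sum>j\<in>I \<times> I. (Q k j)\<^sup>2)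
      = inverse (\<tau> k ^ e) *\<^sub>R (\<Sum>l\<in>I. \<Sum>c\<in>I. (\<Sum>r\<in>I. b k c r *\<^sub>R u k l r)\<^sup>2)"
      by (simp add: scaleR_sum_right)
    also have "\<dots> = f + \<tau> k *\<^sub>R E k"
      unfolding main using t \<tau>(1)[of k] by (simp add: scaleR_add_right)
    finally show ?thesis .
  qed
  \<comment> \<open>Since the certificate was truncated, finitely many exponents suffice for all
    \<open>k\<close> at once.\<close>
  define X where "X = (\<Union>l\<in>I. \<Union>r\<in>I. \<Union>k\<le>degree (P l r). Poly_Mapping.keys (coeff (P l r) k))"
  have "sum_of_squares f"
  proof (rule sum_of_squares_closed[of "I \<times> I" X Q])
    show "finite (I \<times> I)" "finite X" using rep(2) by (auto simp: X_def)
  next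
    fix k and j :: "nat option \<times> nat option"
    assume j: "j \<in> I \<times> I"
    obtain l c where lc: "j = (l, c)" by (cases j)
    have "Poly_Mapping.lookup (Q k j) m = 0" if m: "m \<notin> X" for m
    proof -
      have "Poly_Mapping.lookup (u k l r) m = 0" if "r \<in> I" for r
      proof -
        have "Poly_Mapping.lookup (coeff (P l r) i) m = 0" if "i \<le> degree (P l r)" for i
          using m j lc that \<open>r \<in> I\<close> by (auto simp: X_def in_keys_iff)
        then show ?thesis by (simp add: u_def poly_Const_eq lookup_sum)
      qed
      then show ?thesis by (simp add: lc Q_def lookup_sum)
    qed
    then show "Poly_Mapping.keys (Q k j) \<subseteq> X" by (auto simp: in_keys_iff)
  next
    fix m
    define C where "C = (\<lambda>i. \<Sum>k\<le>degree (R i). \<bar>Poly_Mapping.lookup (coeff (R i) k) m\<bar>)"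
    have "\<bar>Poly_Mapping.lookup (E k) m\<bar> \<le> (\<Sum>i\<in>M. B * C i)" for k
    proof -
      have "\<bar>Poly_Mapping.lookup (E k) m\<bar> \<le> (\<Sum>i\<in>M. \<bar>p k i * Poly_Mapping.lookup (poly (R i) (Const (\<tau> k))) m\<bar>)"
        unfolding E_def lookup_sum lookup_scaleR real_scaleR_def by (rule sum_abs)
      also have "\<dots> \<le> (\<Sum>i\<in>M. B * C i)"
      proof (rule sum_mono)
        fix i assume i: "i \<in> M"
        show "\<bar>p k i * Poly_Mapping.lookup (poly (R i) (Const (\<tau> k))) m\<bar> \<le> B * C i"
          unfolding abs_mult C_def
          using B[OF i, of k] \<tau>[of k] by (intro mult_mono lookup_poly_Const_bounded) auto
      qed
      finally show ?thesis .
    qed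
    then have bd: "norm (\<tau> k * Poly_Mapping.lookup (E k) m) \<le> \<tau> k * (\<Sum>i\<in>M. B * C i)" for k
      using \<tau>(1)[of k] by (simp add: abs_mult)
    have "\<tau> \<longlonglongrightarrow> 0" unfolding \<tau>_def by (rule LIMSEQ_inverse_real_of_nat)
    then have "(\<lambda>k. \<tau> k * (\<Sum>i\<in>M. B * C i)) \<longlonglongrightarrow> 0" by (rule tendsto_mult_left_zero)
    then have "(\<lambda>k. \<tau> k * Poly_Mapping.lookup (E k) m) \<longlonglongrightarrow> 0"
      by (rule Lim_null_comparison[OF always_eventually, rotated]) (intro allI bd)
    then have "(\<lambda>k. Poly_Mapping.lookup f m + \<tau> k * Poly_Mapping.lookup (E k) m) \<longlonglongrightarrow> Poly_Mapping.lookup f m + 0"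
      by (intro tendsto_add tendsto_const)
    then show "(\<lambda>k. Poly_Mapping.lookup (\<Sum>j\<in>I \<times> I. (Q k j)\<^sup>2) m) \<longlonglongrightarrow> Poly_Mapping.lookup f m"
      by (simp add: sumQ lookup_add)
  qed
  then show False using assms(5) by contradiction
qed

end
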